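(* Let $s=-\sqrt[3]{2}$, let $t$ be a primitive third root of unity, and let $K=\mathbb{Q}(s,t)$. Let $I_{E6}\subset K[x_0,x_1,x_2]$ be the homogeneous defining (radical) ideal of the set $\mathcal{B}_{E6}$ of triple points of the Elliptified Böröczky configuration $\mathcal{L}$ associated with the $6$-torsion points of the Fermat cubic $E: x_0^3+x_1^3+x_2^3=0$. Then $$I_{E6}^{(3)}\not\subseteq I_{E6}^2 .$$ In particular, the product of the linear forms defining the ($18$) distinct lines of $\mathcal{L}$ belongs to $I_{E6}^{(3)}$ but not to $I_{E6}^2$.
   Context: $E\subset\mathbb{P}^2$ is the elliptic curve $x_0^3+x_1^3+x_2^3=0$ with the group law whose identity is the flex $[1:-1:0]$. Its $6$-torsion subgroup $E[6]\cong\mathbb{Z}/6\times\mathbb{Z}/6$ is generated by $\alpha=[1:s:1]$ and $\beta=[s:1:t]$, and all $36$ of its points have coordinates in $K$. For integers $i_1,j_1,i_2,j_2$ (modulo $6$), $\ell(i_1,j_1,i_2,j_2)$ is the line through $i_1\alpha+j_1\beta$ and $i_2\alpha+j_2\beta$ if these points are distinct, and the tangent line to $E$ at $i_1\alpha+j_1\beta$ if they are equal. Put $L(i,j)=\ell(i,j,3-2i,3-2j)$ and $\mathcal{L}=\{L(i,j):0\le i,j\le 5\}$; as a set of lines in $\mathbb{P}^2$ it has $18$ distinct elements. $\mathcal{B}_{E6}$ is the set of points of $\mathbb{P}^2$ lying on exactly three distinct lines of $\mathcal{L}$. $I^{(3)}$ denotes the third symbolic power: for the radical ideal $I$ of a finite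 set of $K$-rational points, $I^{(3)}=\bigcap_P I(P)^3$, where $P$ runs over the points and $I(P)$ is the homogeneous ideal of $P$. *)

theory Defs
  imports "HOL-Analysis.Analysis" "HOL-Library.Poly_Mapping" "HOL-Algebra.Group"
begin

section \<open>The field K\<close>

text \<open>
  The subfield of the complex numbers generated by the real number \<open>- root 3 2\<close> and a primitive
  third root of unity. It does not depend on which of the two roots is adjoined, since they are
  inverse to each other.
\<close>

inductive_set KE6 :: "complex set" where
  gen_s: "- complex_of_real (root 3 2) \<in> KE6"
| gen_t: "cis (2 * pi / 3) \<in> KE6"
| one: "1 \<in> KE6"
| diff: "a \<in> KE6 \<Longrightarrow> b \<in> KE6 \<Longrightarrow> a - b \<in> KE6"
| mult: "a \<in> KE6 \<Longrightarrow> b \<in> KE6 \<Longrightarrow> a * b \<in> KE6"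
| inverse: "a \<in> KE6 \<Longrightarrow> inverse a \<in> KE6"

lemma KE6_zero: "0 \<in> KE6"
  using KE6.diff[OF KE6.one KE6.one] by simp

lemma KE6_uminus: "a \<in> KE6 \<Longrightarrow> - a \<in> KE6"
  using KE6.diff[OF KE6_zero] by fastforce

lemma KE6_add: "a \<in> KE6 \<Longrightarrow> b \<in> KE6 \<Longrightarrow> a + b \<in> KE6"
  using KE6.diff[of a "- b"] KE6_uminus by fastforce

lemma KE6_divide: "a \<in> KE6 \<Longrightarrow> b \<in> KE6 \<Longrightarrow> a / b \<in> KE6"
  by (simp add: divide_inverse KE6.mult KE6.inverse)

typedef K = KE6
  using KE6.one by blast

setup_lifting type_definition_K

instantiation K :: field
begin

lift_definition zero_K :: K is 0 by (rule KE6_zero)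
lift_definition one_K :: K is 1 by (rule KE6.one)
lift_definition uminus_K :: "K \<Rightarrow> K" is uminus by (rule KE6_uminus)
lift_definition plus_K :: "K \<Rightarrow> K \<Rightarrow> K" is "(+)" by (rule KE6_add)
lift_definition minus_K :: "K \<Rightarrow> K \<Rightarrow> K" is "(-)" by (rule KE6.diff)
lift_definition times_K :: "K \<Rightarrow> K \<Rightarrow> K" is "(*)" by (rule KE6.mult)
lift_definition inverse_K :: "K \<Rightarrow> K" is inverse by (rule KE6.inverse)
lift_definition divide_K :: "K \<Rightarrow> K \<Rightarrow> K" is "(/)" by (rule KE6_divide)

instance
  by standard (transfer; simp add: algebra_simps divide_inverse)+

end

instance K :: field_char_0
proof
  have of_nat: "Rep_K (of_nat n) = of_nat n" for n
    by (induction n) (simp_all add: zero_K.rep_eq one_K.rep_eq plus_K.rep_eq)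
  show "inj (of_nat :: nat \<Rightarrow> K)"
    by (rule injI) (metis of_nat of_nat_eq_iff)
qed


section \<open>Projective plane and polynomials in three variables\<close>

text \<open>
  A point of the projective plane is the set of all its homogeneous coordinate vectors.
  The coordinates \<open>x\<^sub>0, x\<^sub>1, x\<^sub>2\<close> are the components with index 1, 2, 3 of type \<open>3\<close>,
  so that \<open>vector [a, b, c]\<close> has homogeneous coordinates \<open>[a : b : c]\<close>.
\<close>

type_synonym 'k point = "('k ^ 3) set"

definition pt :: "'k::field ^ 3 \<Rightarrow> 'k point" where
  "pt v = {c *s v | c. c \<noteq> 0}"

definition P2 :: "'k::field point set" where
  "P2 = pt ` (- {0})"

definition line :: "'k::field ^ 3 \<Rightarrow> 'k point set" where
  "line a = {P \<in> P2. \<forall>x\<in>P. scalar_product a x = 0}"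

definition is_line :: "'k::field point set \<Rightarrow> bool" where
  "is_line l \<longleftrightarrow> (\<exists>a. a \<noteq> 0 \<and> l = line a)"

text \<open>
  The polynomial ring \<open>k[x\<^sub>0, x\<^sub>1, x\<^sub>2]\<close>: finitely supported maps from exponent vectors to
  coefficients, with the convolution product.
\<close>

type_synonym 'k poly3 = "(3 \<Rightarrow>\<^sub>0 nat) \<Rightarrow>\<^sub>0 'k"

definition peval :: "'k::field poly3 \<Rightarrow> 'k ^ 3 \<Rightarrow> 'k" where
  "peval p x = (\<Sum>m\<in>Poly_Mapping.keys p.
     Poly_Mapping.lookup p m * (\<Prod>i\<in>UNIV. x $ i ^ Poly_Mapping.lookup m i))"

definition homogeneous :: "nat \<Rightarrow> 'k::field poly3 \<Rightarrow> bool" where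
  "homogeneous d p \<longleftrightarrow>
     (\<forall>m\<in>Poly_Mapping.keys p. (\<Sum>i\<in>UNIV. Poly_Mapping.lookup m i) = d)"

definition linear_form_of :: "'k::field poly3 \<Rightarrow> 'k point set \<Rightarrow> bool" where
  "linear_form_of f l \<longleftrightarrow> homogeneous 1 f \<and> l = {P \<in> P2. \<forall>x\<in>P. peval f x = 0}"


section \<open>Ideals, ordinary and symbolic powers\<close>

lemma module_times: "module ((*) :: 'a::comm_ring_1 \<Rightarrow> 'a \<Rightarrow> 'a)"
  by unfold_locales (simp_all add: algebra_simps)

definition ideal_gen :: "'a::comm_ring_1 set \<Rightarrow> 'a set" where
  "ideal_gen S = module.span (*) S"

definition ideal_mult :: "'a::comm_ring_1 set \<Rightarrow> 'a set \<Rightarrow> 'a set" where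
  "ideal_mult I J = ideal_gen {a * b | a b. a \<in> I \<and> b \<in> J}"

primrec ideal_power :: "'a::comm_ring_1 set \<Rightarrow> nat \<Rightarrow> 'a set" where
  "ideal_power I 0 = UNIV"
| "ideal_power I (Suc n) = ideal_mult I (ideal_power I n)"

definition point_ideal :: "'k::field point set \<Rightarrow> 'k poly3 set" where
  "point_ideal Z = ideal_gen {f. (\<exists>d. homogeneous d f) \<and> (\<forall>P\<in>Z. \<forall>x\<in>P. peval f x = 0)}"

definition symbolic_power :: "'k::field point set \<Rightarrow> nat \<Rightarrow> 'k poly3 set" where
  "symbolic_power Z m = (\<Inter>P\<in>Z. ideal_power (point_ideal {P}) m)"


section \<open>The Fermat cubic and its group law\<close>

definition fermat :: "'k::field ^ 3 \<Rightarrow> 'k" where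
  "fermat x = (\<Sum>i\<in>UNIV. x $ i ^ 3)"

definition fermat_curve :: "'k::field point set" where
  "fermat_curve = {P \<in> P2. \<forall>x\<in>P. fermat x = 0}"

text \<open>The gradient of \<open>fermat\<close> at \<open>v\<close> is \<open>(\<chi> i. 3 * v $ i ^ 2)\<close>.\<close>

definition tangent_line :: "'k::field point \<Rightarrow> 'k point set" where
  "tangent_line P = {X \<in> P2. \<forall>v\<in>P. \<forall>x\<in>X. scalar_product (\<chi> i. 3 * v $ i ^ 2) x = 0}"

definition join_line :: "'k::field point \<Rightarrow> 'k point \<Rightarrow> 'k point set" where
  "join_line P Q =
     (if P = Q then tangent_line P else (THE l. is_line l \<and> P \<in> l \<and> Q \<in> l))"

text \<open>
  The line \<open>l\<close> cuts out the divisor \<open>P + Q + R\<close> on the cubic, i.e. it meets the cubic in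
  \<open>P, Q, R\<close> counted with intersection multiplicity: restricted to \<open>l\<close>, the cubic form is a
  product of three linear forms whose zeros on \<open>l\<close> are \<open>P\<close>, \<open>Q\<close> and \<open>R\<close>. Over an infinite
  field, equality of values on \<open>l\<close> is equality of binary forms; a constant factor is absorbed
  into one of the linear forms.
\<close>

definition cuts_out ::
    "'k::field point set \<Rightarrow> 'k point \<Rightarrow> 'k point \<Rightarrow> 'k point \<Rightarrow> bool" where
  "cuts_out l P Q R \<longleftrightarrow>
     (\<exists>a b c. l \<inter> line a = {P} \<and> l \<inter> line b = {Q} \<and> l \<inter> line c = {R} \<and>
        (\<forall>X\<in>l. \<forall>x\<in>X.
           fermat x = scalar_product a x * scalar_product b x * scalar_product c x))"

definition third_point :: "'k::field point \<Rightarrow> 'k point \<Rightarrow> 'k point" where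
  "third_point P Q = (THE R. cuts_out (join_line P Q) P Q R)"

definition flexO :: "'k::field point" where
  "flexO = pt (vector [1, - 1, 0])"

text \<open>
  The chord-and-tangent group law with identity \<open>flexO\<close>. The group record is written
  multiplicatively, so the multiple \<open>n P\<close> is the power of \<open>P\<close> with integer exponent \<open>n\<close>.
\<close>

definition EK :: "'k::field point monoid" where
  "EK = \<lparr>carrier = fermat_curve,
         monoid.mult = (\<lambda>P Q. third_point (third_point P Q) flexO),
         one = flexO\<rparr>"


section \<open>The elliptified configuration\<close>

definition alpha :: "'k::field \<Rightarrow> 'k point" where
  "alpha s = pt (vector [1, s, 1])"

definition beta :: "'k::field \<Rightarrow> 'k \<Rightarrow> 'k point" where
  "beta s t = pt (vector [s, 1, t])"

definition torsion_pt :: "'k::field \<Rightarrow> 'k \<Rightarrow> int \<Rightarrow> int \<Rightarrow> 'k point" where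
  "torsion_pt s t i j = (alpha s [^]\<^bsub>EK\<^esub> i) \<otimes>\<^bsub>EK\<^esub> (beta s t [^]\<^bsub>EK\<^esub> j)"

definition ell :: "'k::field \<Rightarrow> 'k \<Rightarrow> int \<Rightarrow> int \<Rightarrow> int \<Rightarrow> int \<Rightarrow> 'k point set" where
  "ell s t i1 j1 i2 j2 = join_line (torsion_pt s t i1 j1) (torsion_pt s t i2 j2)"

definition L_line :: "'k::field \<Rightarrow> 'k \<Rightarrow> int \<Rightarrow> int \<Rightarrow> 'k point set" where
  "L_line s t i j = ell s t i j (3 - 2 * i) (3 - 2 * j)"

definition L_lines :: "'k::field \<Rightarrow> 'k \<Rightarrow> 'k point set set" where
  "L_lines s t = {L_line s t i j | i j. i \<in> {0..5} \<and> j \<in> {0..5}}"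

text \<open>
  A point on two distinct lines with coefficients in \<open>K\<close> has coordinates in \<open>K\<close>, so no
  triple point is lost by working in the projective plane over \<open>K\<close>.
\<close>

definition B_E6 :: "'k::field \<Rightarrow> 'k \<Rightarrow> 'k point set" where
  "B_E6 s t = {P \<in> P2. card {l \<in> L_lines s t. P \<in> l} = 3}"

definition I_E6 :: "'k::field \<Rightarrow> 'k \<Rightarrow> 'k poly3 set" where
  "I_E6 s t = point_ideal (B_E6 s t)"

end

theory Submission
  imports Defs "HOL-Computational_Algebra.Polynomial"
begin

text \<open>
  With \<open>\<tau> = s^2 * t\<close> the 18 lines are the linear factors of \<open>\<Phi> = (y^3 - z^3) * (z^3 - x^3) * (x^3 - y^3)\<close> and of
  the product \<open>D\<close> of \<open>x^3 + y^3 + 4 * z^3 - 3 * \<tau> * x * y * z\<close> and its two rotations. Up to degree 10 the ideal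
  \<open>I\<close> of the 48 triple points is generated by the three rotations \<open>f, g, h\<close> of one octic, and
  \<open>x * f + y * g + z * h = 3 * \<Phi>\<close>: the restrictions of an element of \<open>I\<close> to the nine lines of \<open>\<Phi>\<close> are
  determined up to polynomials of small degree, which can be matched by the octics.
  Hence an element of degree 18 of \<open>I^2\<close> is a quadratic expression in \<open>f, g, h\<close> with quadrics as
  coefficients. On each line of \<open>\<Phi>\<close> one of the octics vanishes and the other two are proportional; if
  the element vanishes on all these lines, this leaves only multiples of \<open>\<Phi>\<close> with cofactor in \<open>I\<close>.
  But the cofactor \<open>D\<close> of the product \<open>\<Phi> * D\<close> of the lines does not vanish at the triple point \<open>[1 : 1 : 1]\<close>.
\<close>

subsection \<open>Ternary forms as polynomial functions\<close>

text \<open>Over a field of characteristic 0 a form is determined by its values, so forms are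
  handled as functions and restricted to lines, where divisibility is that of polynomials in one
  variable. The obstacle is that the restrictions to the nine lines of \<Phi> are not independent:
  these lines meet in threes at the coordinate points and at the nine points with x^3 = y^3 = z^3.
  Three directions in a plane are linearly dependent, so each of these twelve points imposes one
  relation on the first-order behaviour along its three lines. These relations are what makes the
  octics suffice; a discrete Fourier expansion over the cube roots of unity splits them into
  equations between single coefficients. The origin of \<tau>^3 = 4 is the identity that a^3 + b^3 +
  c^3 - 3abc is the product of a + w b + w^2 c over w^3 = 1: with (a, b, c) = (x, y, \<tau> z) it
  splits a cubic factor of D into three lines.\<close>

inductive_set form :: "nat \<Rightarrow> ('k::field \<Rightarrow> 'k \<Rightarrow> 'k \<Rightarrow> 'k) set" for d where
  zero: "(\<lambda>x y z. 0) \<in> form d"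
| monomial: "i + j + k = d \<Longrightarrow> g \<in> form d \<Longrightarrow> (\<lambda>x y z. c * x ^ i * y ^ j * z ^ k + g x y z) \<in> form d"

lemma form_single: "i + j + k = d \<Longrightarrow> (\<lambda>x y z. c * x ^ i * y ^ j * z ^ k) \<in> form d"
  using form.monomial[OF _ form.zero, of i j k d c] by simp

lemma form_add:
  assumes "g \<in> form d" "h \<in> form d"
  shows "(\<lambda>x y z. g x y z + h x y z) \<in> form d"
  using assms(1)
proof induction
  case zero
  then show ?case using assms(2) by simp
next
  case (monomial i j k g c)
  from form.monomial[OF this(1) this(3), of c] show ?case by (simp add: algebra_simps)
qed

lemma form_mult_single:
  assumes "g \<in> form d"
  shows "(\<lambda>x y z. c * x ^ i * y ^ j * z ^ k * g x y z) \<in> form (i + j + k + d)"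
  using assms
proof induction
  case zero
  then show ?case by (simp add: form.zero)
next
  case (monomial i' j' k' g c')
  from monomial(1) have "(i + i') + (j + j') + (k + k') = i + j + k + d" by simp
  from form.monomial[OF this monomial(3), of "c * c'"] show ?case
    by (simp add: algebra_simps power_add)
qed

lemma form_mult:
  assumes "g \<in> form m" "h \<in> form n"
  shows "(\<lambda>x y z. g x y z * h x y z) \<in> form (m + n)"
  using assms(1)
proof induction
  case zero
  then show ?case by (simp add: form.zero)
next
  case (monomial i j k g c)
  from form_add[OF form_mult_single[OF assms(2), of c i j k, unfolded monomial(1)] monomial(3)]
  show ?case by (simp add: algebra_simps)
qed

lemma form_const: "(\<lambda>x y z. c) \<in> form 0"
  using form_single[of 0 0 0 0 c] by simp

lemma form_scale: "g \<in> form d \<Longrightarrow> (\<lambda>x y z. c * g x y z) \<in> form d"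
  using form_mult[OF form_const, of g d c] by simp

lemma form_uminus: "g \<in> form d \<Longrightarrow> (\<lambda>x y z. - g x y z) \<in> form d"
  using form_scale[of g d "-1"] by simp

lemma form_diff: "g \<in> form d \<Longrightarrow> h \<in> form d \<Longrightarrow> (\<lambda>x y z. g x y z - h x y z) \<in> form d"
  using form_add[OF _ form_uminus, of g d h] by simp

lemma form_x: "(\<lambda>x y z. x) \<in> form 1" and form_y: "(\<lambda>x y z. y) \<in> form 1"
  and form_z: "(\<lambda>x y z. z) \<in> form 1"
  using form_single[of 1 0 0 1 1] form_single[of 0 1 0 1 1] form_single[of 0 0 1 1 1] by simp_all

lemma form_power: "g \<in> form m \<Longrightarrow> (\<lambda>x y z. g x y z ^ k) \<in> form (k * m)"
  by (induction k) (auto intro: form_mult form_const)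

lemma form_subst:
  assumes "g \<in> form d" "a \<in> form 1" "b \<in> form 1" "c \<in> form 1"
  shows "(\<lambda>x y z. g (a x y z) (b x y z) (c x y z)) \<in> form d"
  using assms(1)
proof induction
  case zero
  then show ?case by (rule form.zero)
next
  case (monomial i j k g e)
  have "(\<lambda>x y z. e * (a x y z ^ i * b x y z ^ j * c x y z ^ k)) \<in> form (i * 1 + j * 1 + k * 1)"
    by (intro form_scale form_mult form_power assms)
  with monomial show ?case using form_add by (fastforce simp: mult.assoc)
qed

lemma form_homogeneous: "g \<in> form d \<Longrightarrow> g (c * x) (c * y) (c * z) = c ^ d * g x y z"
proof (induction rule: form.induct)
  case (monomial i j k g e)
  from monomial(1) have "c ^ d = c ^ i * c ^ j * c ^ k" by (simp add: power_add[symmetric])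
  with monomial(3) show ?case by (simp add: algebra_simps)
qed simp

text \<open>A parametrised curve pulls a form back to a polynomial in one variable. In this way
  identities between values become identities in an integral domain.\<close>

lemma form_poly: "g \<in> form d \<Longrightarrow> \<exists>p. \<forall>u. poly p u = g (poly a u) (poly b u) (poly c u)"
proof (induction rule: form.induct)
  case zero
  show ?case by (rule exI[of _ 0]) simp
next
  case (monomial i j k g e)
  then obtain p where "\<And>u. poly p u = g (poly a u) (poly b u) (poly c u)" by auto
  then show ?case by (intro exI[of _ "smult e (a ^ i * b ^ j * c ^ k) + p"]) (simp add: mult.assoc)
qed

lemma poly_eqI_all: "(\<And>u. poly p u = poly q (u :: 'k :: field_char_0)) \<Longrightarrow> p = q"
  by (metis poly_eq_poly_eq_iff ext)

text \<open>Restrict both forms to the line that passes through (x0, y0, z0) at parameter 0 and (x,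
  y, z) at parameter 1: one of the two polynomials is nonzero, so the other one is zero.\<close>

lemma form_mult_eq_0:
  fixes g h :: "'k::field_char_0 \<Rightarrow> 'k \<Rightarrow> 'k \<Rightarrow> 'k"
  assumes g: "g \<in> form m" and h: "h \<in> form n" and gh: "\<And>x y z. g x y z * h x y z = 0"
    and nz: "g x0 y0 z0 \<noteq> 0"
  shows "h x y z = 0"
proof -
  let ?a = "[:x0, x - x0:]" and ?b = "[:y0, y - y0:]" and ?c = "[:z0, z - z0:]"
  obtain p where p: "\<And>u. poly p u = g (poly ?a u) (poly ?b u) (poly ?c u)"
    using form_poly[OF g] by metis
  obtain q where q: "\<And>u. poly q u = h (poly ?a u) (poly ?b u) (poly ?c u)"
    using form_poly[OF h] by metis
  have "p * q = 0" by (rule poly_eqI_all) (simp only: poly_mult p q gh poly_0)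
  moreover have "p \<noteq> 0" using p[of 0] nz by auto
  ultimately have "q = 0" by simp
  with q[of 1] show ?thesis by simp
qed

text \<open>The curves u -> (a u, b, c) are lines through [1:0:0]. The two top coefficients come
  from the value at that point and from the derivative there in direction (b, c). The order of the
  quantifiers matters: one gradient (\<alpha>, \<beta>) serves all lines.\<close>

lemma form_restrict:
  assumes "g \<in> form d"
  shows "\<exists>\<alpha> \<beta>. \<forall>a b c. \<exists>p. degree p \<le> d \<and> (\<forall>u. poly p u = g (a * u) b c) \<and>
    coeff p d = a ^ d * g 1 0 0 \<and> (d > 0 \<longrightarrow> coeff p (d - 1) = a ^ (d - 1) * (\<alpha> * b + \<beta> * c))"
  using assms
proof induction
  case zero
  show ?case by (rule exI[of _ 0], rule exI[of _ 0], intro allI exI[of _ 0]) simp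
next
  case (monomial i j k g e)
  then obtain \<alpha> \<beta> where ab: "\<And>a b c. \<exists>p. degree p \<le> d \<and> (\<forall>u. poly p u = g (a * u) b c) \<and>
    coeff p d = a ^ d * g 1 0 0 \<and> (d > 0 \<longrightarrow> coeff p (d - 1) = a ^ (d - 1) * (\<alpha> * b + \<beta> * c))"
    by metis
  show ?case
  proof (rule exI[of _ "\<alpha> + (if j = 1 \<and> k = 0 then e else 0)"],
      rule exI[of _ "\<beta> + (if j = 0 \<and> k = 1 then e else 0)"], intro allI)
    fix a b c
    obtain p where p: "degree p \<le> d" "\<And>u. poly p u = g (a * u) b c" "coeff p d = a ^ d * g 1 0 0"
      "d > 0 \<Longrightarrow> coeff p (d - 1) = a ^ (d - 1) * (\<alpha> * b + \<beta> * c)" using ab by metis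
    let ?q = "monom (e * a ^ i * b ^ j * c ^ k) i"
    have 1: "degree (?q + p) \<le> d"
      using monomial(1) p(1) by (intro degree_add_le order.trans[OF degree_monom_le]) auto
    have 2: "poly (?q + p) u = e * (a * u) ^ i * b ^ j * c ^ k + g (a * u) b c" for u
      by (simp add: poly_monom p(2) power_mult_distrib)
    have 3: "coeff (?q + p) d = a ^ d * (e * 1 ^ i * 0 ^ j * 0 ^ k + g 1 0 0)"
      using monomial(1) by (cases "j = 0"; cases "k = 0") (auto simp: p(3) algebra_simps)
    have 4: "coeff (?q + p) (d - 1) = a ^ (d - 1) * ((\<alpha> + (if j = 1 \<and> k = 0 then e else 0)) * b
        + (\<beta> + (if j = 0 \<and> k = 1 then e else 0)) * c)" if "d > 0"
    proof -
      have "i = d - 1 \<longleftrightarrow> j = 1 \<and> k = 0 \<or> j = 0 \<and> k = 1" using that monomial(1) by auto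
      then show ?thesis using p(4)[OF that] by (auto simp: algebra_simps)
    qed
    show "\<exists>p. degree p \<le> d \<and> (\<forall>u. poly p u = e * (a * u) ^ i * b ^ j * c ^ k + g (a * u) b c) \<and>
      coeff p d = a ^ d * (e * 1 ^ i * 0 ^ j * 0 ^ k + g 1 0 0) \<and>
      (d > 0 \<longrightarrow> coeff p (d - 1) = a ^ (d - 1) * ((\<alpha> + (if j = 1 \<and> k = 0 then e else 0)) * b
        + (\<beta> + (if j = 0 \<and> k = 1 then e else 0)) * c))"
      using 1 2 3 4 by blast
  qed
qed

text \<open>Taylor expansion to first order at v = 1, the one-variable input of
  \<open>form_euler\<close>.\<close>

lemma power_expand: "\<exists>p. \<forall>v. v ^ i = 1 + of_nat i * (v - 1) + (v - 1) ^ 2 * poly p (v :: 'k :: field_char_0)"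
proof (induction i)
  case 0
  show ?case by (rule exI[of _ 0]) simp
next
  case (Suc i)
  then obtain p where p: "\<And>v::'k. v ^ i = 1 + of_nat i * (v - 1) + (v - 1) ^ 2 * poly p v" by blast
  have "v ^ Suc i = 1 + of_nat (Suc i) * (v - 1) + (v - 1) ^ 2 * poly ([:0, 1:] * p + [:of_nat i:]) v" for v
    unfolding power_Suc p by (simp add: algebra_simps power2_eq_square)
  then show ?case by blast
qed

text \<open>Euler's relation at a zero of \<open>g\<close>, without derivatives: moving the three coordinates
  separately, the first-order terms add up to \<open>d * g p q r = 0\<close>.\<close>

lemma form_euler:
  fixes g :: "'k::field_char_0 \<Rightarrow> 'k \<Rightarrow> 'k \<Rightarrow> 'k"
  assumes "g \<in> form d"
  shows "\<exists>s. \<forall>v. g (p * v) q r + g p (q * v) r + g p q (r * v)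
    = g p q r * (3 + of_nat d * (v - 1)) + (v - 1) ^ 2 * poly s v"
  using assms
proof induction
  case zero
  show ?case by (rule exI[of _ 0]) simp
next
  case (monomial i j k g e)
  then obtain s where s: "\<And>v. g (p * v) q r + g p (q * v) r + g p q (r * v)
    = g p q r * (3 + of_nat d * (v - 1)) + (v - 1) ^ 2 * poly s v" by auto
  obtain a b c where abc: "\<And>v::'k. v ^ i = 1 + of_nat i * (v - 1) + (v - 1) ^ 2 * poly a v"
    "\<And>v::'k. v ^ j = 1 + of_nat j * (v - 1) + (v - 1) ^ 2 * poly b v"
    "\<And>v::'k. v ^ k = 1 + of_nat k * (v - 1) + (v - 1) ^ 2 * poly c v" using power_expand by metis
  let ?m = "e * p ^ i * q ^ j * r ^ k"
  have "e * (p * v) ^ i * q ^ j * r ^ k + g (p * v) q r + (e * p ^ i * (q * v) ^ j * r ^ k + g p (q * v) r)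
      + (e * p ^ i * q ^ j * (r * v) ^ k + g p q (r * v))
    = (?m + g p q r) * (3 + of_nat d * (v - 1)) + (v - 1)^2 * poly (s + smult ?m (a + b + c)) v" for v
  proof -
    \<comment> \<open>The first-order coefficients of the three powers are i, j and k, whose sum is
      the degree.\<close>
    have "m * v ^ i + m * v ^ j + m * v ^ k
       = m * (3 + of_nat d * (v - 1)) + (v - 1) ^ 2 * (m * (poly a v + poly b v + poly c v))" for m
      unfolding abc[of v] monomial(1)[symmetric] by (simp add: algebra_simps)
    from this[of ?m] s[of v] show ?thesis by (simp add: power_mult_distrib algebra_simps)
  qed
  then show ?case by blast
qed

text \<open>Division by x - w * y, the remainder being the value on the line. The last clause makes
  up for the truncated \<open>d - 1\<close>: a constant has quotient 0.\<close>

lemma form_divide_line: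
  assumes "g \<in> form d"
  shows "\<exists>q\<in>form (d - 1). (\<forall>x y z. g x y z = g (w * y) y z + (x - w * y) * q x y z)
    \<and> (d = 0 \<longrightarrow> q = (\<lambda>x y z. 0))"
  using assms
proof induction
  case zero
  show ?case by (rule bexI[OF _ form.zero]) simp
next
  case (monomial i j k g e)
  then obtain q where q: "q \<in> form (d - 1)" "\<And>x y z. g x y z = g (w * y) y z + (x - w * y) * q x y z"
    "d = 0 \<Longrightarrow> q = (\<lambda>x y z. 0)" by metis
  show ?case
  proof (cases i)
    case 0
    with q show ?thesis by (intro bexI[of _ q]) (auto simp: algebra_simps)
  next
    case (Suc i')
    \<comment> \<open>For one monomial the quotient is the geometric sum for x^i - (w y)^i, times
      the powers of y and z.\<close>
    have "(\<lambda>x y z. e * (\<Sum>l<i. (w * y) ^ (i - Suc l) * x ^ l) * y ^ j * z ^ k) \<in> form (d - 1)"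
    proof -
      have "(\<lambda>x y z. \<Sum>l<n. (w * y) ^ (i - Suc l) * x ^ l) \<in> form i'" if "n \<le> i" for n
        using that
      proof (induction n)
        case (Suc n)
        have "(\<lambda>x y z. (w * y) ^ (i - Suc n) * x ^ n) \<in> form ((i - Suc n) * 1 + n * 1)"
          by (intro form_mult form_power form_scale form_y form_x)
        moreover have "(i - Suc n) * 1 + n * 1 = i'" using Suc.prems \<open>i = Suc i'\<close> by simp
        ultimately show ?case using Suc form_add by fastforce
      qed (simp add: form.zero)
      from form_mult[OF form_mult[OF form_scale[OF this[OF order.refl]] form_power[OF form_y, of j]]
          form_power[OF form_z, of k]]
      have "(\<lambda>x y z. e * (\<Sum>l<i. (w * y) ^ (i - Suc l) * x ^ l) * y ^ j * z ^ k) \<in> form (i' + j * 1 + k * 1)" .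
      moreover have "i' + j * 1 + k * 1 = d - 1" using monomial(1) Suc by simp
      ultimately show ?thesis by simp
    qed
    from form_add[OF this q(1)] show ?thesis
    proof (rule bexI[rotated], intro conjI allI impI)
      fix x y z
      have "x ^ i = (w * y) ^ i + (x - w * y) * (\<Sum>l<i. (w * y) ^ (i - Suc l) * x ^ l)"
        using power_diff_sumr2[of x i "w * y"] by (metis add.commute diff_add_cancel)
      then have "e * x ^ i * y ^ j * z ^ k = e * (w * y) ^ i * y ^ j * z ^ k
          + (x - w * y) * (e * (\<Sum>l<i. (w * y) ^ (i - Suc l) * x ^ l) * y ^ j * z ^ k)"
        by (simp only:) (simp add: algebra_simps)
      then show "e * x ^ i * y ^ j * z ^ k + g x y z =
         e * (w * y) ^ i * y ^ j * z ^ k + g (w * y) y z +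
         (x - w * y) * (e * (\<Sum>l<i. (w * y) ^ (i - Suc l) * x ^ l) * y ^ j * z ^ k + q x y z)"
        unfolding q(2)[of x y z] by (simp only: distrib_left add_ac)
    next
      assume "d = 0" with monomial(1) Suc show "(\<lambda>x y z. e * (\<Sum>l<i. (w * y) ^ (i - Suc l) * x ^ l) * y ^ j * z ^ k + q x y z) = (\<lambda>x y z. 0)" by simp
    qed
  qed
qed

subsection \<open>The octics through the triple points\<close>

lemma prod_linear_dvd:
  fixes p :: "'k::field poly"
  assumes "finite S" "\<And>r. r \<in> S \<Longrightarrow> poly p r = 0"
  shows "(\<Prod>r\<in>S. [:- r, 1:]) dvd p"
  using assms
proof (induction S)
  case (insert r S)
  then obtain q where q: "p = (\<Prod>r\<in>S. [:- r, 1:]) * q" by (auto elim: dvdE)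
  have "poly (\<Prod>r\<in>S. [:- r, 1:]) r \<noteq> 0" using insert(1,2) by (auto simp: poly_prod)
  with insert.prems[of r] q have "[:- r, 1:] dvd q" by (simp add: poly_eq_0_iff_dvd)
  then have "[:- r, 1:] * (\<Prod>r\<in>S. [:- r, 1:]) dvd q * (\<Prod>r\<in>S. [:- r, 1:])"
    by (rule mult_dvd_mono) simp
  then show ?case unfolding q prod.insert[OF insert(1,2)] by (metis mult.commute)
qed simp

text \<open>The configuration depends on s only through \<tau> = s^2 * t: from s^3 = -2 and t^3 = 1
  one gets \<tau>^3 = s^6 = 4.\<close>

locale cube_roots =
  fixes t \<tau> :: "'k::field_char_0"
  assumes t2: "t^2 + t + 1 = 0" and tau3: "\<tau> ^ 3 = 4"
begin

definition \<mu> :: "'k set" where "\<mu> = {1, t, t^2}"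

lemma t_cube: "t ^ 3 = 1" using t2 by algebra

lemma t_distinct: "t \<noteq> 1" "t^2 \<noteq> 1" "t^2 \<noteq> t" "t \<noteq> 0"
proof -
  show a: "t \<noteq> 1" using t2 by auto
  show "t \<noteq> 0" using t2 by auto
  have "t = 1" if "t^2 = 1" using that t_cube by algebra
  with a show "t^2 \<noteq> 1" by auto
  have "t = 1" if "t^2 = t" using that \<open>t \<noteq> 0\<close> by (simp add: power2_eq_square)
  with a show "t^2 \<noteq> t" by auto
qed

lemma mu_iff: "w \<in> \<mu> \<longleftrightarrow> w ^ 3 = 1"
proof
  assume "w ^ 3 = 1"
  then have "(w - 1) * ((w - t) * (w - t^2)) = 0" using t2 by algebra
  then show "w \<in> \<mu>" by (auto simp: \<mu>_def)
next
  have "(t^2) ^ 3 = 1" using t_cube by algebra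
  then show "w \<in> \<mu> \<Longrightarrow> w ^ 3 = 1" using t_cube by (auto simp: \<mu>_def)
qed

lemma one_mu: "1 \<in> \<mu>" and t_mu: "t \<in> \<mu>" by (auto simp: \<mu>_def)

lemma mu_mult: "v \<in> \<mu> \<Longrightarrow> w \<in> \<mu> \<Longrightarrow> v * w \<in> \<mu>" by (simp add: mu_iff power_mult_distrib)

lemma mu_sq: "w \<in> \<mu> \<Longrightarrow> w^2 \<in> \<mu>" by (simp add: mu_mult power2_eq_square)

lemma mu_nonzero: "w \<in> \<mu> \<Longrightarrow> w \<noteq> 0" by (auto simp: mu_iff)

lemma finite_mu: "finite \<mu>" and card_mu: "card \<mu> = 3"
  using t_distinct by (auto simp: \<mu>_def)

lemma tau_nonzero: "\<tau> \<noteq> 0" using tau3 by auto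

text \<open>A polynomial of degree at most 2 in w with the three roots 1, t, t^2 is zero. This turns
  one condition on each line of a pencil into conditions on single coefficients.\<close>

lemma fourier_0:
  assumes "\<And>w. w \<in> \<mu> \<Longrightarrow> a + b * w + c * w^2 = 0"
  shows "a = 0" "b = 0" "c = 0"
proof -
  have e: "a + b + c = 0" "a + b * t + c * t^2 = 0" "a + b * t^2 + c * (t^2)^2 = 0"
    using assms[of 1] assms[of t] assms[of "t^2"] by (simp_all add: \<mu>_def)
  have "3 * a = 0" "3 * b = 0" "3 * c = 0" using e t2 by algebra+
  then show "a = 0" "b = 0" "c = 0" by auto
qed

lemma fourier: "\<exists>a b c. \<forall>w\<in>\<mu>. F w = a + b * w + c * w^2"
proof -
  \<comment> \<open>Inverse discrete Fourier transform on the group \<open>\<mu>\<close>, where t^2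
    is the inverse of t.\<close>
  define a b c where "a = (F 1 + F t + F (t^2)) / 3" and "b = (F 1 + t^2 * F t + t * F (t^2)) / 3"
    and "c = (F 1 + t * F t + t^2 * F (t^2)) / 3"
  have abc: "3 * a = F 1 + F t + F (t^2)" "3 * b = F 1 + t^2 * F t + t * F (t^2)"
    "3 * c = F 1 + t * F t + t^2 * F (t^2)" by (simp_all add: a_def b_def c_def)
  have "3 * F 1 = 3 * (a + b + c)" "3 * F t = 3 * (a + b * t + c * t^2)"
    "3 * F (t^2) = 3 * (a + b * t^2 + c * (t^2)^2)" using abc t2 by algebra+
  moreover from this(1) have "3 * F 1 = 3 * (a + b * 1 + c * 1^2)" by simp
  ultimately have "\<forall>w\<in>\<mu>. 3 * F w = 3 * (a + b * w + c * w^2)" unfolding \<mu>_def by blast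
  then have "\<forall>w\<in>\<mu>. F w = a + b * w + c * w^2" unfolding mult_cancel_left by simp
  then show ?thesis by blast
qed

text \<open>The octics vanishing at the 48 triple points are spanned by \<open>octic x y z\<close>, \<open>octic y z x\<close> and
  \<open>octic z x y\<close>; the coefficients were found by linear algebra over the field generated by \<open>\<tau>\<close>.\<close>

definition quintic :: "'k \<Rightarrow> 'k \<Rightarrow> 'k \<Rightarrow> 'k" where
  "quintic x y z = \<tau> * (x * y * (x ^ 3 + y ^ 3)) - 3 * \<tau>^2 * (x^2 * y^2 * z) + 7 * \<tau> * (x * y * z ^ 3)
    - z^2 * (x ^ 3 + y ^ 3) - 4 * z ^ 5"

definition octic :: "'k \<Rightarrow> 'k \<Rightarrow> 'k \<Rightarrow> 'k" where
  "octic x y z = (x ^ 3 - y ^ 3) * quintic x y z"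

lemma octic_form: "octic \<in> form 8"
proof -
  have "quintic \<in> form 5"
  proof -
    have "(\<lambda>x y z. \<tau> * x ^ 4 * y ^ 1 * z ^ 0 + (\<tau> * x ^ 1 * y ^ 4 * z ^ 0 + (- 3 * \<tau>^2 * x ^ 2 * y ^ 2 * z ^ 1
      + (7 * \<tau> * x ^ 1 * y ^ 1 * z ^ 3 + (- 1 * x ^ 3 * y ^ 0 * z ^ 2 + (- 1 * x ^ 0 * y ^ 3 * z ^ 2
      + - 4 * x ^ 0 * y ^ 0 * z ^ 5)))))) \<in> form 5"
      by (intro form.monomial form_single; simp)
    also have "?this \<longleftrightarrow> ?thesis"
      by (rule arg_cong[where f = "\<lambda>g. g \<in> form 5"])
        (simp add: quintic_def fun_eq_iff algebra_simps power_numeral_reduce)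
    finally show ?thesis .
  qed
  moreover have "(\<lambda>x y z. x ^ 3 - y ^ 3) \<in> form (3 * 1 :: nat)"
    by (intro form_diff form_power form_x form_y)
  ultimately have "(\<lambda>x y z. (x ^ 3 - y ^ 3) * quintic x y z) \<in> form (3 * 1 + 5)"
    by (intro form_mult)
  then show ?thesis by (simp add: octic_def[abs_def])
qed

lemma octic_rot_form: "(\<lambda>x y z. octic y z x) \<in> form 8" "(\<lambda>x y z. octic z x y) \<in> form 8"
  by (intro form_subst[OF octic_form] form_x form_y form_z)+

lemma octic_Euler: "x * octic y z x + y * octic z x y + z * octic x y z
    = 3 * ((y ^ 3 - z ^ 3) * (z ^ 3 - x ^ 3) * (x ^ 3 - y ^ 3))"
  unfolding octic_def quintic_def by algebra

text \<open>Apart from \<open>[1 : 0 : 0]\<close>, the triple points on the line \<open>y = z\<close> are the points \<open>[u : 1 : 1]\<close> with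
  \<open>septic u = 0\<close>; the map \<open>[x : y : z] \<mapsto> [w^2 * x : w * y : z]\<close> carries them to the line \<open>y = w * z\<close>.\<close>

definition E :: "'k \<Rightarrow> 'k" where "E u = (\<tau> * u - 1) * (u ^ 3 - 3 * \<tau> * u + 5)"

definition septic :: "'k \<Rightarrow> 'k" where "septic u = (u ^ 3 - 1) * E u"

text \<open>On the line y = w * z, parametrised by (w^2 * u, w, 1), the octics f, g, h take the
  values 0 (by \<open>octic_mu_0\<close>), -w^2 * septic u and septic u. These proportions drive the
  later comparisons on the lines.\<close>

lemma octic_mu:
  assumes "w ^ 3 = 1"
  shows "octic (w^2 * u) w 1 = septic u" "octic 1 (w^2 * u) w = - (w^2 * septic u)"
proof -
  \<comment> \<open>With e in place of the coordinate 1, both claims are polynomial identities in w,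
    u, e and \<open>\<tau>\<close> modulo the given equations.\<close>
  have "octic (w^2 * u) w e = septic u" "octic e (w^2 * u) w = - (w^2 * septic u)" if "e = 1" for e
    unfolding octic_def quintic_def septic_def E_def using assms that tau3 by algebra+
  then show "octic (w^2 * u) w 1 = septic u" "octic 1 (w^2 * u) w = - (w^2 * septic u)" by simp_all
qed

lemma octic_mu_0: "w ^ 3 = 1 \<Longrightarrow> octic w 1 x = 0"
  unfolding octic_def by simp

text \<open>So cube roots of unity are simple roots of \<open>septic\<close>, which lets
  \<open>fermat_point_relation\<close> divide by \<open>E\<close>. For w^3 = 1 the cubic factor
  becomes 3 * (2 - \<tau> * w), and (\<tau> * w)^3 = 4 is neither 1 nor 8.\<close>

lemma E_mu: "w ^ 3 = 1 \<Longrightarrow> E w \<noteq> 0"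
proof
  assume w: "w ^ 3 = 1" and "E w = 0"
  then have "(\<tau> * w - 1) * (2 - \<tau> * w) = 0" unfolding E_def by algebra
  then have "\<tau> * w = 1 \<or> \<tau> * w = 2" by auto
  then have "(\<tau> * w) ^ 3 = 1 \<or> (\<tau> * w) ^ 3 = 8" by auto
  with w tau3 show False by (simp add: power_mult_distrib)
qed

definition hpoly :: "'k poly" where
  "hpoly = [:- 1, 0, 0, 1:] * [:- 1, \<tau>:] * [:5, - 3 * \<tau>, 0, 1:]"

lemma poly_hpoly: "poly hpoly u = septic u"
  by (simp add: hpoly_def septic_def E_def power3_eq_cube algebra_simps)

lemma degree_hpoly: "degree hpoly = 7" and lead_hpoly: "lead_coeff hpoly = \<tau>"
  using tau_nonzero by (simp_all add: hpoly_def)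

text \<open>The cubic factor is a^3 + b^3 + c^3 - 3abc for (a, b, c) = (u, \<tau>, 1), because
  \<tau>^3 + 1 = 5. Hence it splits into the factors u + \<tau> * w + w^2 with w in
  \<open>\<mu>\<close>.\<close>

lemma E_root_cases: "E u = 0 \<Longrightarrow> \<tau> * u = 1 \<or> (\<exists>w\<in>\<mu>. u = - (\<tau> * w + w^2))"
proof -
  assume "E u = 0"
  then have "\<tau> * u - 1 = 0 \<or> u ^ 3 - 3 * \<tau> * u + 5 = 0" by (simp add: E_def)
  moreover have "u ^ 3 - 3 * \<tau> * u + 5 =
      (u + (\<tau> + 1)) * ((u + (\<tau> * t + t^2)) * (u + (\<tau> * t^2 + (t^2)^2)))"
    using t2 tau3 by algebra
  ultimately have "\<tau> * u = 1 \<or> u = - (\<tau> + 1) \<or> u = - (\<tau> * t + t^2) \<or> u = - (\<tau> * t^2 + (t^2)^2)"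
    unfolding eq_neg_iff_add_eq_0 by (metis mult_eq_0_iff right_minus_eq)
  then show ?thesis unfolding \<mu>_def by auto
qed

lemma nu_root: "w ^ 3 = 1 \<Longrightarrow> (- (\<tau> * w + w^2)) ^ 3 - 3 * \<tau> * (- (\<tau> * w + w^2)) + 5 = 0"
  using tau3 by algebra

lemma E_root: "w ^ 3 = 1 \<Longrightarrow> E (- (\<tau> * w + w^2)) = 0"
  unfolding E_def nu_root by simp

text \<open>The first two exclusions separate these roots from the other roots of
  \<open>septic\<close>; the third one excludes a fourth line through the point in
  \<open>incidence_triple\<close>.\<close>

lemma nu_facts:
  assumes "u ^ 3 - 3 * \<tau> * u + 5 = 0"
  shows "u ^ 3 \<noteq> 1" "\<tau> * u \<noteq> 1" "\<tau> * u \<noteq> - 2"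
proof -
  show "\<tau> * u \<noteq> 1"
  proof
    assume "\<tau> * u = 1"
    then have "(9::'k) = 0" using assms tau3 by algebra
    then show False by simp
  qed
  show "\<tau> * u \<noteq> - 2"
  proof
    assume "\<tau> * u = - 2"
    then have "(9::'k) = 0" using assms tau3 by algebra
    then show False by simp
  qed
  show "u ^ 3 \<noteq> 1"
  proof
    assume "u ^ 3 = 1"
    then have "3 * (2 - \<tau> * u) = 0" using assms by algebra
    then have "\<tau> * u = 2" by simp
    then have "(\<tau> * u) ^ 3 = 8" by simp
    with \<open>u ^ 3 = 1\<close> tau3 show False by (simp add: power_mult_distrib)
  qed
qed

text \<open>For distinct v, w in \<open>\<mu>\<close> the sum v + w is minus the third cube root of
  unity, so \<tau> = - (v + w) would give \<tau>^3 = 1 instead of 4.\<close>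

lemma nu_inj: "inj_on (\<lambda>w. - (\<tau> * w + w^2)) \<mu>"
proof (rule inj_onI)
  fix v w assume v: "v \<in> \<mu>" and w: "w \<in> \<mu>" and eq: "- (\<tau> * v + v^2) = - (\<tau> * w + w^2)"
  have "(v - w) * (\<tau> + v + w) = 0" using eq by algebra
  moreover have "\<tau> + v + w \<noteq> 0" if "v \<noteq> w"
  proof
    assume 0: "\<tau> + v + w = 0"
    have "(v - w) * (v^2 + v * w + w^2) = 0" using v w by (simp add: mu_iff) algebra
    with that have "v^2 + v * w + w^2 = 0" by simp
    moreover have "\<tau> ^ 3 = - ((v + w) ^ 3)" using 0 by algebra
    ultimately have "(4::'k) = 1" using v w tau3 unfolding mu_iff by algebra
    then show False by simp
  qed
  ultimately show "v = w" by auto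
qed

text \<open>\<open>septic\<close> has seven distinct roots in the field: the three elements of
  \<open>\<mu>\<close>, 1 / \<tau> and the three roots of the cubic factor. So the product of the
  linear factors differs from \<open>hpoly\<close> only by a unit.\<close>

lemma hpoly_dvd:
  assumes "\<And>u. septic u = 0 \<Longrightarrow> poly p u = 0"
  shows "hpoly dvd p"
proof -
  define S where "S = \<mu> \<union> {1 / \<tau>} \<union> (\<lambda>w. - (\<tau> * w + w^2)) ` \<mu>"
  have fin: "finite S" by (simp add: S_def finite_mu)
  note inj = nu_inj
  have nu: "u ^ 3 - 3 * \<tau> * u + 5 = 0" if "u \<in> (\<lambda>w. - (\<tau> * w + w^2)) ` \<mu>" for u
  proof -
    from that obtain w where "u = - (\<tau> * w + w^2)" "w ^ 3 = 1"
      unfolding image_iff Bex_def mu_iff by blast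
    with nu_root show ?thesis by simp
  qed
  have d1: "\<mu> \<inter> {1 / \<tau>} = {}" using tau3 by (auto simp: mu_iff power_divide)
  have d2: "(\<mu> \<union> {1 / \<tau>}) \<inter> (\<lambda>w. - (\<tau> * w + w^2)) ` \<mu> = {}"
  proof -
    have "u \<notin> \<mu> \<union> {1 / \<tau>}" if "u \<in> (\<lambda>w. - (\<tau> * w + w^2)) ` \<mu>" for u
      using nu_facts[OF nu[OF that]] tau_nonzero by (auto simp: mu_iff)
    then show ?thesis by blast
  qed
  have "card S = 3 + 1 + 3"
    unfolding S_def using d1 d2 inj finite_mu card_mu by (subst card_Un_disjoint | simp add: card_image)+
  then have card: "card S = 7" by simp
  have roots: "septic u = 0" if "u \<in> S" for u
    using that tau_nonzero E_root by (auto simp: S_def septic_def mu_iff E_def[of "1 / \<tau>"])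
  let ?P = "\<Prod>r\<in>S. [:- r, 1:]"
  have "?P dvd hpoly" using prod_linear_dvd[OF fin] roots by (simp add: poly_hpoly)
  then obtain q where q: "hpoly = ?P * q" by (auto elim: dvdE)
  have "degree ?P = 7" using card fin by (simp add: degree_prod_sum_eq)
  moreover have "hpoly \<noteq> 0" using degree_hpoly by auto
  ultimately have "degree q = 0" using q degree_hpoly degree_mult_eq[of ?P q] by fastforce
  moreover have "q \<noteq> 0" using q \<open>hpoly \<noteq> 0\<close> by auto
  ultimately have "is_unit q" by (simp add: is_unit_iff_degree)
  then have "hpoly dvd ?P" using q by (simp add: mult_unit_dvd_iff)
  also have "?P dvd p" using prod_linear_dvd[OF fin] roots assms by blast
  finally show ?thesis .
qed

text \<open>The conditions on the pencil of lines through [1:0:0]: that point and seven more on each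
  of three lines. The three pencils give 3 + 63 conditions, where each of the nine points with x^3 =
  y^3 = z^3 is counted three times; this leaves 48 points.\<close>

definition van1 :: "('k \<Rightarrow> 'k \<Rightarrow> 'k \<Rightarrow> 'k) \<Rightarrow> bool" where
  "van1 g \<longleftrightarrow> g 1 0 0 = 0 \<and> (\<forall>w\<in>\<mu>. \<forall>u. septic u = 0 \<longrightarrow> g (w^2 * u) w 1 = 0)"

text \<open>Vanishing at the 48 triple points, in the coordinates used on the three pencils of lines.\<close>

definition vanishing :: "('k \<Rightarrow> 'k \<Rightarrow> 'k \<Rightarrow> 'k) \<Rightarrow> bool" where
  "vanishing g \<longleftrightarrow> van1 g \<and> van1 (\<lambda>x y z. g z x y) \<and> van1 (\<lambda>x y z. g y z x)"

text \<open>The restriction to y = w * z has degree below d because g vanishes at [1:0:0], and it is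
  divisible by the polynomial of degree 7, so the quotient has degree at most d - 8. Its coefficient
  at d - 8 comes from the linear terms of g at [1:0:0]; this is why \<alpha> and \<beta> are common
  to the three lines.\<close>

lemma line_factor:
  assumes g: "g \<in> form d" and van: "van1 g"
  shows "\<exists>p \<alpha> \<beta>. \<forall>w\<in>\<mu>. (p w = 0 \<or> degree (p w) + 8 \<le> d) \<and> (\<forall>u. g (w^2 * u) w 1 = septic u * poly (p w) u)
    \<and> (d \<ge> 8 \<longrightarrow> \<tau> * coeff (p w) (d - 8) = w ^ (2 * (d - 1)) * (\<alpha> * w + \<beta>))"
proof -
  obtain \<alpha> \<beta> where ab: "\<And>a b c. \<exists>p. degree p \<le> d \<and> (\<forall>u. poly p u = g (a * u) b c) \<and>
    coeff p d = a ^ d * g 1 0 0 \<and> (d > 0 \<longrightarrow> coeff p (d - 1) = a ^ (d - 1) * (\<alpha> * b + \<beta> * c))"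
    using form_restrict[OF g] by metis
  have "\<exists>q. (q = 0 \<or> degree q + 8 \<le> d) \<and> (\<forall>u. g (w^2 * u) w 1 = septic u * poly q u)
    \<and> (d \<ge> 8 \<longrightarrow> \<tau> * coeff q (d - 8) = w ^ (2 * (d - 1)) * (\<alpha> * w + \<beta>))" if w: "w \<in> \<mu>" for w
  proof -
    obtain p where p: "degree p \<le> d" "\<And>u. poly p u = g (w^2 * u) w 1" "coeff p d = (w^2) ^ d * g 1 0 0"
      "d > 0 \<Longrightarrow> coeff p (d - 1) = (w^2) ^ (d - 1) * (\<alpha> * w + \<beta> * 1)" using ab[of "w^2" w 1] by metis
    have "hpoly dvd p" using van w by (intro hpoly_dvd) (auto simp: p(2) van1_def)
    then obtain q where q: "p = hpoly * q" by (auto elim: dvdE)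
    have 1: "q = 0 \<or> degree q + 8 \<le> d"
    proof (cases "q = 0")
      case False
      then have "p \<noteq> 0" using q degree_hpoly by auto
      moreover have "coeff p d = 0" using p(3) van by (simp add: van1_def)
      ultimately have "degree p < d" using p(1) by (metis le_neq_implies_less leading_coeff_0_iff)
      moreover have "degree p = 7 + degree q" using q False degree_hpoly degree_mult_eq[of hpoly q] by fastforce
      ultimately show ?thesis by simp
    qed simp
    have 2: "g (w^2 * u) w 1 = septic u * poly q u" for u
      using p(2)[of u] q by (simp add: poly_hpoly)
    have 3: "\<tau> * coeff q (d - 8) = w ^ (2 * (d - 1)) * (\<alpha> * w + \<beta>)" if "d \<ge> 8"
    proof -
      have "coeff p (d - 1) = \<tau> * coeff q (d - 8)"
      proof (cases "degree q = d - 8")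
        case True
        then have "d - 1 = degree hpoly + degree q" using degree_hpoly that by simp
        then show ?thesis using coeff_mult_degree_sum[of hpoly q] q lead_hpoly True by simp
      next
        case False
        with 1 that have "degree q < d - 8" by auto
        then have "degree p < d - 1"
          using q degree_hpoly degree_mult_le[of hpoly q] by simp
        with \<open>degree q < d - 8\<close> show ?thesis by (simp add: coeff_eq_0)
      qed
      with p(4) that show ?thesis by (simp add: power_mult)
    qed
    from 1 2 3 show ?thesis by blast
  qed
  then show ?thesis by metis
qed

text \<open>At the point [w^2 * \<omega> : w : 1] three of the nine lines meet, and scaling one
  coordinate at a time moves along them. By \<open>form_euler\<close> the three first-order terms of
  g cancel. As \<open>septic\<close> has a simple zero at \<omega>, this is a relation between the
  values of the three quotients there.\<close>

lemma fermat_point_relation: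
  assumes g: "g \<in> form d" and van: "vanishing g"
    and A: "\<And>w u. w \<in> \<mu> \<Longrightarrow> g (w^2 * u) w 1 = septic u * poly (pA w) u"
    and B: "\<And>w u. w \<in> \<mu> \<Longrightarrow> g 1 (w^2 * u) w = septic u * poly (pB w) u"
    and C: "\<And>w u. w \<in> \<mu> \<Longrightarrow> g w 1 (w^2 * u) = septic u * poly (pC w) u"
    and w: "w \<in> \<mu>" and o: "\<omega> \<in> \<mu>"
  shows "poly (pA w) \<omega> + (w^2 * \<omega>) ^ d * poly (pB (w * \<omega>^2)) \<omega> + w ^ d * poly (pC (w * \<omega>)) \<omega> = 0"
proof -
  have w3: "w ^ 3 = 1" and o3: "\<omega> ^ 3 = 1" using w o by (simp_all add: mu_iff)
  let ?T = "\<lambda>v. poly (pA w) (\<omega> * v) + (w^2 * \<omega>) ^ d * poly (pB (w * \<omega>^2)) (\<omega> * v) + w ^ d * poly (pC (w * \<omega>)) (\<omega> * v)"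
  have a: "g ((w^2 * \<omega>) * v) w 1 = septic (\<omega> * v) * poly (pA w) (\<omega> * v)" for v
    using A[OF w, of "\<omega> * v"] by (simp add: mult.assoc)
  have b: "g (w^2 * \<omega>) (w * v) 1 = (w^2 * \<omega>) ^ d * (septic (\<omega> * v) * poly (pB (w * \<omega>^2)) (\<omega> * v))" for v
  proof -
    \<comment> \<open>Rescaling brings the moving point into the parametrisation used in B;
      homogeneity supplies the power of the scalar.\<close>
    have "(w^2 * \<omega>) * ((w * \<omega>^2)^2 * (\<omega> * v)) = w * v" "(w^2 * \<omega>) * (w * \<omega>^2) = 1" using w3 o3 by algebra+
    then have "g (w^2 * \<omega>) (w * v) 1 = (w^2 * \<omega>) ^ d * g 1 ((w * \<omega>^2)^2 * (\<omega> * v)) (w * \<omega>^2)"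
      using form_homogeneous[OF g, of "w^2 * \<omega>" 1 "(w * \<omega>^2)^2 * (\<omega> * v)" "w * \<omega>^2"]
      by (simp only: mult_1_right)
    with B[of "w * \<omega>^2"] mu_mult mu_sq w o show ?thesis by simp
  qed
  have c: "g (w^2 * \<omega>) w (1 * v) = w ^ d * (septic (\<omega> * v) * poly (pC (w * \<omega>)) (\<omega> * v))" for v
  proof -
    have "w * ((w * \<omega>)^2 * (\<omega> * v)) = v" using w3 o3 by algebra
    moreover have "w * (w * \<omega>) = w^2 * \<omega>" by (simp add: power2_eq_square)
    ultimately have "g (w^2 * \<omega>) w (1 * v) = w ^ d * g (w * \<omega>) 1 ((w * \<omega>)^2 * (\<omega> * v))"
      using form_homogeneous[OF g, of w "w * \<omega>" 1 "(w * \<omega>)^2 * (\<omega> * v)"]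
      by (simp only: mult_1_right mult_1_left)
    with C[of "w * \<omega>"] mu_mult w o show ?thesis by simp
  qed
  obtain s where s: "\<And>v. g (w^2 * \<omega> * v) w 1 + g (w^2 * \<omega>) (w * v) 1 + g (w^2 * \<omega>) w (1 * v)
    = g (w^2 * \<omega>) w 1 * (3 + of_nat d * (v - 1)) + (v - 1) ^ 2 * poly s v"
    using form_euler[OF g] by metis
  have "g (w^2 * \<omega>) w 1 = 0" using van w o3 by (simp add: vanishing_def van1_def septic_def)
  then have s': "septic (\<omega> * v) * ?T v = (v - 1) ^ 2 * poly s v" for v
    using s[of v] unfolding a b c by (simp only: mult_zero_left add_0_left distrib_left mult_ac)
  \<comment> \<open>Here septic (\<omega> * v) = (v - 1) * (v^2 + v + 1) * E (\<omega> * v). Against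
    the factor (v - 1)^2 of the remainder one factor v - 1 cancels and the other one forces
    \<open>?F\<close> to vanish at 1, where its value is 3 * E \<omega> times the wanted
    sum.\<close>
  let ?F = "[:1, 1, 1:] * (pcompose ([:- 1, \<tau>:] * [:5, - 3 * \<tau>, 0, 1:]) [:0, \<omega>:]) *
     (pcompose (pA w + smult ((w^2 * \<omega>) ^ d) (pB (w * \<omega>^2)) + smult (w ^ d) (pC (w * \<omega>))) [:0, \<omega>:])"
  have F: "poly ?F v = (v^2 + v + 1) * E (\<omega> * v) * ?T v" for v
    by (simp add: poly_pcompose E_def algebra_simps power_numeral_reduce)
  have "[:- 1, 1:] * ([:- 1, 1:] * s - ?F) = 0"
  proof (rule poly_eqI_all)
    fix v
    have "septic (\<omega> * v) = (v - 1) * (v^2 + v + 1) * E (\<omega> * v)" unfolding septic_def using o3 by algebra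
    with s'[of v] have "(v - 1) ^ 2 * poly s v = (v - 1) * poly ?F v" unfolding F by (metis mult.assoc)
    then show "poly ([:- 1, 1:] * ([:- 1, 1:] * s - ?F)) v = poly 0 v"
      by (simp only: poly_mult poly_diff) (simp add: algebra_simps power2_eq_square)
  qed
  then have "[:- 1, 1:] * s = ?F" by (metis eq_iff_diff_eq_0 mult_eq_0_iff pCons_eq_0_iff zero_neq_one)
  then have "poly ?F 1 = poly ([:- 1, 1:] * s) 1" by (rule arg_cong[OF sym])
  also have "\<dots> = 0" by (simp add: poly_mult)
  finally have "poly ?F 1 = 0" .
  then have "3 * E \<omega> * ?T 1 = 0" unfolding F by simp
  with E_mu[OF o3] show ?thesis by simp
qed

end

subsection \<open>Forms vanishing at the triple points\<close>

lemma sum_le_012: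
  "(\<Sum>k\<le>0. f k) = f (0::nat)" "(\<Sum>k\<le>1. f k) = f (0::nat) + f 1"
  "(\<Sum>k\<le>2. f k) = f (0::nat) + f 1 + f 2"
  by (simp_all add: numeral_2_eq_2)

context cube_roots
begin

text \<open>Dividing by one line of the pencil preserves vanishing on the others: x - v * y becomes
  (w - v) * y on the line x = w * y, and y cancels as a form.\<close>

lemma divide_three_lines:
  assumes g: "g \<in> form d" and 0: "\<And>w y z. w \<in> \<mu> \<Longrightarrow> g (w * y) y z = 0"
  shows "\<exists>q\<in>form (d - 3). (\<forall>x y z. g x y z = (x ^ 3 - y ^ 3) * q x y z) \<and> (d < 3 \<longrightarrow> q = (\<lambda>x y z. 0))"
proof -
  have cancel: "q (w * y) y z = 0" if q: "q \<in> form e" and "w \<noteq> v"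
    and "\<And>x y z. g x y z = (x - v * y) * q x y z" "\<And>y z. g (w * y) y z = 0" for g q e and w v y z :: 'k
  proof (rule form_mult_eq_0[OF form_y, where h = "\<lambda>x y z. q (w * y) y z"])
    show "(\<lambda>x y z. q (w * y) y z) \<in> form e" by (rule form_subst[OF q form_scale[OF form_y] form_y form_z])
    show "(1 :: 'k) \<noteq> 0" by simp
    have "(w - v) * (y * q (w * y) y z) = 0" for y z
      using that(4)[of y z] that(3)[of "w * y" y z] by (simp add: algebra_simps)
    then show "y * q (w * y) y z = 0" for y z using that(2) by simp
  qed
  obtain q1 where q1: "q1 \<in> form (d - 1)" "\<And>x y z. g x y z = g (1 * y) y z + (x - 1 * y) * q1 x y z"
    by (metis form_divide_line[OF g, of 1])
  have e1: "g x y z = (x - 1 * y) * q1 x y z" for x y z using q1(2)[of x y z] 0[OF one_mu, of y z] by simp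
  have 1: "q1 (t * y) y z = 0" "q1 (t^2 * y) y z = 0" for y z
    using cancel[OF q1(1) _ e1] 0 t_distinct by (auto simp: \<mu>_def)
  obtain q2 where q2: "q2 \<in> form (d - 1 - 1)" "\<And>x y z. q1 x y z = q1 (t * y) y z + (x - t * y) * q2 x y z"
    by (metis form_divide_line[OF q1(1), of t])
  have e2: "q1 x y z = (x - t * y) * q2 x y z" for x y z using q2(2)[of x y z] 1(1)[of y z] by simp
  have 2: "q2 (t^2 * y) y z = 0" for y z
    using cancel[OF q2(1) _ e2] 1 t_distinct by auto
  obtain q3 where q3: "q3 \<in> form (d - 1 - 1 - 1)"
    "\<And>x y z. q2 x y z = q2 (t^2 * y) y z + (x - t^2 * y) * q3 x y z"
    "d - 1 - 1 = 0 \<longrightarrow> q3 = (\<lambda>x y z. 0)"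
    by (metis form_divide_line[OF q2(1), of "t^2"])
  have "g x y z = (x ^ 3 - y ^ 3) * q3 x y z" for x y z
  proof -
    have "g x y z = ((x - 1 * y) * ((x - t * y) * (x - t^2 * y))) * q3 x y z"
      using e1[of x y z] e2[of x y z] q3(2)[of x y z] 2 by simp
    also have "(x - 1 * y) * ((x - t * y) * (x - t^2 * y)) = x ^ 3 - y ^ 3" using t2 by algebra
    finally show ?thesis .
  qed
  with q3 show ?thesis by (intro bexI[of _ q3]) (auto simp: numeral_3_eq_3)
qed

text \<open>The three pencils are split off in turn, rotating the coordinates. A factor already
  split off is not identically zero on a line of another pencil, so \<open>form_mult_eq_0\<close>
  passes the vanishing on to the quotient. The clause for d < 9 makes up for the truncated
  \<open>d - 9\<close>.\<close>

lemma divide_nine_lines: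
  assumes g: "g \<in> form d"
    and A: "\<And>w x z. w \<in> \<mu> \<Longrightarrow> g x (w * z) z = 0"
    and B: "\<And>w x y. w \<in> \<mu> \<Longrightarrow> g x y (w * x) = 0"
    and C: "\<And>w y z. w \<in> \<mu> \<Longrightarrow> g (w * y) y z = 0"
  shows "\<exists>q\<in>form (d - 9). (\<forall>x y z. g x y z = (y ^ 3 - z ^ 3) * (z ^ 3 - x ^ 3) * (x ^ 3 - y ^ 3) * q x y z)
    \<and> (d < 9 \<longrightarrow> q = (\<lambda>x y z. 0))"
proof -
  obtain q1 where q1: "q1 \<in> form (d - 3)" "\<And>x y z. g x y z = (x ^ 3 - y ^ 3) * q1 x y z"
    by (metis divide_three_lines[OF g C])
  have A1: "q1 x (w * z) z = 0" if w: "w \<in> \<mu>" for w x z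
  proof (rule form_mult_eq_0[where h = "\<lambda>x y z. q1 x (w * z) z"])
    show "(\<lambda>x y z. x ^ 3 - (w * z) ^ 3) \<in> form (3 * 1)" by (intro form_diff form_power form_scale form_x form_z)
    show "(\<lambda>x y z. q1 x (w * z) z) \<in> form (d - 3)" by (rule form_subst[OF q1(1) form_x form_scale[OF form_z] form_z])
    show "(x ^ 3 - (w * z) ^ 3) * q1 x (w * z) z = 0" for x z using A[OF w, of x z] q1(2) by simp
    show "(1::'k) ^ 3 - (w * 0) ^ 3 \<noteq> 0" by simp
  qed
  let ?r = "\<lambda>x y z. q1 z x y"
  have r: "?r \<in> form (d - 3)" by (rule form_subst[OF q1(1) form_z form_x form_y])
  obtain q2 where q2: "q2 \<in> form (d - 3 - 3)" "\<And>x y z. q1 z x y = (x ^ 3 - y ^ 3) * q2 x y z"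
    using divide_three_lines[OF r] A1 by blast
  have B1: "q2 y (w * x) x = 0" if w: "w \<in> \<mu>" for w x y
  proof (rule form_mult_eq_0[where h = "\<lambda>x y z. q2 y (w * x) x"])
    show "(\<lambda>x y z. (x ^ 3 - y ^ 3) * (y ^ 3 - (w * x) ^ 3)) \<in> form (3 * 1 + 3 * 1)"
      by (intro form_mult form_diff form_power form_scale form_x form_y)
    show "(\<lambda>x y z. q2 y (w * x) x) \<in> form (d - 3 - 3)" by (rule form_subst[OF q2(1) form_y form_scale[OF form_x] form_x])
    show "(x ^ 3 - y ^ 3) * (y ^ 3 - (w * x) ^ 3) * q2 y (w * x) x = 0" for x y
      using B[OF w, of x y] q1(2)[of x y "w * x"] q2(2)[of x y "w * x"] by simp
    show "((1::'k) ^ 3 - 0 ^ 3) * (0 ^ 3 - (w * 1) ^ 3) \<noteq> 0" using mu_nonzero[OF w] by simp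
  qed
  let ?s = "\<lambda>x y z. q2 z x y"
  have s: "?s \<in> form (d - 3 - 3)" by (rule form_subst[OF q2(1) form_z form_x form_y])
  obtain q3 where q3: "q3 \<in> form (d - 3 - 3 - 3)" "\<And>x y z. q2 z x y = (x ^ 3 - y ^ 3) * q3 x y z"
    "d - 3 - 3 < 3 \<longrightarrow> q3 = (\<lambda>x y z. 0)"
    using divide_three_lines[OF s] B1 by blast
  have "(\<lambda>x y z. q3 z x y) \<in> form (d - 9)"
    using form_subst[OF q3(1) form_z form_x form_y] by simp
  moreover have "g x y z = (y ^ 3 - z ^ 3) * (z ^ 3 - x ^ 3) * (x ^ 3 - y ^ 3) * q3 z x y" for x y z
    using q1(2)[of x y z] q2(2)[where x = y and y = z and z = x] q3(2)[where x = z and y = x and z = y]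
    by (simp add: mult_ac)
  moreover have "d < 9 \<longrightarrow> (\<lambda>x y z. q3 z x y) = (\<lambda>x y z. 0)" using q3(3) by simp
  ultimately show ?thesis by (intro bexI[of _ "\<lambda>x y z. q3 z x y"] conjI allI)
qed

text \<open>The hypotheses concern one affine chart of each line. Homogeneity extends them to all
  points off the coordinate line, and multiplying by that coordinate and cancelling it as a form
  covers the rest.\<close>

lemma zero_on_nine_lines:
  assumes g: "g \<in> form d" and w: "w \<in> \<mu>"
  shows "(\<And>u. g (w^2 * u) w 1 = 0) \<Longrightarrow> g x (w * z) z = 0"
    and "(\<And>u. g 1 (w^2 * u) w = 0) \<Longrightarrow> g x y (w * x) = 0"
    and "(\<And>u. g w 1 (w^2 * u) = 0) \<Longrightarrow> g (w * y) y z = 0"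
proof -
  have w3: "w^2 * (w * u) = u" for u
    using w by (simp add: mu_iff power2_eq_square power3_eq_cube mult.assoc[symmetric])
  {
    assume 0: "\<And>u. g (w^2 * u) w 1 = 0"
    have "z * g x (w * z) z = 0" for x z
      using form_homogeneous[OF g, of z "x / z" w 1] 0[of "w * (x / z)", unfolded w3]
      by (cases "z = 0") (simp_all add: mult.commute)
    from form_mult_eq_0[OF form_z form_subst[OF g form_x form_scale[OF form_z, of w] form_z] this, of 1]
    show "g x (w * z) z = 0" by simp
  }
  {
    assume 0: "\<And>u. g 1 (w^2 * u) w = 0"
    have "x * g x y (w * x) = 0" for x y
      using form_homogeneous[OF g, of x 1 "y / x" w] 0[of "w * (y / x)", unfolded w3]
      by (cases "x = 0") (simp_all add: mult.commute)
    from form_mult_eq_0[OF form_x form_subst[OF g form_x form_y form_scale[OF form_x, of w]] this, of 1]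
    show "g x y (w * x) = 0" by simp
  }
  {
    assume 0: "\<And>u. g w 1 (w^2 * u) = 0"
    have "y * g (w * y) y z = 0" for y z
      using form_homogeneous[OF g, of y w 1 "z / y"] 0[of "w * (z / y)", unfolded w3]
      by (cases "y = 0") (simp_all add: mult.commute)
    from form_mult_eq_0[OF form_y form_subst[OF g form_scale[OF form_y, of w] form_y form_z] this, of 1]
    show "g (w * y) y z = 0" by simp
  }
qed

definition in_octics :: "nat \<Rightarrow> ('k \<Rightarrow> 'k \<Rightarrow> 'k \<Rightarrow> 'k) \<Rightarrow> bool" where
  "in_octics e g \<longleftrightarrow> (\<exists>a\<in>form e. \<exists>b\<in>form e. \<exists>c\<in>form e.
     \<forall>x y z. g x y z = a x y z * octic y z x + b x y z * octic z x y + c x y z * octic x y z)"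

text \<open>It is enough to match g on the nine lines: a difference that vanishes there is a
  multiple of \<Phi>, and \<open>octic_Euler\<close> absorbs it into the cofactors with the
  coefficients x / 3, y / 3, z / 3.\<close>

lemma in_octicsI:
  assumes g: "g \<in> form (e + 8)" "e \<le> 2"
    and abc: "a \<in> form e" "b \<in> form e" "c \<in> form e"
    and A: "\<And>w u. w \<in> \<mu> \<Longrightarrow> g (w^2 * u) w 1 = septic u * (c (w^2 * u) w 1 - w^2 * b (w^2 * u) w 1)"
    and B: "\<And>w u. w \<in> \<mu> \<Longrightarrow> g 1 (w^2 * u) w = septic u * (a 1 (w^2 * u) w - w^2 * c 1 (w^2 * u) w)"
    and C: "\<And>w u. w \<in> \<mu> \<Longrightarrow> g w 1 (w^2 * u) = septic u * (b w 1 (w^2 * u) - w^2 * a w 1 (w^2 * u))"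
  shows "in_octics e g"
proof -
  let ?S = "\<lambda>x y z. a x y z * octic y z x + b x y z * octic z x y + c x y z * octic x y z"
  let ?g = "\<lambda>x y z. g x y z - ?S x y z"
  have S: "?S \<in> form (e + 8)"
    by (intro form_add form_mult abc octic_form octic_rot_form)
  define r where "r = ?g"
  have G: "r \<in> form (e + 8)" unfolding r_def by (rule form_diff[OF g(1) S])
  have lines: "r (w^2 * u) w 1 = 0" "r 1 (w^2 * u) w = 0" "r w 1 (w^2 * u) = 0" if w: "w \<in> \<mu>" for w u
    unfolding r_def using w octic_mu octic_mu_0
    by (simp_all only: mu_iff A[OF w] B[OF w] C[OF w]) (simp_all add: algebra_simps)
  obtain q where q: "q \<in> form (e + 8 - 9)" "\<And>x y z. r x y z = (y ^ 3 - z ^ 3) * (z ^ 3 - x ^ 3) * (x ^ 3 - y ^ 3) * q x y z"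
    "e + 8 < 9 \<longrightarrow> q = (\<lambda>x y z. 0)"
    by (metis divide_nine_lines[OF G zero_on_nine_lines(1)[OF G _ lines(1)] zero_on_nine_lines(2)[OF G _ lines(2)]
      zero_on_nine_lines(3)[OF G _ lines(3)]])
  \<comment> \<open>For e = 0 the truncated degree e + 8 - 9 is useless, but then q is zero.\<close>
  have var: "(\<lambda>x y z. q x y z * v x y z / 3) \<in> form e" if "v \<in> form 1" for v
  proof (cases "e = 0")
    case True
    then have "q = (\<lambda>x y z. 0)" using q(3) by simp
    then show ?thesis by (simp add: form.zero)
  next
    case False
    from form_scale[OF form_mult[OF q(1) that], of "1 / 3"] False show ?thesis by simp
  qed
  have "g x y z = (a x y z + q x y z * x / 3) * octic y z x + (b x y z + q x y z * y / 3) * octic z x y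
    + (c x y z + q x y z * z / 3) * octic x y z" for x y z
  proof -
    have "g x y z = ?S x y z + q x y z / 3 * (3 * ((y ^ 3 - z ^ 3) * (z ^ 3 - x ^ 3) * (x ^ 3 - y ^ 3)))"
      using q(2)[of x y z] unfolding r_def by (simp add: algebra_simps)
    then show ?thesis unfolding octic_Euler[symmetric] by (simp add: distrib_left distrib_right mult.assoc)
  qed
  then show ?thesis unfolding in_octics_def
    by (intro bexI[OF _ form_add[OF abc(1) var[OF form_x]]] bexI[OF _ form_add[OF abc(2) var[OF form_y]]]
        bexI[OF _ form_add[OF abc(3) var[OF form_z]]] allI)
qed

lemma rot_form: "g \<in> form d \<Longrightarrow> (\<lambda>x y z. g z x y) \<in> form d" "g \<in> form d \<Longrightarrow> (\<lambda>x y z. g y z x) \<in> form d"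
  by (rule form_subst[OF _ form_z form_x form_y] form_subst[OF _ form_y form_z form_x], assumption)+

text \<open>Eight zeros on a line exceed the degree, so g vanishes on all nine lines; a form of
  degree below 9 divisible by \<Phi> is zero.\<close>

lemma vanishing_low_degree:
  assumes g: "g \<in> form d" "d < 8" and van: "vanishing g"
  shows "g = (\<lambda>x y z. 0)"
proof -
  have lines: "g' (w^2 * u) w 1 = 0" if "g' \<in> form d" "van1 g'" "w \<in> \<mu>" for g' w u
    using line_factor[OF that(1,2)] that(3) g(2) by auto
  have A: "g (w^2 * u) w 1 = 0" "g 1 (w^2 * u) w = 0" "g w 1 (w^2 * u) = 0" if w: "w \<in> \<mu>" for w u
    using lines[OF g(1) _ w, of u] lines[OF rot_form(1)[OF g(1)] _ w, of u]
      lines[OF rot_form(2)[OF g(1)] _ w, of u] van by (simp_all add: vanishing_def)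
  obtain q where "q \<in> form (d - 9)" "\<And>x y z. g x y z = (y ^ 3 - z ^ 3) * (z ^ 3 - x ^ 3) * (x ^ 3 - y ^ 3) * q x y z"
    "d < 9 \<longrightarrow> q = (\<lambda>x y z. 0)"
    by (metis divide_nine_lines[OF g(1) zero_on_nine_lines(1)[OF g(1) _ A(1)] zero_on_nine_lines(2)[OF g(1) _ A(2)]
      zero_on_nine_lines(3)[OF g(1) _ A(3)]])
  with g(2) show ?thesis by (simp add: fun_eq_iff)
qed

text \<open>The condition on \<open>a e\<close> expresses that the leading coefficients on the three lines \<open>y = w * z\<close> come
  from the linear terms of \<open>g\<close> at the point \<open>[1 : 0 : 0]\<close>, where these lines meet.\<close>

definition expansion :: "nat \<Rightarrow> ('k \<Rightarrow> 'k \<Rightarrow> 'k \<Rightarrow> 'k) \<Rightarrow> ('k \<Rightarrow> 'k poly) \<Rightarrow> (nat \<Rightarrow> nat \<Rightarrow> 'k) \<Rightarrow> bool" where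
  "expansion e g p a \<longleftrightarrow> a e ((2 * e + 1) mod 3) = 0 \<and>
     (\<forall>w\<in>\<mu>. \<forall>u. g (w^2 * u) w 1 = septic u * poly (p w) u \<and>
       poly (p w) u = (\<Sum>k\<le>e. (a k 0 + a k 1 * w + a k 2 * w^2) * u ^ k))"

text \<open>The coefficients are the Fourier coefficients in w of those of the quotient in
  \<open>line_factor\<close>. For d = e + 8 the top coefficient is w^(2 * (e + 7)) * (\<alpha> * w +
  \<beta>) up to \<tau>; its exponents of w are 2 * e and 2 * e + 2 modulo 3, so the residue 2 * e +
  1 is missing.\<close>

lemma expansion_exists:
  assumes g: "g \<in> form (e + 8)" and e: "e \<le> 2" and van: "van1 g"
  shows "\<exists>p a. expansion e g p a"
proof -
  obtain p \<alpha> \<beta> where p: "\<And>w. w \<in> \<mu> \<Longrightarrow> p w = 0 \<or> degree (p w) + 8 \<le> e + 8"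
    "\<And>w u. w \<in> \<mu> \<Longrightarrow> g (w^2 * u) w 1 = septic u * poly (p w) u"
    "\<And>w. w \<in> \<mu> \<Longrightarrow> \<tau> * coeff (p w) (e + 8 - 8) = w ^ (2 * (e + 8 - 1)) * (\<alpha> * w + \<beta>)"
    using line_factor[OF g van] by (metis le_add2)
  have "\<exists>c :: nat \<Rightarrow> 'k. \<forall>w\<in>\<mu>. coeff (p w) k = c 0 + c 1 * w + c 2 * w^2" for k
  proof -
    obtain x y z where "\<forall>w\<in>\<mu>. coeff (p w) k = x + y * w + z * w^2"
      using fourier[of "\<lambda>w. coeff (p w) k"] by blast
    then show ?thesis by (intro exI[of _ "\<lambda>j. if j = 0 then x else if j = 1 then y else z"]) simp
  qed
  then obtain a :: "nat \<Rightarrow> nat \<Rightarrow> 'k"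
    where a: "\<And>k w. w \<in> \<mu> \<Longrightarrow> coeff (p w) k = a k 0 + a k 1 * w + a k 2 * w^2" by metis
  have poly: "poly (p w) u = (\<Sum>k\<le>e. (a k 0 + a k 1 * w + a k 2 * w^2) * u ^ k)" if w: "w \<in> \<mu>" for w u
  proof -
    have "poly (p w) u = (\<Sum>k\<le>e. coeff (p w) k * u ^ k)"
      unfolding poly_altdef using p(1)[OF w] by (intro sum.mono_neutral_left) (auto simp: coeff_eq_0)
    then show ?thesis by (simp add: a[OF w])
  qed
  have lead: "\<tau> * a e 0 + \<tau> * a e 1 * w + \<tau> * a e 2 * w^2 = w ^ (2 * (e + 7)) * (\<alpha> * w + \<beta>)" if "w \<in> \<mu>" for w
    using p(3)[OF that] a[OF that, of e] by (simp add: algebra_simps)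
  consider "e = 0" | "e = 1" | "e = 2" using e by linarith
  then have "\<tau> * a e ((2 * e + 1) mod 3) = 0"
  proof cases
    case 1
    have "(\<tau> * a e 0 - \<alpha>) + \<tau> * a e 1 * w + (\<tau> * a e 2 - \<beta>) * w^2 = 0" if w: "w \<in> \<mu>" for w
      using lead[OF w] w[unfolded mu_iff] unfolding 1 by simp algebra
    from fourier_0(2)[OF this] 1 show ?thesis by simp
  next
    case 2
    have "\<tau> * a e 0 + (\<tau> * a e 1 - \<beta>) * w + (\<tau> * a e 2 - \<alpha>) * w^2 = 0" if w: "w \<in> \<mu>" for w
      using lead[OF w] w[unfolded mu_iff] unfolding 2 by simp algebra
    from fourier_0(1)[OF this] 2 show ?thesis by simp
  next
    case 3
    have "(\<tau> * a e 0 - \<beta>) + (\<tau> * a e 1 - \<alpha>) * w + \<tau> * a e 2 * w^2 = 0" if w: "w \<in> \<mu>" for w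
      using lead[OF w] w[unfolded mu_iff] unfolding 3 by simp algebra
    from fourier_0(3)[OF this] 3 show ?thesis by simp
  qed
  then have "a e ((2 * e + 1) mod 3) = 0" using tau_nonzero by simp
  with p(2) poly show ?thesis unfolding expansion_def by blast
qed

text \<open>Fourier expansion first in w, then in \<omega>: the nine points [w^2 * \<omega> : w : 1]
  yield nine separate equations.\<close>

lemma fourier_00:
  assumes "\<And>w \<omega>. w \<in> \<mu> \<Longrightarrow> \<omega> \<in> \<mu> \<Longrightarrow> (x00 + x10 * \<omega> + x20 * \<omega>^2) + (x01 + x11 * \<omega> + x21 * \<omega>^2) * w
    + (x02 + x12 * \<omega> + x22 * \<omega>^2) * w^2 = 0"
  shows "x00 = 0" "x10 = 0" "x20 = 0" "x01 = 0" "x11 = 0" "x21 = 0" "x02 = 0" "x12 = 0" "x22 = 0"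
proof -
  have "x00 + x10 * \<omega> + x20 * \<omega>^2 = 0" "x01 + x11 * \<omega> + x21 * \<omega>^2 = 0" "x02 + x12 * \<omega> + x22 * \<omega>^2 = 0"
    if "\<omega> \<in> \<mu>" for \<omega>
    using fourier_0[OF assms[OF _ that]] by blast+
  from fourier_0[OF this(1)] fourier_0[OF this(2)] fourier_0[OF this(3)]
  show "x00 = 0" "x10 = 0" "x20 = 0" "x01 = 0" "x11 = 0" "x21 = 0" "x02 = 0" "x12 = 0" "x22 = 0"
    by blast+
qed

text \<open>Membership in the ideal of the octics is a linear system for the coefficients of the cofactors.
  Its solvability conditions are the condition in \<open>expansion\<close> at the coordinate points and the
  relations \<open>R\<close> at the nine points with \<open>x^3 = y^3 = z^3\<close>, where three of the lines meet as well.\<close>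

lemma vanishing_degree_8:
  assumes g: "g \<in> form 8" and van: "vanishing g"
  shows "in_octics 0 g"
proof -
  have g0: "g \<in> form (0 + 8)" using g by simp
  have le: "(0::nat) \<le> 2" by simp
  obtain pA a where A: "expansion 0 g pA a"
    using expansion_exists[OF g0 le] van by (auto simp: vanishing_def)
  obtain pB b where B: "expansion 0 (\<lambda>x y z. g z x y) pB b"
    using expansion_exists[OF rot_form(1)[OF g0] le] van by (auto simp: vanishing_def)
  obtain pC c where C: "expansion 0 (\<lambda>x y z. g y z x) pC c"
    using expansion_exists[OF rot_form(2)[OF g0] le] van by (auto simp: vanishing_def)
  have qA: "g (w^2 * u) w 1 = septic u * poly (pA w) u"
    and pA: "poly (pA w) u = ((a 0 0 + a 0 2 * w^2))"
    if "w \<in> \<mu>" for w u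
    using A that by (simp_all add: expansion_def sum_le_012)
  have qB: "g 1 (w^2 * u) w = septic u * poly (pB w) u"
    and pB: "poly (pB w) u = ((b 0 0 + b 0 2 * w^2))"
    if "w \<in> \<mu>" for w u
    using B that by (simp_all add: expansion_def sum_le_012)
  have qC: "g w 1 (w^2 * u) = septic u * poly (pC w) u"
    and pC: "poly (pC w) u = ((c 0 0 + c 0 2 * w^2))"
    if "w \<in> \<mu>" for w u
    using C that by (simp_all add: expansion_def sum_le_012)
  \<comment> \<open>This is \<open>fermat_point_relation\<close> sorted by the powers of w and
    \<omega>, with exponents reduced modulo 3.\<close>
  have rel: "((a 0 0 + b 0 2) + 0 * \<omega> + 0 * \<omega>^2) + (0 + 0 * \<omega> + (b 0 0 + c 0 2) *
    \<omega>^2) * w + ((c 0 0 + a 0 2) + 0 * \<omega> + 0 * \<omega>^2) * w^2 = 0"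
    if w: "w \<in> \<mu>" and o: "\<omega> \<in> \<mu>" for w \<omega>
  proof -
    have w3: "w ^ 3 = 1" and o3: "\<omega> ^ 3 = 1" using w o by (simp_all add: mu_iff)
    have pw: "(w^2 * \<omega>) ^ 8 = w * \<omega>^2" "w ^ 8 = w^2" using w3 o3 by algebra+
    from fermat_point_relation[OF g van qA qB qC w o]
    have "((a 0 0 + a 0 2 * w^2)) + (w * \<omega>^2) * ((b 0 0 + b 0 2 * (w *
      \<omega>^2)^2)) + w^2 * ((c 0 0 + c 0 2 * (w * \<omega>)^2)) = 0"
      unfolding pA[OF w] pB[OF mu_mult[OF w mu_sq[OF o]]] pC[OF mu_mult[OF w o]] pw .
    with w3 o3 show ?thesis by algebra
  qed
  note R = fourier_00[OF rel]
  \<comment> \<open>On y = w * z the constant c - w^2 * b must equal a 0 0 + a 0 2 * w^2, and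
    likewise on the other pencils. The terms free of w dictate the cofactors, and \<open>R\<close>
    makes the terms in w^2 agree.\<close>
  let ?a = "\<lambda>x y z. b 0 0 * x ^ 0 * y ^ 0 * z ^ 0"
  let ?b = "\<lambda>x y z. c 0 0 * x ^ 0 * y ^ 0 * z ^ 0"
  let ?c = "\<lambda>x y z. a 0 0 * x ^ 0 * y ^ 0 * z ^ 0"
  have forms: "?a \<in> form 0" "?b \<in> form 0" "?c \<in> form 0"
    by (intro form.monomial form_single; simp)+
  show ?thesis
  proof (rule in_octicsI[OF g0 le forms])
    fix w u assume w: "w \<in> \<mu>"
    then have w3: "w ^ 3 = 1" by (simp add: mu_iff)
    have "poly (pA w) u = ?c (w^2 * u) w 1 - w^2 * ?b (w^2 * u) w 1"
      unfolding pA[OF w] power_one power_0 power_one_right mult_1_right using R w3 by algebra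
    then show "g (w^2 * u) w 1 = septic u * (?c (w^2 * u) w 1 - w^2 * ?b (w^2 * u) w 1)"
      unfolding qA[OF w] by (rule arg_cong)
    have "poly (pB w) u = ?a 1 (w^2 * u) w - w^2 * ?c 1 (w^2 * u) w"
      unfolding pB[OF w] power_one power_0 power_one_right mult_1_right using R w3 by algebra
    then show "g 1 (w^2 * u) w = septic u * (?a 1 (w^2 * u) w - w^2 * ?c 1 (w^2 * u) w)"
      unfolding qB[OF w] by (rule arg_cong)
    have "poly (pC w) u = ?b w 1 (w^2 * u) - w^2 * ?a w 1 (w^2 * u)"
      unfolding pC[OF w] power_one power_0 power_one_right mult_1_right using R w3 by algebra
    then show "g w 1 (w^2 * u) = septic u * (?b w 1 (w^2 * u) - w^2 * ?a w 1 (w^2 * u))"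
      unfolding qC[OF w] by (rule arg_cong)
  qed
qed

lemma vanishing_degree_9:
  assumes g: "g \<in> form 9" and van: "vanishing g"
  shows "in_octics 1 g"
proof -
  have g0: "g \<in> form (1 + 8)" using g by simp
  have le: "(1::nat) \<le> 2" by simp
  obtain pA a where A: "expansion 1 g pA a"
    using expansion_exists[OF g0 le] van by (auto simp: vanishing_def)
  obtain pB b where B: "expansion 1 (\<lambda>x y z. g z x y) pB b"
    using expansion_exists[OF rot_form(1)[OF g0] le] van by (auto simp: vanishing_def)
  obtain pC c where C: "expansion 1 (\<lambda>x y z. g y z x) pC c"
    using expansion_exists[OF rot_form(2)[OF g0] le] van by (auto simp: vanishing_def)
  have qA: "g (w^2 * u) w 1 = septic u * poly (pA w) u"
    and pA: "poly (pA w) u = ((a 0 0 + a 0 1 * w + a 0 2 * w^2) + (a 1 1 * w + a 1 2 * w^2) * u)"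
    if "w \<in> \<mu>" for w u
    using A that by (simp_all add: expansion_def sum_le_012)
  have qB: "g 1 (w^2 * u) w = septic u * poly (pB w) u"
    and pB: "poly (pB w) u = ((b 0 0 + b 0 1 * w + b 0 2 * w^2) + (b 1 1 * w + b 1 2 * w^2) * u)"
    if "w \<in> \<mu>" for w u
    using B that by (simp_all add: expansion_def sum_le_012)
  have qC: "g w 1 (w^2 * u) = septic u * poly (pC w) u"
    and pC: "poly (pC w) u = ((c 0 0 + c 0 1 * w + c 0 2 * w^2) + (c 1 1 * w + c 1 2 * w^2) * u)"
    if "w \<in> \<mu>" for w u
    using C that by (simp_all add: expansion_def sum_le_012)
  have rel: "((a 0 0 + b 0 0 + c 0 0) + 0 * \<omega> + 0 * \<omega>^2) + ((a 0 1 + b 1 1) + (c 0 1 + a 1 1)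
    * \<omega> + (b 0 1 + c 1 1) * \<omega>^2) * w + ((a 0 2 + c 1 2) + (b 0 2 + a 1 2) * \<omega>
    + (c 0 2 + b 1 2) * \<omega>^2) * w^2 = 0"
    if w: "w \<in> \<mu>" and o: "\<omega> \<in> \<mu>" for w \<omega>
  proof -
    have w3: "w ^ 3 = 1" and o3: "\<omega> ^ 3 = 1" using w o by (simp_all add: mu_iff)
    have pw: "(w^2 * \<omega>) ^ 9 = 1" "w ^ 9 = 1" using w3 o3 by algebra+
    from fermat_point_relation[OF g van qA qB qC w o]
    have "((a 0 0 + a 0 1 * w + a 0 2 * w^2) + (a 1 1 * w + a 1 2 * w^2) * \<omega>) + 1 * ((b 0
      0 + b 0 1 * (w * \<omega>^2) + b 0 2 * (w * \<omega>^2)^2) + (b 1 1 * (w *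
      \<omega>^2) + b 1 2 * (w * \<omega>^2)^2) * \<omega>) + 1 * ((c 0 0 + c 0 1 * (w
      * \<omega>) + c 0 2 * (w * \<omega>)^2) + (c 1 1 * (w * \<omega>) + c 1 2 * (w *
      \<omega>)^2) * \<omega>) = 0"
      unfolding pA[OF w] pB[OF mu_mult[OF w mu_sq[OF o]]] pC[OF mu_mult[OF w o]] pw .
    with w3 o3 show ?thesis by algebra
  qed
  note R = fourier_00[OF rel]
  \<comment> \<open>One solution of the linear system. Adding a multiple of (x, y, z) to the three
    cofactors changes nothing on the nine lines; the choice is normalised by letting
    \<open>?a\<close> have no term in x.\<close>
  let ?a = "\<lambda>x y z. b 1 2 * x ^ 0 * y ^ 1 * z ^ 0 + (b 0 1 * x ^ 0 * y ^ 0 * z ^ 1)"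
  let ?b = "\<lambda>x y z. - a 1 1 * x ^ 1 * y ^ 0 * z ^ 0 + (c 0 0 * x ^ 0 * y ^ 1 * z ^ 0 + (- a 0 2 * x ^ 0 *
    y ^ 0 * z ^ 1))"
  let ?c = "\<lambda>x y z. a 1 2 * x ^ 1 * y ^ 0 * z ^ 0 + (a 0 1 * x ^ 0 * y ^ 1 * z ^ 0 + (- b 0 0 * x ^ 0 * y
    ^ 0 * z ^ 1))"
  have forms: "?a \<in> form 1" "?b \<in> form 1" "?c \<in> form 1"
    by (intro form.monomial form_single; simp)+
  show ?thesis
  proof (rule in_octicsI[OF g0 le forms])
    fix w u assume w: "w \<in> \<mu>"
    then have w3: "w ^ 3 = 1" by (simp add: mu_iff)
    have "poly (pA w) u = ?c (w^2 * u) w 1 - w^2 * ?b (w^2 * u) w 1"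
      unfolding pA[OF w] power_one power_0 power_one_right mult_1_right using R w3 by algebra
    then show "g (w^2 * u) w 1 = septic u * (?c (w^2 * u) w 1 - w^2 * ?b (w^2 * u) w 1)"
      unfolding qA[OF w] by (rule arg_cong)
    have "poly (pB w) u = ?a 1 (w^2 * u) w - w^2 * ?c 1 (w^2 * u) w"
      unfolding pB[OF w] power_one power_0 power_one_right mult_1_right using R w3 by algebra
    then show "g 1 (w^2 * u) w = septic u * (?a 1 (w^2 * u) w - w^2 * ?c 1 (w^2 * u) w)"
      unfolding qB[OF w] by (rule arg_cong)
    have "poly (pC w) u = ?b w 1 (w^2 * u) - w^2 * ?a w 1 (w^2 * u)"
      unfolding pC[OF w] power_one power_0 power_one_right mult_1_right using R w3 by algebra
    then show "g w 1 (w^2 * u) = septic u * (?b w 1 (w^2 * u) - w^2 * ?a w 1 (w^2 * u))"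
      unfolding qC[OF w] by (rule arg_cong)
  qed
qed

lemma vanishing_degree_10:
  assumes g: "g \<in> form 10" and van: "vanishing g"
  shows "in_octics 2 g"
proof -
  have g0: "g \<in> form (2 + 8)" using g by simp
  have le: "(2::nat) \<le> 2" by simp
  obtain pA a where A: "expansion 2 g pA a"
    using expansion_exists[OF g0 le] van by (auto simp: vanishing_def)
  obtain pB b where B: "expansion 2 (\<lambda>x y z. g z x y) pB b"
    using expansion_exists[OF rot_form(1)[OF g0] le] van by (auto simp: vanishing_def)
  obtain pC c where C: "expansion 2 (\<lambda>x y z. g y z x) pC c"
    using expansion_exists[OF rot_form(2)[OF g0] le] van by (auto simp: vanishing_def)
  have qA: "g (w^2 * u) w 1 = septic u * poly (pA w) u"
    and pA: "poly (pA w) u = ((a 0 0 + a 0 1 * w + a 0 2 * w^2) + (a 1 0 + a 1 1 * w + a 1 2 * w^2)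
      * u + (a 2 0 + a 2 1 * w) * u^2)"
    if "w \<in> \<mu>" for w u
    using A that by (simp_all add: expansion_def sum_le_012)
  have qB: "g 1 (w^2 * u) w = septic u * poly (pB w) u"
    and pB: "poly (pB w) u = ((b 0 0 + b 0 1 * w + b 0 2 * w^2) + (b 1 0 + b 1 1 * w + b 1 2 * w^2)
      * u + (b 2 0 + b 2 1 * w) * u^2)"
    if "w \<in> \<mu>" for w u
    using B that by (simp_all add: expansion_def sum_le_012)
  have qC: "g w 1 (w^2 * u) = septic u * poly (pC w) u"
    and pC: "poly (pC w) u = ((c 0 0 + c 0 1 * w + c 0 2 * w^2) + (c 1 0 + c 1 1 * w + c 1 2 * w^2)
      * u + (c 2 0 + c 2 1 * w) * u^2)"
    if "w \<in> \<mu>" for w u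
    using C that by (simp_all add: expansion_def sum_le_012)
  have rel: "((a 0 0 + b 0 1 + c 1 2) + (a 1 0 + b 1 1) * \<omega> + (c 0 2 + a 2 0 + b 2 1) * \<omega>^2) +
    ((c 0 0 + a 0 1 + b 1 2) + (c 1 0 + a 1 1) * \<omega> + (b 0 2 + c 2 0 + a 2 1) * \<omega>^2) *
    w + ((a 0 2 + b 2 0 + c 2 1) + (b 0 0 + c 0 1 + a 1 2) * \<omega> + (b 1 0 + c 1 1) *
    \<omega>^2) * w^2 = 0"
    if w: "w \<in> \<mu>" and o: "\<omega> \<in> \<mu>" for w \<omega>
  proof -
    have w3: "w ^ 3 = 1" and o3: "\<omega> ^ 3 = 1" using w o by (simp_all add: mu_iff)
    have pw: "(w^2 * \<omega>) ^ 10 = w^2 * \<omega>" "w ^ 10 = w" using w3 o3 by algebra+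
    from fermat_point_relation[OF g van qA qB qC w o]
    have "((a 0 0 + a 0 1 * w + a 0 2 * w^2) + (a 1 0 + a 1 1 * w + a 1 2 * w^2) * \<omega> + (a
      2 0 + a 2 1 * w) * \<omega>^2) + (w^2 * \<omega>) * ((b 0 0 + b 0 1 * (w *
      \<omega>^2) + b 0 2 * (w * \<omega>^2)^2) + (b 1 0 + b 1 1 * (w *
      \<omega>^2) + b 1 2 * (w * \<omega>^2)^2) * \<omega> + (b 2 0 + b 2 1 * (w *
      \<omega>^2)) * \<omega>^2) + w * ((c 0 0 + c 0 1 * (w * \<omega>) + c 0 2 * (w *
      \<omega>)^2) + (c 1 0 + c 1 1 * (w * \<omega>) + c 1 2 * (w * \<omega>)^2) * \<omega> +
      (c 2 0 + c 2 1 * (w * \<omega>)) * \<omega>^2) = 0"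
      unfolding pA[OF w] pB[OF mu_mult[OF w mu_sq[OF o]]] pC[OF mu_mult[OF w o]] pw .
    with w3 o3 show ?thesis by algebra
  qed
  note R = fourier_00[OF rel]
  \<comment> \<open>The solution is determined up to adding a linear form times (x, y, z); again it
    is normalised so that no monomial of \<open>?a\<close> contains x.\<close>
  let ?a = "\<lambda>x y z. b 2 1 * x ^ 0 * y ^ 2 * z ^ 0 + (b 1 0 * x ^ 0 * y ^ 1 * z ^ 1 + (- c 2 0 * x ^ 0 * y
    ^ 0 * z ^ 2))"
  let ?b = "\<lambda>x y z. - a 2 0 * x ^ 2 * y ^ 0 * z ^ 0 + (- a 1 1 * x ^ 1 * y ^ 0 * z ^ 1 + (c 2 1 * x ^ 0 *
    y ^ 0 * z ^ 2 + (c 0 1 * x ^ 1 * y ^ 1 * z ^ 0 + (c 0 0 * x ^ 0 * y ^ 2 * z ^ 0 + (c 1 2 * x ^ 0 * y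
    ^ 1 * z ^ 1)))))"
  let ?c = "\<lambda>x y z. a 2 1 * x ^ 2 * y ^ 0 * z ^ 0 + (a 1 0 * x ^ 1 * y ^ 1 * z ^ 0 + (- b 2 0 * x ^ 0 * y
    ^ 2 * z ^ 0 + (- b 0 0 * x ^ 1 * y ^ 0 * z ^ 1 + (- b 1 2 * x ^ 0 * y ^ 1 * z ^ 1 + (- b 0 1 * x ^ 0
    * y ^ 0 * z ^ 2)))))"
  have forms: "?a \<in> form 2" "?b \<in> form 2" "?c \<in> form 2"
    by (intro form.monomial form_single; simp)+
  show ?thesis
  proof (rule in_octicsI[OF g0 le forms])
    fix w u assume w: "w \<in> \<mu>"
    then have w3: "w ^ 3 = 1" by (simp add: mu_iff)
    have "poly (pA w) u = ?c (w^2 * u) w 1 - w^2 * ?b (w^2 * u) w 1"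
      unfolding pA[OF w] power_one power_0 power_one_right mult_1_right using R w3 by algebra
    then show "g (w^2 * u) w 1 = septic u * (?c (w^2 * u) w 1 - w^2 * ?b (w^2 * u) w 1)"
      unfolding qA[OF w] by (rule arg_cong)
    have "poly (pB w) u = ?a 1 (w^2 * u) w - w^2 * ?c 1 (w^2 * u) w"
      unfolding pB[OF w] power_one power_0 power_one_right mult_1_right using R w3 by algebra
    then show "g 1 (w^2 * u) w = septic u * (?a 1 (w^2 * u) w - w^2 * ?c 1 (w^2 * u) w)"
      unfolding qB[OF w] by (rule arg_cong)
    have "poly (pC w) u = ?b w 1 (w^2 * u) - w^2 * ?a w 1 (w^2 * u)"
      unfolding pC[OF w] power_one power_0 power_one_right mult_1_right using R w3 by algebra
    then show "g w 1 (w^2 * u) = septic u * (?b w 1 (w^2 * u) - w^2 * ?a w 1 (w^2 * u))"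
      unfolding qC[OF w] by (rule arg_cong)
  qed
qed

end

subsection \<open>Quadratic expressions in the octics\<close>

context cube_roots
begin

definition quadric :: "'k \<Rightarrow> 'k \<Rightarrow> 'k \<Rightarrow> 'k \<Rightarrow> 'k \<Rightarrow> 'k \<Rightarrow> 'k \<Rightarrow> 'k \<Rightarrow> 'k \<Rightarrow> 'k" where
  "quadric c1 c2 c3 c4 c5 c6 x y z = c1 * x^2 + c2 * y^2 + c3 * z^2 + c4 * (y * z) + c5 * (z * x) + c6 * (x * y)"

lemma form_2_quadric:
  assumes "q \<in> form 2"
  shows "\<exists>c1 c2 c3 c4 c5 c6. q = quadric c1 c2 c3 c4 c5 c6"
  using assms
proof induction
  case zero
  have "(\<lambda>x y z. 0) = quadric 0 0 0 0 0 0" by (simp add: quadric_def fun_eq_iff)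
  then show ?case by blast
next
  case (monomial i j k g e)
  then obtain c1 c2 c3 c4 c5 c6 where g: "g = quadric c1 c2 c3 c4 c5 c6" by blast
  have "i = 2 \<and> j = 0 \<and> k = 0 \<or> i = 0 \<and> j = 2 \<and> k = 0 \<or> i = 0 \<and> j = 0 \<and> k = 2
    \<or> i = 0 \<and> j = 1 \<and> k = 1 \<or> i = 1 \<and> j = 0 \<and> k = 1 \<or> i = 1 \<and> j = 1 \<and> k = 0"
  proof -
    have "i = 0 \<or> i = 1 \<or> i = 2" "j = 0 \<or> j = 1 \<or> j = 2" using monomial(1) by arith+
    with monomial(1) show ?thesis by (elim disjE) simp_all
  qed
  then have "(\<lambda>x y z. e * x ^ i * y ^ j * z ^ k + g x y z) = quadric (c1 + (if i = 2 then e else 0))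
    (c2 + (if j = 2 then e else 0)) (c3 + (if k = 2 then e else 0)) (c4 + (if j = 1 \<and> k = 1 then e else 0))
    (c5 + (if i = 1 \<and> k = 1 then e else 0)) (c6 + (if i = 1 \<and> j = 1 then e else 0))"
    unfolding g by (elim disjE conjE; hypsubst) (simp_all add: quadric_def fun_eq_iff distrib_right mult.assoc add_ac)
  then show ?case by blast
qed

lemma quadric_rot: "quadric c1 c2 c3 c4 c5 c6 x y z = quadric c2 c3 c1 c5 c6 c4 y z x"
  by (simp add: quadric_def algebra_simps)

lemma quadric_rot': "quadric c1 c2 c3 c4 c5 c6 x y z = quadric c3 c1 c2 c6 c4 c5 z x y"
  by (simp add: quadric_def algebra_simps)

text \<open>With (f, g, h) = (0, -w^2 * septic u, septic u) a quadratic expression in the octics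
  restricts to the left-hand side, as w^4 = w. The square of \<open>septic\<close> cancels as a
  polynomial in u; the remaining coefficients of 1, u and u^2 are quadratic in w and are split by
  \<open>fourier_0\<close>.\<close>

lemma quadric_line:
  assumes "\<And>w u. w \<in> \<mu> \<Longrightarrow> (septic u)^2 * (w * quadric y1 y2 y3 y4 y5 y6 (w^2 * u) w 1
    - w^2 * quadric v1 v2 v3 v4 v5 v6 (w^2 * u) w 1 + quadric z1 z2 z3 z4 z5 z6 (w^2 * u) w 1) = 0"
  shows "y1 = 0" "v1 = 0" "z1 = 0" "y5 + z6 = 0" "y6 = v5" "z5 = v6"
    "v4 = y2 + z3" "v2 = y3 + z4" "v3 = y4 + z2"
proof -
  have *: "y1 * w^2 - v1 + z1 * w = 0 \<and> (y5 + z6) + (y6 - v5) * w + (z5 - v6) * w^2 = 0 \<and>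
    (y2 - v4 + z3) + (y3 - v2 + z4) * w + (y4 - v3 + z2) * w^2 = 0" if w: "w \<in> \<mu>" for w
  proof -
    have w3: "w ^ 3 = 1" using w by (simp add: mu_iff)
    let ?p = "[:(y2 - v4 + z3) + (y3 - v2 + z4) * w + (y4 - v3 + z2) * w^2,
      (y5 + z6) + (y6 - v5) * w + (z5 - v6) * w^2, y1 * w^2 - v1 + z1 * w:]"
    have "hpoly ^ 2 * ?p = 0"
    proof (rule poly_eqI_all)
      fix u
      have "w * quadric y1 y2 y3 y4 y5 y6 (w^2 * u) w e - w^2 * quadric v1 v2 v3 v4 v5 v6 (w^2 * u) w e
        + quadric z1 z2 z3 z4 z5 z6 (w^2 * u) w e = ((y2 - v4 + z3) + (y3 - v2 + z4) * w + (y4 - v3 + z2) * w^2)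
          + u * (((y5 + z6) + (y6 - v5) * w + (z5 - v6) * w^2) + u * (y1 * w^2 - v1 + z1 * w))" if "e = 1" for e
        unfolding quadric_def using w3 that by algebra
      from this[OF refl] assms[OF w, of u] show "poly (hpoly ^ 2 * ?p) u = poly 0 u"
        unfolding poly_mult poly_power poly_hpoly by simp
    qed
    then have "hpoly ^ 2 = 0 \<or> ?p = 0" by (rule mult_eq_0_iff[THEN iffD1])
    moreover have "hpoly \<noteq> 0" using degree_hpoly by auto
    ultimately have "?p = 0" by (simp only: power_eq_0_iff) simp
    then show ?thesis by simp
  qed
  have "y1 = 0 \<and> v1 = 0 \<and> z1 = 0" using fourier_0[of "- v1" z1 y1] * by (simp add: algebra_simps)
  then show "y1 = 0" "v1 = 0" "z1 = 0" by auto
  show "y5 + z6 = 0" "y6 = v5" "z5 = v6"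
    using fourier_0[of "y5 + z6" "y6 - v5" "z5 - v6"] * by auto
  show "v4 = y2 + z3" "v2 = y3 + z4" "v3 = y4 + z2"
    using fourier_0[of "y2 - v4 + z3" "y3 - v2 + z4" "y4 - v3 + z2"] * by (auto simp: algebra_simps)
qed

definition octics_sq where
  "octics_sq X Y Z U V W x y z = X x y z * (octic y z x)^2 + Y x y z * (octic z x y)^2 + Z x y z * (octic x y z)^2
     + U x y z * (octic y z x * octic z x y) + V x y z * (octic x y z * octic y z x)
     + W x y z * (octic z x y * octic x y z)"

definition in_octics_sq :: "('k \<Rightarrow> 'k \<Rightarrow> 'k \<Rightarrow> 'k) \<Rightarrow> bool" where
  "in_octics_sq H \<longleftrightarrow> (\<exists>X\<in>form 2. \<exists>Y\<in>form 2. \<exists>Z\<in>form 2. \<exists>U\<in>form 2. \<exists>V\<in>form 2. \<exists>W\<in>form 2.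
     \<forall>x y z. H x y z = octics_sq X Y Z U V W x y z)"

lemma in_octics_sq_0: "in_octics_sq (\<lambda>x y z. 0)"
  unfolding in_octics_sq_def octics_sq_def by (intro bexI[OF _ form.zero]) simp

lemma in_octics_sq_add:
  assumes "in_octics_sq H" "in_octics_sq H'"
  shows "in_octics_sq (\<lambda>x y z. H x y z + H' x y z)"
proof -
  from assms(1) obtain X Y Z U V W where 1: "X \<in> form 2" "Y \<in> form 2" "Z \<in> form 2" "U \<in> form 2" "V \<in> form 2" "W \<in> form 2"
    "\<forall>x y z. H x y z = octics_sq X Y Z U V W x y z" unfolding in_octics_sq_def by (elim bexE) (rule that)
  from assms(2) obtain X' Y' Z' U' V' W' where 2: "X' \<in> form 2" "Y' \<in> form 2" "Z' \<in> form 2" "U' \<in> form 2"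
    "V' \<in> form 2" "W' \<in> form 2"
    "\<forall>x y z. H' x y z = octics_sq X' Y' Z' U' V' W' x y z" unfolding in_octics_sq_def by (elim bexE) (rule that)
  have *: "x * a + y * b + z * c + u * d + v * e + w * f + (x' * a + y' * b + z' * c + u' * d + v' * e + w' * f) =
    (x + x') * a + (y + y') * b + (z + z') * c + (u + u') * d + (v + v') * e + (w + w') * f"
    for x y z u v w x' y' z' u' v' w' a b c d e f :: 'k by algebra
  show ?thesis unfolding in_octics_sq_def
    by (intro bexI[OF _ form_add[OF 1(1) 2(1)]] bexI[OF _ form_add[OF 1(2) 2(2)]] bexI[OF _ form_add[OF 1(3) 2(3)]]
      bexI[OF _ form_add[OF 1(4) 2(4)]] bexI[OF _ form_add[OF 1(5) 2(5)]] bexI[OF _ form_add[OF 1(6) 2(6)]] allI)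
      (simp only: 1(7)[rule_format] 2(7)[rule_format] octics_sq_def *)
qed

lemma in_octics_sq_mult:
  assumes "in_octics e g" "in_octics e' g'" "e + e' = 2"
  shows "in_octics_sq (\<lambda>x y z. g x y z * g' x y z)"
proof -
  from assms(1) obtain a b c where 1: "a \<in> form e" "b \<in> form e" "c \<in> form e"
    "\<forall>x y z. g x y z = a x y z * octic y z x + b x y z * octic z x y + c x y z * octic x y z"
    unfolding in_octics_def by (elim bexE) (rule that)
  from assms(2) obtain a' b' c' where 2: "a' \<in> form e'" "b' \<in> form e'" "c' \<in> form e'"
    "\<forall>x y z. g' x y z = a' x y z * octic y z x + b' x y z * octic z x y + c' x y z * octic x y z"
    unfolding in_octics_def by (elim bexE) (rule that)
  have *: "(a * p + b * q + c * r) * (a' * p + b' * q + c' * r) = a * a' * p^2 + b * b' * q^2 + c * c' * r^2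
    + (a * b' + b * a') * (p * q) + (a * c' + c * a') * (r * p) + (b * c' + c * b') * (q * r)"
    for a b c a' b' c' p q r :: 'k by algebra
  note m = form_mult[where m = e and n = e', unfolded assms(3)]
  show ?thesis unfolding in_octics_sq_def octics_sq_def
    by (intro bexI[OF _ m[OF 1(1) 2(1)]] bexI[OF _ m[OF 1(2) 2(2)]] bexI[OF _ m[OF 1(3) 2(3)]]
      bexI[OF _ form_add[OF m[OF 1(1) 2(2)] m[OF 1(2) 2(1)]]] bexI[OF _ form_add[OF m[OF 1(1) 2(3)] m[OF 1(3) 2(1)]]]
      bexI[OF _ form_add[OF m[OF 1(2) 2(3)] m[OF 1(3) 2(2)]]] allI)
      (simp only: 1(4)[rule_format] 2(4)[rule_format] *)
qed

text \<open>The linear conditions from the three pencils force the quadratic expression in f, g, h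
  to factor as (x f + y g + z h) * (a f + b g + c h) with linear forms a, b, c. The first factor is
  3 * \<Phi>, so the cofactor of \<Phi> is a combination of the octics and vanishes at
  [1:1:1].\<close>

lemma in_octics_sq_nine_lines:
  assumes H: "in_octics_sq H"
    and A: "\<And>w x z. w \<in> \<mu> \<Longrightarrow> H x (w * z) z = 0"
    and B: "\<And>w x y. w \<in> \<mu> \<Longrightarrow> H x y (w * x) = 0"
    and C: "\<And>w y z. w \<in> \<mu> \<Longrightarrow> H (w * y) y z = 0"
  shows "\<exists>G\<in>form 9. (\<forall>x y z. H x y z = (y ^ 3 - z ^ 3) * (z ^ 3 - x ^ 3) * (x ^ 3 - y ^ 3) * G x y z) \<and> G 1 1 1 = 0"
proof -
  from H obtain X Y Z U V W where q: "X \<in> form 2" "Y \<in> form 2" "Z \<in> form 2" "U \<in> form 2" "V \<in> form 2" "W \<in> form 2"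
    and e0: "\<forall>x y z. H x y z = octics_sq X Y Z U V W x y z" unfolding in_octics_sq_def by (elim bexE) (rule that)
  note e = e0[unfolded octics_sq_def]
  obtain x1 x2 x3 x4 x5 x6 where X: "X = quadric x1 x2 x3 x4 x5 x6" using form_2_quadric[OF q(1)] by blast
  obtain y1 y2 y3 y4 y5 y6 where Y: "Y = quadric y1 y2 y3 y4 y5 y6" using form_2_quadric[OF q(2)] by blast
  obtain z1 z2 z3 z4 z5 z6 where Z: "Z = quadric z1 z2 z3 z4 z5 z6" using form_2_quadric[OF q(3)] by blast
  obtain u1 u2 u3 u4 u5 u6 where U: "U = quadric u1 u2 u3 u4 u5 u6" using form_2_quadric[OF q(4)] by blast
  obtain v1 v2 v3 v4 v5 v6 where V: "V = quadric v1 v2 v3 v4 v5 v6" using form_2_quadric[OF q(5)] by blast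
  obtain w1 w2 w3 w4 w5 w6 where W: "W = quadric w1 w2 w3 w4 w5 w6" using form_2_quadric[OF q(6)] by blast
  \<comment> \<open>Common to the three pencils: the values of the octics on a line are 0, -w^2 * h2
    and h2, in cyclic order.\<close>
  have line: "h2^2 * (w * Y' - w^2 * W' + Z') = 0" if "w \<in> \<mu>"
    "0 = X' * 0^2 + Y' * (- (w^2 * h2))^2 + Z' * h2^2 + U' * (0 * - (w^2 * h2)) + V' * (h2 * 0) + W' * (- (w^2 * h2) * h2)"
    for X' Y' Z' U' V' W' w h2
  proof -
    have "(w^2 * h2)^2 = w * h2^2" using that(1)[unfolded mu_iff] by algebra
    with that(2) show ?thesis by (simp add: algebra_simps power2_eq_square)
  qed
  have a: "(septic u)^2 * (w * Y (w^2 * u) w 1 - w^2 * W (w^2 * u) w 1 + Z (w^2 * u) w 1) = 0" if w: "w \<in> \<mu>" for w u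
  proof (rule line[OF w])
    show "0 = X (w^2 * u) w 1 * 0^2 + Y (w^2 * u) w 1 * (- (w^2 * septic u))^2 + Z (w^2 * u) w 1 * (septic u)^2
      + U (w^2 * u) w 1 * (0 * - (w^2 * septic u)) + V (w^2 * u) w 1 * (septic u * 0) + W (w^2 * u) w 1 * (- (w^2 * septic u) * septic u)"
      using e[rule_format, of "w^2 * u" w 1] A[OF w, of "w^2 * u" 1] w octic_mu octic_mu_0 by (simp add: mu_iff)
  qed
  have b: "(septic u)^2 * (w * Z 1 (w^2 * u) w - w^2 * V 1 (w^2 * u) w + X 1 (w^2 * u) w) = 0" if w: "w \<in> \<mu>" for w u
  proof (rule line[OF w])
    show "0 = Y 1 (w^2 * u) w * 0^2 + Z 1 (w^2 * u) w * (- (w^2 * septic u))^2 + X 1 (w^2 * u) w * (septic u)^2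
      + W 1 (w^2 * u) w * (0 * - (w^2 * septic u)) + U 1 (w^2 * u) w * (septic u * 0) + V 1 (w^2 * u) w * (- (w^2 * septic u) * septic u)"
      using e[rule_format, of 1 "w^2 * u" w] B[OF w, of 1 "w^2 * u"] w octic_mu octic_mu_0
      by (simp add: mu_iff add_ac)
  qed
  have c: "(septic u)^2 * (w * X w 1 (w^2 * u) - w^2 * U w 1 (w^2 * u) + Y w 1 (w^2 * u)) = 0" if w: "w \<in> \<mu>" for w u
  proof (rule line[OF w])
    show "0 = Z w 1 (w^2 * u) * 0^2 + X w 1 (w^2 * u) * (- (w^2 * septic u))^2 + Y w 1 (w^2 * u) * (septic u)^2
      + V w 1 (w^2 * u) * (0 * - (w^2 * septic u)) + W w 1 (w^2 * u) * (septic u * 0) + U w 1 (w^2 * u) * (- (w^2 * septic u) * septic u)"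
      using e[rule_format, of w 1 "w^2 * u"] C[OF w, of 1 "w^2 * u"] w octic_mu octic_mu_0
      by (simp add: mu_iff algebra_simps)
  qed
  note RA = quadric_line[OF a[unfolded Y W Z]]
  note RB = quadric_line[OF b[unfolded Z V X quadric_rot[of _ _ _ _ _ _ 1]]]
  note RC = quadric_line[OF c[unfolded X U Y quadric_rot'[of _ _ _ _ _ _ _ 1]]]
  \<comment> \<open>The linear forms are read off from X = x * a, Y = y * b and Z = z * c.\<close>
  define a where "a x y z = x1 * x + (x6 * y + x5 * z)" for x y z
  define b where "b x y z = y6 * x + (y2 * y + y4 * z)" for x y z
  define c where "c x y z = z5 * x + (z4 * y + z3 * z)" for x y z
  \<comment> \<open>The mixed terms y * z in X, z * x in Y and x * y in Z are negatives of each
    other around a cycle of length three, hence zero.\<close>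
  have "x4 = - y5" "y5 = - z6" "z6 = - x4" using RA(4) RB(4) RC(4) by (simp_all add: eq_neg_iff_add_eq_0 add.commute)
  then have "x4 = 0" "y5 = 0" "z6 = 0" by (simp_all add: equation_minus_iff)
  note coeffs = this RA RB RC
  have XYZ: "X x y z = x * a x y z" "Y x y z = y * b x y z" "Z x y z = z * c x y z"
    "U x y z = x * b x y z + y * a x y z" "V x y z = z * a x y z + x * c x y z"
    "W x y z = y * c x y z + z * b x y z" for x y z
    unfolding X Y Z U V W quadric_def a_def b_def c_def using coeffs
    by (simp_all add: algebra_simps power2_eq_square)
  have lin: "a \<in> form 1" "b \<in> form 1" "c \<in> form 1"
    unfolding a_def[abs_def] b_def[abs_def] c_def[abs_def]
    by (intro form_add form_scale form_x form_y form_z)+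
  let ?G = "\<lambda>x y z. 3 * (a x y z * octic y z x + (b x y z * octic z x y + c x y z * octic x y z))"
  have "?G \<in> form (1 + 8)"
    by (intro form_scale form_add form_mult lin octic_form octic_rot_form)
  moreover have "H x y z = (y ^ 3 - z ^ 3) * (z ^ 3 - x ^ 3) * (x ^ 3 - y ^ 3) * ?G x y z" for x y z
  proof -
    have "H x y z = (x * octic y z x + y * octic z x y + z * octic x y z) * (?G x y z / 3)"
      unfolding e[rule_format] XYZ by (simp add: algebra_simps power2_eq_square)
    then show ?thesis unfolding octic_Euler by simp
  qed
  moreover have "?G 1 1 1 = 0" by (simp add: octic_def)
  ultimately show ?thesis by (intro bexI[of _ ?G]) simp_all
qed

end

subsection \<open>From polynomials to graded sums of forms\<close>

abbreviation "lookup \<equiv> Poly_Mapping.lookup"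
abbreviation "keys \<equiv> Poly_Mapping.keys"

definition fn :: "'k::field poly3 \<Rightarrow> 'k \<Rightarrow> 'k \<Rightarrow> 'k \<Rightarrow> 'k" where
  "fn p x y z = peval p (vector [x, y, z])"

lemma vector_eta: "vector [v $ 1, v $ 2, v $ 3] = (v :: 'k::field ^ 3)"
  by (simp add: vec_eq_iff forall_3)

lemma peval_fn: "peval p v = fn p (v $ 1) (v $ 2) (v $ 3)"
  by (simp add: fn_def vector_eta)

lemma peval_superset:
  "finite S \<Longrightarrow> keys p \<subseteq> S \<Longrightarrow>
    peval p v = (\<Sum>m\<in>S. lookup p m * (\<Prod>i\<in>UNIV. v $ i ^ lookup m i))"
  unfolding peval_def by (rule sum.mono_neutral_left) (auto simp: in_keys_iff)

lemma peval_0: "peval 0 v = 0"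
  by (simp add: peval_def)

lemma peval_add: "peval (p + q) v = peval p v + peval q v"
proof -
  let ?S = "keys p \<union> keys q"
  have "peval (p + q) v = (\<Sum>m\<in>?S. lookup (p + q) m * (\<Prod>i\<in>UNIV. v $ i ^ lookup m i))"
    by (rule peval_superset) (simp_all add: Poly_Mapping.keys_add)
  also have "\<dots> = peval p v + peval q v"
    by (simp add: peval_superset[of ?S] lookup_add distrib_right sum.distrib)
  finally show ?thesis .
qed

lemma peval_sum: "peval (\<Sum>a\<in>S. p a) v = (\<Sum>a\<in>S. peval (p a) v)"
  by (induction S rule: infinite_finite_induct) (simp_all add: peval_0 peval_add)

lemma peval_single: "peval (Poly_Mapping.single m c) v = c * (\<Prod>i\<in>UNIV. v $ i ^ lookup m i)"
  by (subst peval_superset[of "{m}"]) auto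

lemma poly_mapping_sum_single:
  "(\<Sum>m\<in>keys p. Poly_Mapping.single m (lookup p m)) = p"
  by (rule poly_mapping_eqI) (auto simp: lookup_sum lookup_single when_def in_keys_iff)

lemma peval_mult: "peval (p * q) v = peval p v * peval q v"
proof -
  let ?s = "\<lambda>p m. Poly_Mapping.single m (lookup p m)"
  have "p * q = (\<Sum>m\<in>keys p. ?s p m) * (\<Sum>n\<in>keys q. ?s q n)"
    by (simp only: poly_mapping_sum_single)
  also have "\<dots> = (\<Sum>m\<in>keys p. \<Sum>n\<in>keys q.
      Poly_Mapping.single (m + n) (lookup p m * lookup q n))"
    by (simp add: sum_product mult_single)
  finally have "peval (p * q) v = (\<Sum>m\<in>keys p. \<Sum>n\<in>keys q.
      (lookup p m * (\<Prod>i\<in>UNIV. v $ i ^ lookup m i)) *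
      (lookup q n * (\<Prod>i\<in>UNIV. v $ i ^ lookup n i)))"
    by (simp add: peval_sum peval_single lookup_add power_add prod.distrib mult_ac)
  then show ?thesis by (simp add: peval_def sum_product)
qed

lemma fn_add: "fn (p + q) x y z = fn p x y z + fn q x y z" and fn_mult: "fn (p * q) x y z = fn p x y z * fn q x y z"
  by (simp_all add: fn_def peval_add peval_mult)

lemma prod_UNIV_3: "(\<Prod>i\<in>(UNIV :: 3 set). f i) = f 1 * f 2 * f 3"
  unfolding UNIV_3 by (simp add: mult.assoc)

lemma homogeneous_fn_form:
  assumes "homogeneous d p"
  shows "fn p \<in> form d"
proof -
  let ?L = lookup
  have "(\<lambda>x y z. \<Sum>m\<in>S. ?L p m * x ^ ?L m 1 * y ^ ?L m 2 * z ^ ?L m 3) \<in> form d"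
    if "finite S" "S \<subseteq> keys p" for S
    using that
  proof (induction S)
    case (insert m S)
    then have "?L m 1 + ?L m 2 + ?L m 3 = d" using assms by (simp add: homogeneous_def sum_3)
    from form.monomial[OF this insert.IH, of "?L p m"] insert show ?case by simp
  qed (simp add: form.zero)
  moreover have "fn p = (\<lambda>x y z. \<Sum>m\<in>keys p. ?L p m * x ^ ?L m 1 * y ^ ?L m 2 * z ^ ?L m 3)"
    by (intro ext) (simp add: fn_def peval_def prod_UNIV_3 mult.assoc)
  ultimately show ?thesis by simp
qed

text \<open>Finite sums of elements of graded pieces. The family A will be that of all forms, of the
  forms in I or of the forms in I^2, so that one extraction of components,
  \<open>tot_component\<close>, serves the graded setting.\<close>

inductive_set tot :: "(nat \<Rightarrow> ('k::field \<Rightarrow> 'k \<Rightarrow> 'k \<Rightarrow> 'k) set) \<Rightarrow> ('k \<Rightarrow> 'k \<Rightarrow> 'k \<Rightarrow> 'k) set"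
  for A where
  zero: "(\<lambda>x y z. 0) \<in> tot A"
| add: "g \<in> A n \<Longrightarrow> f \<in> tot A \<Longrightarrow> (\<lambda>x y z. g x y z + f x y z) \<in> tot A"

lemma tot_single: "g \<in> A n \<Longrightarrow> g \<in> tot A"
  using tot.add[OF _ tot.zero] by fastforce

lemma tot_add: "f \<in> tot A \<Longrightarrow> g \<in> tot A \<Longrightarrow> (\<lambda>x y z. f x y z + g x y z) \<in> tot A"
proof (induction rule: tot.induct)
  case (add h n f)
  from tot.add[OF add(1) add.IH[OF add.prems]] show ?case by (simp add: add.assoc)
qed simp

lemma tot_mult:
  assumes C: "\<And>g h m n. g \<in> A m \<Longrightarrow> h \<in> B n \<Longrightarrow> (\<lambda>x y z. g x y z * h x y z) \<in> C (m + n)"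
    and f: "f \<in> tot A" and g: "g \<in> tot B"
  shows "(\<lambda>x y z. f x y z * g x y z) \<in> tot C"
  using f
proof induction
  case zero
  show ?case by (simp add: tot.zero)
next
  case (add a m f)
  have "(\<lambda>x y z. a x y z * g x y z) \<in> tot C" using g
  proof induction
    case zero
    show ?case by (simp add: tot.zero)
  next
    case (add b n g)
    from tot.add[OF C[OF \<open>a \<in> A m\<close> add(1)] add(3)] show ?case by (simp add: distrib_left)
  qed
  from tot_add[OF this add(3)] show ?case by (simp add: distrib_right)
qed

lemma fn_tot_form: "fn p \<in> tot form"
proof -
  have "fn (\<Sum>m\<in>S. Poly_Mapping.single m (c m)) \<in> tot form" if "finite S" for S :: "(3 \<Rightarrow>\<^sub>0 nat) set" and c :: "_ \<Rightarrow> 'k::field"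
    using that
  proof (induction S)
    case empty
    show ?case by (simp add: fn_def[abs_def] peval_0 tot.zero)
  next
    case (insert m S)
    have "homogeneous (\<Sum>i\<in>UNIV. lookup m i) (Poly_Mapping.single m (c m))"
      by (simp add: homogeneous_def)
    from tot.add[where A = form, OF homogeneous_fn_form[OF this] insert.IH] insert(1,2) show ?case
      by (simp add: fn_add[abs_def])
  qed
  from this[of "keys p" "lookup p"] show ?thesis
    by (simp add: poly_mapping_sum_single)
qed

text \<open>The degree \<open>m\<close> component is read off as the coefficient of \<open>c ^ m\<close> after scaling the argument by \<open>c\<close>.\<close>

lemma tot_component:
  fixes A :: "nat \<Rightarrow> ('k::field_char_0 \<Rightarrow> 'k \<Rightarrow> 'k \<Rightarrow> 'k) set"
  assumes f: "f \<in> tot A" "f \<in> form m" and A: "\<And>n. A n \<subseteq> form n" "(\<lambda>x y z. 0) \<in> A m"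
    "\<And>g h. g \<in> A m \<Longrightarrow> h \<in> A m \<Longrightarrow> (\<lambda>x y z. g x y z + h x y z) \<in> A m"
  shows "f \<in> A m"
proof -
  have "\<exists>u\<in>A m. \<forall>x y z. \<exists>p. (\<forall>c. poly p c = f (c * x) (c * y) (c * z)) \<and> coeff p m = u x y z"
    using f(1)
  proof induction
    case zero
    show ?case by (rule bexI[OF _ A(2)], intro allI exI[of _ 0]) simp
  next
    case (add g n f)
    then obtain u where u: "u \<in> A m"
      "\<And>x y z. \<exists>p. (\<forall>c. poly p c = f (c * x) (c * y) (c * z)) \<and> coeff p m = u x y z" by blast
    have g: "g (c * x) (c * y) (c * z) = c ^ n * g x y z" for c x y z
      using add(1) A(1) form_homogeneous by blast
    define v where "v = (if n = m then (\<lambda>x y z. g x y z + u x y z) else u)"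
    have "v \<in> A m" using A(3)[OF _ u(1), of g] add(1) u(1) by (auto simp: v_def)
    moreover have "\<exists>p. (\<forall>c. poly p c = g (c * x) (c * y) (c * z) + f (c * x) (c * y) (c * z)) \<and> coeff p m = v x y z" for x y z
    proof -
      obtain p where "\<And>c. poly p c = f (c * x) (c * y) (c * z)" "coeff p m = u x y z" using u(2) by blast
      then show ?thesis
        by (intro exI[of _ "monom (g x y z) n + p"]) (auto simp: poly_monom g v_def mult.commute)
    qed
    ultimately show ?case by blast
  qed
  then obtain u where u: "u \<in> A m"
    "\<And>x y z. \<exists>p. (\<forall>c. poly p c = f (c * x) (c * y) (c * z)) \<and> coeff p m = u x y z" by blast
  have "f x y z = u x y z" for x y z
  proof -
    obtain p where p: "\<And>c. poly p c = f (c * x) (c * y) (c * z)" "coeff p m = u x y z" using u(2) by blast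
    have "p = monom (f x y z) m"
      by (rule poly_eqI_all) (simp add: p(1) form_homogeneous[OF f(2)] poly_monom mult.commute)
    with p(2) show ?thesis by simp
  qed
  then have "f = u" by (simp add: fun_eq_iff)
  with u(1) show ?thesis by simp
qed

lemma ideal_gen_induct [consumes 1, case_names zero add]:
  assumes "p \<in> ideal_gen S" "P 0" "\<And>c s q. s \<in> S \<Longrightarrow> P q \<Longrightarrow> P (c * s + q)"
  shows "P p"
  using module.span_induct_alt[OF module_times, of p S P] assms unfolding ideal_gen_def by metis

section \<open>The square of the ideal in degree 18\<close>

context cube_roots
begin

definition van_form :: "nat \<Rightarrow> ('k \<Rightarrow> 'k \<Rightarrow> 'k \<Rightarrow> 'k) set" where
  "van_form n = {g \<in> form n. vanishing g}"

text \<open>The degree n piece of I^2 as sums of products of two homogeneous elements. Polynomial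
  cofactors are absorbed into the first factor, see \<open>van_sq_mult\<close>.\<close>

inductive_set van_sq :: "nat \<Rightarrow> ('k \<Rightarrow> 'k \<Rightarrow> 'k \<Rightarrow> 'k) set" for n where
  zero: "(\<lambda>x y z. 0) \<in> van_sq n"
| add: "g \<in> van_form i \<Longrightarrow> h \<in> van_form j \<Longrightarrow> i + j = n \<Longrightarrow> f \<in> van_sq n \<Longrightarrow>
    (\<lambda>x y z. g x y z * h x y z + f x y z) \<in> van_sq n"

lemma van_form_mult: "g \<in> form m \<Longrightarrow> h \<in> van_form n \<Longrightarrow> (\<lambda>x y z. g x y z * h x y z) \<in> van_form (m + n)"
  by (auto simp: van_form_def vanishing_def van1_def intro: form_mult)

lemma van_sq_single: "g \<in> van_form m \<Longrightarrow> h \<in> van_form n \<Longrightarrow> (\<lambda>x y z. g x y z * h x y z) \<in> van_sq (m + n)"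
  using van_sq.add[OF _ _ refl van_sq.zero, of g m h n] by simp

lemma van_sq_add: "f \<in> van_sq n \<Longrightarrow> g \<in> van_sq n \<Longrightarrow> (\<lambda>x y z. f x y z + g x y z) \<in> van_sq n"
proof (induction rule: van_sq.induct)
  case (add g' i h j f)
  from van_sq.add[OF add(1-3) add.IH[OF add.prems]] show ?case by (simp add: add.assoc)
qed simp

lemma van_sq_form: "f \<in> van_sq n \<Longrightarrow> f \<in> form n"
  by (induction rule: van_sq.induct) (auto simp: van_form_def intro: form.zero form_add form_mult)

lemma van_sq_mult: "g \<in> form m \<Longrightarrow> f \<in> van_sq n \<Longrightarrow> (\<lambda>x y z. g x y z * f x y z) \<in> van_sq (m + n)"
proof (rotate_tac 1, induction rule: van_sq.induct)
  case zero
  then show ?case by (simp add: van_sq.zero)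
next
  case (add g' i h j f)
  have "m + i + j = m + n" using add(3) by simp
  from van_sq.add[OF van_form_mult[OF add.prems add(1)] add(2) this add.IH[OF add.prems]]
  show ?case by (simp add: algebra_simps)
qed

text \<open>For i + j = 18 either one of the degrees is below 8, and that factor is zero, or both
  lie between 8 and 10, where the octics are known to generate.\<close>

lemma van_sq_18: "H \<in> van_sq 18 \<Longrightarrow> in_octics_sq H"
proof (induction rule: van_sq.induct)
  case zero
  show ?case by (rule in_octics_sq_0)
next
  case (add g i h j f)
  have "in_octics_sq (\<lambda>x y z. g x y z * h x y z)"
  proof -
    have gh: "g \<in> form i" "vanishing g" "h \<in> form j" "vanishing h" using add(1,2) by (auto simp: van_form_def)
    consider "i < 8" | "j < 8" | "i = 8" "j = 10" | "i = 9" "j = 9" | "i = 10" "j = 8"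
      using add(3) by linarith
    then show ?thesis
    proof cases
      case 1
      then show ?thesis using vanishing_low_degree[OF gh(1) _ gh(2)] in_octics_sq_0 by simp
    next
      case 2
      then show ?thesis using vanishing_low_degree[OF gh(3) _ gh(4)] in_octics_sq_0 by simp
    next
      case 3
      then show ?thesis
        using in_octics_sq_mult[OF vanishing_degree_8 vanishing_degree_10] gh by simp
    next
      case 4
      then show ?thesis
        using in_octics_sq_mult[OF vanishing_degree_9 vanishing_degree_9] gh by simp
    next
      case 5
      then show ?thesis
        using in_octics_sq_mult[OF vanishing_degree_10 vanishing_degree_8] gh by simp
    qed
  qed
  from in_octics_sq_add[OF this add.IH] show ?case .
qed

text \<open>The set Z enters only through the test \<open>vanishing\<close>. The generators of the
  ideal are homogeneous, so an element of its square is a sum of graded pieces; being a form of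
  degree 18, it equals its component in that degree.\<close>

theorem ideal_square_nine_lines:
  assumes Z: "\<And>p. (\<And>P x. P \<in> Z \<Longrightarrow> x \<in> P \<Longrightarrow> peval p x = 0) \<Longrightarrow> vanishing (fn p)"
    and p: "p \<in> ideal_power (point_ideal Z) 2" "fn p \<in> form 18"
    and lines: "\<And>w x z. w \<in> \<mu> \<Longrightarrow> fn p x (w * z) z = 0" "\<And>w x y. w \<in> \<mu> \<Longrightarrow> fn p x y (w * x) = 0"
      "\<And>w y z. w \<in> \<mu> \<Longrightarrow> fn p (w * y) y z = 0"
  shows "\<exists>G\<in>form 9. (\<forall>x y z. fn p x y z = (y ^ 3 - z ^ 3) * (z ^ 3 - x ^ 3) * (x ^ 3 - y ^ 3) * G x y z) \<and> G 1 1 1 = 0"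
proof -
  have step: "fn (c * s + q) \<in> tot A"
    if "fn s \<in> tot A" "fn q \<in> tot A" "\<And>g h m n. g \<in> form m \<Longrightarrow> h \<in> A n \<Longrightarrow> (\<lambda>x y z. g x y z * h x y z) \<in> A (m + n)"
    for c s q and A
  proof -
    have "(\<lambda>x y z. fn c x y z * fn s x y z) \<in> tot A"
      by (rule tot_mult[where A = form and B = A and C = A, OF _ fn_tot_form that(1)]) (rule that(3))
    from tot_add[OF this that(2)] show ?thesis by (simp add: fn_add[abs_def] fn_mult[abs_def])
  qed
  have fn0: "fn 0 \<in> tot A" for A :: "nat \<Rightarrow> ('k \<Rightarrow> 'k \<Rightarrow> 'k \<Rightarrow> 'k) set"
    by (simp add: fn_def[abs_def] peval_0 tot.zero)
  have I: "fn q \<in> tot van_form" if "q \<in> point_ideal Z" for q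
    using that unfolding point_ideal_def
  proof (induction rule: ideal_gen_induct)
    case (add c s q)
    then obtain d where "homogeneous d s" "\<And>P x. P \<in> Z \<Longrightarrow> x \<in> P \<Longrightarrow> peval s x = 0" by blast
    then have "fn s \<in> van_form d" using Z homogeneous_fn_form by (auto simp: van_form_def)
    then show ?case using add.IH tot_single by (intro step van_form_mult) blast+
  qed (rule fn0)
  \<comment> \<open>\<open>ideal_power\<close> ends in the unit ideal, so the second factor of the
    square is a product with \<open>UNIV\<close>.\<close>
  have I': "fn q \<in> tot van_form" if "q \<in> ideal_mult (point_ideal Z) UNIV" for q
    using that unfolding ideal_mult_def
  proof (induction rule: ideal_gen_induct)
    case (add c s q)
    then obtain a b where ab: "s = b * a" "a \<in> point_ideal Z" by (auto simp: mult.commute)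
    have "fn (b * a + 0) \<in> tot van_form" by (intro step I ab fn0 van_form_mult)
    with ab add.IH show ?case by (intro step van_form_mult) simp_all
  qed (rule fn0)
  have "fn p \<in> tot van_sq"
    using p(1) unfolding numeral_2_eq_2 ideal_power.simps ideal_mult_def[of _ "ideal_mult _ _"]
  proof (induction rule: ideal_gen_induct)
    case (add c s q)
    then obtain a b where ab: "s = a * b" "a \<in> point_ideal Z" "b \<in> ideal_mult (point_ideal Z) UNIV" by blast
    have "(\<lambda>x y z. fn a x y z * fn b x y z) \<in> tot van_sq"
      by (rule tot_mult[where A = van_form and B = van_form and C = van_sq, OF _ I[OF ab(2)] I'[OF ab(3)]])
        (rule van_sq_single)
    then have "fn s \<in> tot van_sq" by (simp add: ab(1) fn_mult[abs_def])
    with add.IH show ?case by (intro step van_sq_mult)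
  qed (rule fn0)
  then have "fn p \<in> van_sq 18"
    by (rule tot_component[OF _ p(2)]) (auto intro: van_sq_form van_sq.zero van_sq_add)
  from in_octics_sq_nine_lines[OF van_sq_18[OF this] lines] show ?thesis .
qed

end

subsection \<open>Points, lines and third points on the Fermat cubic\<close>

abbreviation dot :: "'k::field ^ 3 \<Rightarrow> 'k ^ 3 \<Rightarrow> 'k" where
  "dot \<equiv> scalar_product"

lemma sp_3: "dot a (x :: 'k::field ^ 3) = a $ 1 * x $ 1 + a $ 2 * x $ 2 + a $ 3 * x $ 3"
  by (simp add: scalar_product_def sum_3)

lemma sp_linear:
  "dot a (c *s x) = c * dot a (x :: 'k::field ^ 3)"
  "dot a (x + y) = dot a x + dot a y"
  "dot a (x - y) = dot a x - dot a y"
  "dot (c *s a) x = c * dot a x"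
  "dot (a + b) x = dot a x + dot b x"
  by (simp_all add: sp_3 algebra_simps)

lemma sp_0: "dot 0 (x :: 'k::field ^ 3) = 0"
  by (simp add: sp_3)

lemma mem_pt: "x \<in> pt p \<longleftrightarrow> (\<exists>c. c \<noteq> 0 \<and> x = c *s p)"
  by (auto simp: pt_def)

lemma self_pt: "p \<in> pt p"
  unfolding mem_pt by (rule exI[of _ 1]) simp

lemma ball_pt: "(\<And>c. c \<noteq> 0 \<Longrightarrow> F (c *s p) = F p) \<Longrightarrow> (\<forall>x\<in>pt p. F x) \<longleftrightarrow> F p"
  using self_pt[of p] unfolding Ball_def by (metis mem_pt)

lemma pt_scale:
  fixes p :: "'k::field ^ 3"
  assumes c: "c \<noteq> 0"
  shows "pt (c *s p) = pt p"
proof (intro equalityI subsetI)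
  fix x assume "x \<in> pt (c *s p)"
  then show "x \<in> pt p" using c unfolding mem_pt by (metis mult_eq_0_iff vector_smult_assoc)
next
  fix x assume "x \<in> pt p"
  then obtain d where "d \<noteq> 0" "x = d *s p" unfolding mem_pt by blast
  with c have "d / c \<noteq> 0" "x = (d / c) *s (c *s p)" by (simp_all add: vector_smult_assoc)
  then show "x \<in> pt (c *s p)" unfolding mem_pt by blast
qed

lemma pt_eqD: "pt p = pt q \<Longrightarrow> \<exists>c. c \<noteq> 0 \<and> p = c *s q"
  using self_pt[of p] by (simp add: mem_pt)

lemma P2_cases: "P \<in> P2 \<Longrightarrow> \<exists>p. p \<noteq> 0 \<and> P = pt p"
  by (auto simp: P2_def)

lemma pt_P2: "p \<noteq> 0 \<Longrightarrow> pt p \<in> P2"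
  by (auto simp: P2_def)

lemma pt_line: "p \<noteq> 0 \<Longrightarrow> pt p \<in> line a \<longleftrightarrow> dot a p = 0"
  unfolding line_def using ball_pt[of "\<lambda>x. dot a x = 0" p] by (simp add: pt_P2 sp_linear)

definition cross :: "'k::field ^ 3 \<Rightarrow> 'k ^ 3 \<Rightarrow> 'k ^ 3" where
  "cross p q = vector [p $ 2 * q $ 3 - p $ 3 * q $ 2, p $ 3 * q $ 1 - p $ 1 * q $ 3, p $ 1 * q $ 2 - p $ 2 * q $ 1]"

lemma cross_nth: "cross p q $ 1 = p $ 2 * q $ 3 - p $ 3 * q $ 2" "cross p q $ 2 = p $ 3 * q $ 1 - p $ 1 * q $ 3"
  "cross p q $ 3 = p $ 1 * q $ 2 - p $ 2 * q $ 1"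
  by (simp_all add: cross_def)

lemma sp_cross: "dot (cross p q) p = 0" "dot (cross p q) q = 0"
  by (simp_all add: sp_3 cross_nth algebra_simps)

lemma cross_scale: "cross (c *s p) p = 0" "cross p (c *s p) = 0" "cross p p = 0"
  by (simp_all add: vec_eq_iff forall_3 cross_nth)

lemma cross_nonzeroD: "cross p q \<noteq> 0 \<Longrightarrow> p \<noteq> 0" "cross p q \<noteq> 0 \<Longrightarrow> q \<noteq> 0"
  by (auto simp: vec_eq_iff forall_3 cross_nth)

lemma cross_nonzero_pt: "cross p q \<noteq> 0 \<Longrightarrow> pt p \<noteq> pt q"
  using pt_eqD cross_scale by metis

lemma cross_0_pt:
  fixes p q :: "'k::field ^ 3"
  assumes "cross p q = 0" "p \<noteq> 0" "q \<noteq> 0"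
  shows "pt p = pt q"
proof -
  have c: "p $ 2 * q $ 3 = p $ 3 * q $ 2" "p $ 3 * q $ 1 = p $ 1 * q $ 3" "p $ 1 * q $ 2 = p $ 2 * q $ 1"
    using assms(1) by (simp_all add: vec_eq_iff forall_3 cross_nth)
  obtain i where i: "p $ i \<noteq> 0" using assms(2) by (auto simp: vec_eq_iff)
  have "p $ i * q $ j = q $ i * p $ j" for j
    using c exhaust_3[of i] exhaust_3[of j] by (elim disjE) (simp_all add: mult.commute)
  then have q: "q = (q $ i / p $ i) *s p" using i by (simp add: vec_eq_iff field_simps)
  then have "q $ i / p $ i \<noteq> 0" using assms(3) by auto
  from pt_scale[OF this, of p] q show ?thesis by simp
qed

text \<open>Cramer's rule for p, q, m: \<open>dot (cross p q) m\<close> is their determinant, and u,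
  v are the cofactor vectors that read off coordinates on the line through p and q.\<close>

lemma dual_basis:
  fixes p q :: "'k::field ^ 3"
  assumes "cross p q \<noteq> 0"
  obtains u v m where "\<And>x. x = dot u x *s p + dot v x *s q + dot (cross p q) x *s m"
    "dot u p = 1" "dot u q = 0" "dot v p = 0" "dot v q = 1"
    "dot (cross p q) m = 1"
proof -
  obtain i where i: "cross p q $ i \<noteq> 0" using assms by (auto simp: vec_eq_iff)
  \<comment> \<open>A multiple of a unit vector, scaled so that the determinant is 1.\<close>
  define m where "m = (1 / cross p q $ i) *s axis i (1::'k)"
  have m: "dot (cross p q) m = 1"
    using i exhaust_3[of i] by (elim disjE) (simp_all add: m_def sp_3 axis_def)
  have id: "dot (cross p q) m *s x = dot (cross q m) x *s p + dot (cross m p) x *s q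
    + dot (cross p q) x *s m" for x
    by (simp add: vec_eq_iff forall_3 sp_3 cross_nth) (simp add: algebra_simps)
  show ?thesis
  proof (rule that[of "cross q m" "cross m p" m])
    show "x = dot (cross q m) x *s p + dot (cross m p) x *s q + dot (cross p q) x *s m" for x
      using id[of x] m by simp
    have "dot (cross q m) p = dot (cross p q) m" "dot (cross m p) q = dot (cross p q) m"
      by (simp_all add: sp_3 cross_nth algebra_simps)
    then show "dot (cross q m) p = 1" "dot (cross m p) q = 1" using m by simp_all
  qed (use m sp_cross in simp_all)
qed

lemma span_line:
  fixes p q :: "'k::field ^ 3"
  assumes "cross p q \<noteq> 0" "dot (cross p q) x = 0"
  shows "\<exists>a b. x = a *s p + b *s q"
  using dual_basis[OF assms(1)] assms(2) by (metis add.right_neutral vector_smult_lzero)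

lemma line_unique:
  fixes p q :: "'k::field ^ 3"
  assumes n: "cross p q \<noteq> 0" and a: "a \<noteq> 0" "dot a p = 0" "dot a q = 0"
  shows "line a = line (cross p q)"
proof -
  obtain u v m where x: "\<And>x. x = dot u x *s p + dot v x *s q + dot (cross p q) x *s m"
    using dual_basis[OF n] by metis
  have sa: "dot a x = dot (cross p q) x * dot a m" for x
    by (subst x) (simp add: sp_linear a)
  have "dot a m \<noteq> 0"
  proof
    assume "dot a m = 0"
    then have "dot a x = 0" for x using sa[of x] by simp
    from this[of "vector [1, 0, 0]"] this[of "vector [0, 1, 0]"] this[of "vector [0, 0, 1]"]
    show False using a(1) by (simp add: sp_3 vec_eq_iff forall_3)
  qed
  then have "dot a x = 0 \<longleftrightarrow> dot (cross p q) x = 0" for x using sa[of x] by auto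
  then show ?thesis unfolding line_def by simp
qed

lemma join_line_distinct:
  fixes p q :: "'k::field ^ 3"
  assumes n: "cross p q \<noteq> 0"
  shows "join_line (pt p) (pt q) = line (cross p q)"
proof -
  note pq = cross_nonzeroD[OF n]
  have "(THE l. is_line l \<and> pt p \<in> l \<and> pt q \<in> l) = line (cross p q)"
  proof (rule the_equality)
    show "is_line (line (cross p q)) \<and> pt p \<in> line (cross p q) \<and> pt q \<in> line (cross p q)"
      using n pq by (auto simp: is_line_def pt_line sp_cross)
    fix l assume "is_line l \<and> pt p \<in> l \<and> pt q \<in> l"
    then obtain a where "a \<noteq> 0" "l = line a" "pt p \<in> line a" "pt q \<in> line a" by (auto simp: is_line_def)
    then show "l = line (cross p q)" using line_unique[OF n] pq by (simp add: pt_line)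
  qed
  then show ?thesis using cross_nonzero_pt[OF n] by (simp add: join_line_def)
qed

definition sq :: "'k::field ^ 3 \<Rightarrow> 'k ^ 3" where
  "sq p = (\<chi> i. p $ i ^ 2)"

lemma sp_sq: "dot (sq p) q = p $ 1 ^ 2 * q $ 1 + p $ 2 ^ 2 * q $ 2 + p $ 3 ^ 2 * (q $ 3 :: 'k::field)"
  by (simp add: sp_3 sq_def)

lemma sq_nonzero: "p \<noteq> 0 \<Longrightarrow> sq p \<noteq> 0"
  by (auto simp: vec_eq_iff sq_def)

lemma fermat_3: "fermat x = x $ 1 ^ 3 + x $ 2 ^ 3 + x $ 3 ^ 3"
  by (simp add: fermat_def sum_3)

lemma sp_sq_self: "dot (sq p) p = fermat p"
  by (simp add: sp_sq fermat_3 power2_eq_square power3_eq_cube)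

lemma fermat_scale: "fermat (c *s x) = c ^ 3 * fermat x"
  by (simp add: fermat_3 power_mult_distrib distrib_left)

lemma pt_fermat_curve: "p \<noteq> 0 \<Longrightarrow> pt p \<in> fermat_curve \<longleftrightarrow> fermat p = 0"
  unfolding fermat_curve_def using ball_pt[of "\<lambda>x. fermat x = 0" p] by (simp add: pt_P2 fermat_scale)

lemma fermat_curve_cases: "P \<in> fermat_curve \<Longrightarrow> \<exists>p. p \<noteq> 0 \<and> fermat p = 0 \<and> P = pt p"
  using P2_cases pt_fermat_curve by (fastforce simp: fermat_curve_def)

lemma join_line_tangent:
  fixes p :: "'k::field_char_0 ^ 3"
  shows "join_line (pt p) (pt p) = line (sq p)"
proof -
  have "(\<forall>v\<in>pt p. \<forall>x\<in>X. dot (\<chi> i. 3 * v $ i ^ 2) x = 0) \<longleftrightarrow> (\<forall>x\<in>X. dot (sq p) x = 0)" for X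
  proof -
    have e: "dot (\<chi> i. 3 * (c *s p) $ i ^ 2) x = 3 * c ^ 2 * dot (sq p) x" for c x
      by (simp add: sp_3 sq_def power_mult_distrib algebra_simps)
    have "dot (\<chi> i. 3 * p $ i ^ 2) x = 3 * dot (sq p) x" for x
      using e[of 1 x] by simp
    with ball_pt[of "\<lambda>v. \<forall>x\<in>X. dot (\<chi> i. 3 * v $ i ^ 2) x = 0" p] e show ?thesis by simp
  qed
  then show ?thesis by (simp add: join_line_def tangent_line_def line_def)
qed

text \<open>The binary cubic induced on the line through p and q; the formulas for third points
  factor it.\<close>

lemma fermat_comb: "fermat (a *s p + b *s q) = a ^ 3 * fermat p + 3 * a^2 * b * dot (sq p) q
    + 3 * a * b^2 * dot (sq q) p + b ^ 3 * fermat q"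
  unfolding fermat_3 sp_sq by simp algebra

text \<open>The cubic contains no line, so the binary cubic on a line is nonzero and its third
  linear factor has a well-defined zero.\<close>

lemma fermat_no_line:
  fixes n :: "'k::field_char_0 ^ 3"
  assumes "n \<noteq> 0"
  shows "\<exists>x. dot n x = 0 \<and> fermat x \<noteq> 0"
proof (rule ccontr)
  assume "\<not> ?thesis"
  then have *: "fermat x = 0" if "dot n x = 0" for x using that by blast
  let ?a = "n $ 1" and ?b = "n $ 2" and ?c = "n $ 3"
  \<comment> \<open>The test vectors are chosen orthogonal to n; vanishing at them forces the
    coordinates of n to be zero.\<close>
  have 1: "?a ^ 3 = ?b ^ 3" using *[of "vector [- ?b, ?a, 0]"] by (simp add: sp_3 fermat_3 algebra_simps)
  have 2: "?a ^ 3 = ?c ^ 3" using *[of "vector [- ?c, 0, ?a]"] by (simp add: sp_3 fermat_3 algebra_simps)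
  have "(?c - ?b) ^ 3 = 0" using *[of "vector [?c - ?b, ?a, - ?a]"] by (simp add: sp_3 fermat_3 algebra_simps)
  then have 3: "?c = ?b" by simp
  have "(- ?b - ?c) ^ 3 + ?a ^ 3 + ?a ^ 3 = 0"
    using *[of "vector [- ?b - ?c, ?a, ?a]"] by (simp add: sp_3 fermat_3 algebra_simps)
  with 1 3 have "- 6 * ?b ^ 3 = 0" by algebra
  then have "?b = 0" by simp
  with 1 2 have "?a = 0" "?c = 0" by simp_all
  with \<open>?b = 0\<close> assms show False by (simp add: vec_eq_iff forall_3)
qed

lemma line_inter_line:
  fixes p q :: "'k::field ^ 3"
  assumes n: "cross p q \<noteq> 0" and a: "dot a p \<noteq> 0 \<or> dot a q \<noteq> 0"
  shows "line (cross p q) \<inter> line a = {pt (dot a q *s p - dot a p *s q)}"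
    and "dot a q *s p - dot a p *s q \<noteq> 0"
proof -
  let ?r = "dot a q *s p - dot a p *s q"
  obtain u v where uv: "dot u p = 1" "dot u q = 0" "dot v p = 0" "dot v q = 1"
    using dual_basis[OF n] by metis
  show r0: "?r \<noteq> 0"
  proof
    assume "?r = 0"
    then have "dot u ?r = 0" "dot v ?r = 0" by (simp_all add: sp_3)
    then have "dot a q = 0" "dot a p = 0" by (simp_all only: sp_linear uv) simp_all
    then show False using a by simp
  qed
  show "line (cross p q) \<inter> line a = {pt ?r}"
  proof
    show "{pt ?r} \<subseteq> line (cross p q) \<inter> line a"
      using r0 by (simp add: pt_line sp_linear sp_cross algebra_simps)
    show "line (cross p q) \<inter> line a \<subseteq> {pt ?r}"
    proof
      fix X assume X: "X \<in> line (cross p q) \<inter> line a"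
      then have "X \<in> P2" by (simp add: line_def)
      then obtain x where x: "x \<noteq> 0" "X = pt x" using P2_cases by blast
      obtain \<alpha> \<beta> where xe: "x = \<alpha> *s p + \<beta> *s q"
        using span_line[OF n, of x] X x by (auto simp: pt_line)
      have "\<alpha> * dot a p + \<beta> * dot a q = 0"
        using X x by (simp add: pt_line xe sp_linear)
      then have "cross x ?r = 0"
        unfolding xe by (simp add: vec_eq_iff forall_3 cross_nth) algebra
      with cross_0_pt[OF _ x(1) r0] x(2) show "X \<in> {pt ?r}" by simp
    qed
  qed
qed

text \<open>The dual vectors u and v extend a factor a1 * \<alpha> + a2 * \<beta> of the binary
  cubic to a linear form on the plane, whose zero on the line is a2 p - a1 q.\<close>

lemma cuts_outI:
  fixes p q :: "'k::field ^ 3"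
  assumes n: "cross p q \<noteq> 0"
    and nz: "a1 \<noteq> 0 \<or> a2 \<noteq> 0" "b1 \<noteq> 0 \<or> b2 \<noteq> 0" "c1 \<noteq> 0 \<or> c2 \<noteq> 0"
    and f: "\<And>\<alpha> \<beta>. fermat (\<alpha> *s p + \<beta> *s q) = (a1 * \<alpha> + a2 * \<beta>) * (b1 * \<alpha> + b2 * \<beta>) * (c1 * \<alpha> + c2 * \<beta>)"
  shows "cuts_out (line (cross p q)) (pt (a2 *s p - a1 *s q)) (pt (b2 *s p - b1 *s q)) (pt (c2 *s p - c1 *s q))"
proof -
  obtain u v where uv: "dot u p = 1" "dot u q = 0" "dot v p = 0" "dot v q = 1"
    using dual_basis[OF n] by metis
  have int: "line (cross p q) \<inter> line (d1 *s u + d2 *s v) = {pt (d2 *s p - d1 *s q)}" if "d1 \<noteq> 0 \<or> d2 \<noteq> 0" for d1 d2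
    using line_inter_line(1)[OF n, of "d1 *s u + d2 *s v"] that by (simp add: sp_linear uv)
  have fm: "fermat x = dot (a1 *s u + a2 *s v) x * dot (b1 *s u + b2 *s v) x * dot (c1 *s u + c2 *s v) x"
    if "X \<in> line (cross p q)" "x \<in> X" for X x
  proof -
    have "dot (cross p q) x = 0" using that by (simp add: line_def)
    then obtain \<alpha> \<beta> where "x = \<alpha> *s p + \<beta> *s q" using span_line[OF n] by blast
    then show ?thesis by (simp add: f sp_linear uv mult.commute)
  qed
  show ?thesis unfolding cuts_out_def
    by (rule exI[of _ "a1 *s u + a2 *s v"], rule exI[of _ "b1 *s u + b2 *s v"], rule exI[of _ "c1 *s u + c2 *s v"])
      (intro conjI ballI int[OF nz(1)] int[OF nz(2)] int[OF nz(3)], rule fm)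
qed

lemma binary_product_0:
  fixes a1 :: "'k::field_char_0"
  assumes "\<And>\<alpha> \<beta>. (a1 * \<alpha> + a2 * \<beta>) * (b1 * \<alpha> + b2 * \<beta>) * (d1 * \<alpha> + d2 * \<beta>) = 0"
    and "a1 \<noteq> 0 \<or> a2 \<noteq> 0" "b1 \<noteq> 0 \<or> b2 \<noteq> 0"
  shows "d1 = 0" "d2 = 0"
proof -
  have "[:a2, a1:] * [:b2, b1:] * [:d2, d1:] = 0"
  proof (rule poly_eq_poly_eq_iff[THEN iffD1], rule ext)
    show "poly ([:a2, a1:] * [:b2, b1:] * [:d2, d1:]) x = poly 0 x" for x
      using assms(1)[of x 1] by (simp only: poly_mult poly_pCons poly_0) (simp add: algebra_simps)
  qed
  then have "[:d2, d1:] = 0" using assms(2,3) by (auto simp only: mult_eq_0_iff pCons_eq_0_iff)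
  then show "d1 = 0" "d2 = 0" by simp_all
qed

text \<open>The points P and Q fix the first two linear factors up to scalars; cancelling them as
  polynomials fixes the third one up to a scalar.\<close>

lemma cuts_out_unique:
  fixes p q :: "'k::field_char_0 ^ 3"
  assumes n: "cross p q \<noteq> 0"
    and R: "cuts_out (line (cross p q)) P Q R" and R': "cuts_out (line (cross p q)) P Q R'"
  shows "R = R'"
proof -
  let ?l = "line (cross p q)"
  have form: "(dot a p \<noteq> 0 \<or> dot a q \<noteq> 0) \<and> X = pt (dot a q *s p - dot a p *s q)"
    if "?l \<inter> line a = {X}" for a X
  proof -
    have "dot a p \<noteq> 0 \<or> dot a q \<noteq> 0"
    proof (rule ccontr)
      assume "\<not> ?thesis"
      then have "pt p \<in> ?l \<inter> line a" "pt q \<in> ?l \<inter> line a"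
        using cross_nonzeroD[OF n] by (simp_all add: pt_line sp_cross)
      with that cross_nonzero_pt[OF n] show False by auto
    qed
    with line_inter_line(1)[OF n, of a] that show ?thesis by auto
  qed
  have proportional: "\<exists>k. k \<noteq> 0 \<and> dot a p = k * dot a' p \<and> dot a q = k * dot a' q"
    if "?l \<inter> line a = {X}" "?l \<inter> line a' = {X}" for a a' X
  proof -
    note X = that
    obtain k where k: "k \<noteq> 0" "dot a q *s p - dot a p *s q
        = k *s (dot a' q *s p - dot a' p *s q)"
      using form[OF X(1)] form[OF X(2)] pt_eqD by metis
    obtain u v where uv: "dot u p = 1" "dot u q = 0" "dot v p = 0" "dot v q = 1"
      using dual_basis[OF n] by metis
    have "dot a q = k * dot a' q" "dot a p = k * dot a' p"
      using arg_cong[OF k(2), of "dot u"] arg_cong[OF k(2), of "dot v"]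
      by (simp_all add: sp_linear uv)
    with k(1) show ?thesis by blast
  qed
  from R obtain a b c where abc: "?l \<inter> line a = {P}" "?l \<inter> line b = {Q}" "?l \<inter> line c = {R}"
    and f0: "\<forall>X\<in>?l. \<forall>x\<in>X. fermat x = dot a x * dot b x * dot c x"
    unfolding cuts_out_def by (elim exE conjE) (rule that)
  from R' obtain a' b' c' where abc': "?l \<inter> line a' = {P}" "?l \<inter> line b' = {Q}" "?l \<inter> line c' = {R'}"
    and f0': "\<forall>X\<in>?l. \<forall>x\<in>X. fermat x = dot a' x * dot b' x * dot c' x"
    unfolding cuts_out_def by (elim exE conjE) (rule that)
  note f = f0[rule_format] and f' = f0'[rule_format]
  obtain k where k: "k \<noteq> 0" "dot a' p = k * dot a p" "dot a' q = k * dot a q"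
    using proportional[OF abc'(1) abc(1)] by blast
  obtain j where j: "j \<noteq> 0" "dot b' p = j * dot b p" "dot b' q = j * dot b q"
    using proportional[OF abc'(2) abc(2)] by blast
  let ?d1 = "dot c p - k * j * dot c' p" and ?d2 = "dot c q - k * j * dot c' q"
  have "(dot a p * \<alpha> + dot a q * \<beta>) * (dot b p * \<alpha> + dot b q * \<beta>)
    * (?d1 * \<alpha> + ?d2 * \<beta>) = 0" for \<alpha> \<beta>
  \<comment> \<open>The zero vector represents no point of the line and is treated apart.\<close>
  proof (cases "\<alpha> *s p + \<beta> *s q = 0")
    case True
    obtain u v where "dot u p = 1" "dot u q = 0" "dot v p = 0" "dot v q = 1"
      using dual_basis[OF n] by metis
    with arg_cong[OF True, of "dot u"] arg_cong[OF True, of "dot v"]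
    have "\<alpha> = 0" "\<beta> = 0" by (simp_all add: sp_linear) (simp_all add: sp_3)
    then show ?thesis by simp
  next
    case False
    then have "pt (\<alpha> *s p + \<beta> *s q) \<in> ?l" by (simp add: pt_line sp_linear sp_cross)
    from f[OF this self_pt] f'[OF this self_pt] show ?thesis
      by (simp add: sp_linear k j algebra_simps)
  qed
  from binary_product_0[OF this] form[OF abc(1)] form[OF abc(2)] have "?d1 = 0" "?d2 = 0" by auto
  then have "dot c p = k * j * dot c' p" "dot c q = k * j * dot c' q" by simp_all
  then have "dot c q *s p - dot c p *s q = (k * j) *s (dot c' q *s p - dot c' p *s q)"
    by (simp add: vec_eq_iff algebra_simps)
  with form[OF abc(3)] form[OF abc'(3)] pt_scale k(1) j(1) show ?thesis by (metis mult_eq_0_iff)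
qed

lemma cuts_out_perm:
  assumes "cuts_out l P Q R"
  shows "cuts_out l Q P R" "cuts_out l P R Q"
proof -
  obtain a b c where abc: "l \<inter> line a = {P}" "l \<inter> line b = {Q}" "l \<inter> line c = {R}"
    "\<forall>X\<in>l. \<forall>x\<in>X. fermat x = dot a x * dot b x * dot c x"
    using assms unfolding cuts_out_def by (elim exE conjE) (rule that)
  show "cuts_out l Q P R" unfolding cuts_out_def
    by (rule exI[of _ b], rule exI[of _ a], rule exI[of _ c]) (simp add: abc mult_ac)
  show "cuts_out l P R Q" unfolding cuts_out_def
    by (rule exI[of _ a], rule exI[of _ c], rule exI[of _ b]) (simp add: abc mult_ac)
qed

lemma cuts_out_mem: "cuts_out l P Q R \<Longrightarrow> P \<in> l" "cuts_out l P Q R \<Longrightarrow> Q \<in> l" "cuts_out l P Q R \<Longrightarrow> R \<in> l"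
  unfolding cuts_out_def by blast+


lemma third_point_eqI:
  fixes P Q :: "'k::field_char_0 point"
  assumes "cuts_out (line (cross p q)) P Q R" "cross p q \<noteq> 0" "join_line P Q = line (cross p q)"
  shows "third_point P Q = R"
  unfolding third_point_def assms(3) using assms(1) cuts_out_unique[OF assms(2) _ assms(1)] by (rule the_equality)

text \<open>For p and q on the cubic the binary cubic is 3 \<alpha> \<beta> (A \<alpha> + B \<beta>)
  with A = \<open>dot (sq p) q\<close> and B = \<open>dot (sq q) p\<close>; the zero of the last
  factor is B p - A q.\<close>

lemma third_point_distinct:
  fixes p q :: "'k::field_char_0 ^ 3"
  assumes n: "cross p q \<noteq> 0" and f: "fermat p = 0" "fermat q = 0"
  shows "cuts_out (line (cross p q)) (pt p) (pt q)
      (pt (dot (sq q) p *s p - dot (sq p) q *s q))"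
    and "dot (sq q) p *s p - dot (sq p) q *s q \<noteq> 0"
proof -
  let ?A = "dot (sq p) q" and ?B = "dot (sq q) p"
  have fe: "fermat (\<alpha> *s p + \<beta> *s q) = 3 * \<alpha> * \<beta> * (?A * \<alpha> + ?B * \<beta>)" for \<alpha> \<beta>
    unfolding fermat_comb f by (simp add: algebra_simps power2_eq_square)
  have nz: "?A \<noteq> 0 \<or> ?B \<noteq> 0"
  proof (rule ccontr)
    assume "\<not> ?thesis"
    then have "fermat (\<alpha> *s p + \<beta> *s q) = 0" for \<alpha> \<beta> using fe by simp
    with fermat_no_line[OF n] span_line[OF n] show False by metis
  qed
  have "cuts_out (line (cross p q)) (pt (1 *s p - 0 *s q)) (pt (0 *s p - 1 *s q))
      (pt ((3 * ?B) *s p - (3 * ?A) *s q))"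
    by (rule cuts_outI[OF n]) (use nz fe in \<open>auto simp: algebra_simps\<close>)
  moreover have "pt (0 *s p - 1 *s q) = pt q" using pt_scale[of "- 1" q] by simp
  moreover have "pt ((3 * ?B) *s p - (3 * ?A) *s q) = pt (?B *s p - ?A *s q)"
    using pt_scale[of 3 "?B *s p - ?A *s q"]
    by (simp add: vector_ssub_ldistrib vector_smult_assoc)
  ultimately show "cuts_out (line (cross p q)) (pt p) (pt q) (pt (?B *s p - ?A *s q))" by simp
  show "?B *s p - ?A *s q \<noteq> 0"
  proof
    assume 0: "?B *s p - ?A *s q = 0"
    obtain u v where uv: "dot u p = 1" "dot u q = 0" "dot v p = 0" "dot v q = 1"
      using dual_basis[OF n] by metis
    from 0 have "dot u (?B *s p - ?A *s q) = 0" "dot v (?B *s p - ?A *s q) = 0"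
      by (simp_all add: sp_3)
    then show False using nz unfolding sp_linear uv by simp
  qed
qed

text \<open>Here q is any second point of the tangent at p. The binary cubic has the double factor
  \<beta>^2, and the other factor is 3 B \<alpha> + G \<beta> with G =
  \<open>fermat q\<close>.\<close>

lemma third_point_tangent:
  fixes p q :: "'k::field_char_0 ^ 3"
  assumes n: "cross p q \<noteq> 0" and f: "fermat p = 0" "dot (sq p) q = 0"
  shows "cuts_out (line (cross p q)) (pt p) (pt p) (pt (fermat q *s p - (3 * dot (sq q) p) *s q))"
    and "fermat q *s p - (3 * dot (sq q) p) *s q \<noteq> 0"
    and "join_line (pt p) (pt p) = line (cross p q)"
proof -
  let ?G = "fermat q" and ?B = "dot (sq q) p"
  have fe: "fermat (\<alpha> *s p + \<beta> *s q) = \<beta> * \<beta> * (3 * ?B * \<alpha> + ?G * \<beta>)" for \<alpha> \<beta>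
    unfolding fermat_comb f by (simp add: algebra_simps power2_eq_square power3_eq_cube)
  have nz: "3 * ?B \<noteq> 0 \<or> ?G \<noteq> 0"
  proof (rule ccontr)
    assume "\<not> ?thesis"
    then have "fermat (\<alpha> *s p + \<beta> *s q) = 0" for \<alpha> \<beta> using fe by simp
    with fermat_no_line[OF n] span_line[OF n] show False by metis
  qed
  have "cuts_out (line (cross p q)) (pt (1 *s p - 0 *s q)) (pt (1 *s p - 0 *s q)) (pt (?G *s p - (3 * ?B) *s q))"
    by (rule cuts_outI[OF n]) (use nz fe in \<open>auto simp: algebra_simps\<close>)
  then show "cuts_out (line (cross p q)) (pt p) (pt p) (pt (?G *s p - (3 * ?B) *s q))" by simp
  show "?G *s p - (3 * ?B) *s q \<noteq> 0"
  proof
    assume 0: "?G *s p - (3 * ?B) *s q = 0"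
    obtain u v where uv: "dot u p = 1" "dot u q = 0" "dot v p = 0" "dot v q = 1"
      using dual_basis[OF n] by metis
    from 0 have "dot u (?G *s p - (3 * ?B) *s q) = 0" "dot v (?G *s p - (3 * ?B) *s q) = 0"
      by (simp_all add: sp_3)
    then show False using nz unfolding sp_linear uv by simp
  qed
  show "join_line (pt p) (pt p) = line (cross p q)"
    unfolding join_line_tangent
    by (rule line_unique[OF n sq_nonzero]) (use f cross_nonzeroD[OF n] in \<open>simp_all add: sp_sq_self\<close>)
qed

text \<open>The three test vectors span the plane orthogonal to \<open>sq p\<close>. If all were
  parallel to p, two coordinates of p would vanish, which is impossible on the cubic.\<close>

lemma tangent_direction:
  fixes p :: "'k::field_char_0 ^ 3"
  assumes "p \<noteq> 0" "fermat p = 0"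
  shows "\<exists>q. cross p q \<noteq> 0 \<and> dot (sq p) q = 0"
proof -
  let ?n = "sq p"
  let ?v1 = "vector [0, ?n $ 3, - ?n $ 2] :: 'k ^ 3" and ?v2 = "vector [- ?n $ 3, 0, ?n $ 1] :: 'k ^ 3"
    and ?v3 = "vector [?n $ 2, - ?n $ 1, 0] :: 'k ^ 3"
  have orth: "dot ?n ?v1 = 0" "dot ?n ?v2 = 0" "dot ?n ?v3 = 0"
    by (simp_all add: sp_3)
  have "cross p ?v1 \<noteq> 0 \<or> cross p ?v2 \<noteq> 0 \<or> cross p ?v3 \<noteq> 0"
  proof (rule ccontr)
    assume "\<not> ?thesis"
    then have "p $ 1 * ?n $ 2 = 0" "p $ 1 * ?n $ 3 = 0" "p $ 2 * ?n $ 1 = 0" "p $ 2 * ?n $ 3 = 0" "p $ 3 * ?n $ 1 = 0"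
      "p $ 3 * ?n $ 2 = 0" by (simp_all add: vec_eq_iff forall_3 cross_nth)
    then have "p $ 1 = 0 \<and> p $ 2 = 0 \<or> p $ 1 = 0 \<and> p $ 3 = 0 \<or> p $ 2 = 0 \<and> p $ 3 = 0" by (auto simp: sq_def)
    with assms show False by (auto simp: fermat_3 vec_eq_iff forall_3)
  qed
  with orth show ?thesis by blast
qed

lemma third_point_exists:
  fixes P Q :: "'k::field_char_0 point"
  assumes "P \<in> fermat_curve" "Q \<in> fermat_curve"
  shows "\<exists>p q R. cross p q \<noteq> 0 \<and> join_line P Q = line (cross p q) \<and> cuts_out (line (cross p q)) P Q R"
proof -
  obtain p where p: "p \<noteq> 0" "fermat p = 0" "P = pt p" using fermat_curve_cases[OF assms(1)] by blast
  obtain q where q: "q \<noteq> 0" "fermat q = 0" "Q = pt q" using fermat_curve_cases[OF assms(2)] by blast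
  show ?thesis
  proof (cases "cross p q = 0")
    case True
    then have "Q = P" using cross_0_pt p q by metis
    obtain v where "cross p v \<noteq> 0" "dot (sq p) v = 0" using tangent_direction p by blast
    with third_point_tangent[OF this(1) p(2) this(2)] \<open>Q = P\<close> p(3) show ?thesis by blast
  next
    case False
    with third_point_distinct[OF False p(2) q(2)] join_line_distinct p(3) q(3) show ?thesis by blast
  qed
qed

lemma cuts_out_third_point:
  fixes P Q :: "'k::field_char_0 point"
  assumes "P \<in> fermat_curve" "Q \<in> fermat_curve"
  shows "cuts_out (join_line P Q) P Q (third_point P Q)"
  using third_point_exists[OF assms] third_point_eqI by metis

lemma third_point_in:
  fixes P Q :: "'k::field_char_0 point"
  assumes "P \<in> fermat_curve" "Q \<in> fermat_curve"
  shows "third_point P Q \<in> fermat_curve"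
proof -
  have c: "cuts_out (join_line P Q) P Q (third_point P Q)" by (rule cuts_out_third_point[OF assms])
  obtain p q where pq: "join_line P Q = line (cross p q)" using third_point_exists[OF assms] by blast
  from cuts_out_mem(3)[OF c] have P2: "third_point P Q \<in> P2" by (auto simp: pq line_def)
  moreover have "fermat x = 0" if "x \<in> third_point P Q" for x
  proof -
    obtain a b d where d: "join_line P Q \<inter> line d = {third_point P Q}"
      and f: "\<forall>X\<in>join_line P Q. \<forall>x\<in>X. fermat x = dot a x * dot b x * dot d x"
      using c unfolding cuts_out_def by (elim exE conjE) (rule that)
    have "third_point P Q \<in> line d" using d by blast
    with that have "dot d x = 0" by (auto simp: line_def)
    with f that cuts_out_mem(3)[OF c] show ?thesis by simp
  qed
  ultimately show ?thesis by (auto simp: fermat_curve_def)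
qed

lemma join_line_commute: "join_line P Q = join_line Q P"
  by (simp add: join_line_def conj_commute)

lemma third_point_commute: "third_point P Q = third_point Q P"
proof -
  have "cuts_out l P Q = cuts_out l Q P" for l by (rule ext, rule iffI) (erule cuts_out_perm(1))+
  then show ?thesis unfolding third_point_def using join_line_commute[of P Q] by simp
qed

text \<open>\<open>cuts_out\<close> is symmetric in its three points, so the point at issue is that
  P and R span the same line as P and Q, also when R = P.\<close>

lemma third_point_third_point:
  fixes P Q :: "'k::field_char_0 point"
  assumes PQ: "P \<in> fermat_curve" "Q \<in> fermat_curve"
  shows "third_point P (third_point P Q) = Q"
proof -
  define R where "R = third_point P Q"
  obtain p q where n: "cross p q \<noteq> 0" and l: "join_line P Q = line (cross p q)" using third_point_exists[OF PQ] by blast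
  have c: "cuts_out (line (cross p q)) P Q R" using cuts_out_third_point[OF PQ] by (simp add: l R_def)
  note mem = cuts_out_mem[OF c]
  have "join_line P R = line (cross p q)"
  proof (cases "R = P")
    case False
    have "P \<in> P2" "R \<in> P2" using mem by (simp_all add: line_def)
    then obtain p' r' where p': "p' \<noteq> 0" "P = pt p'" and r': "r' \<noteq> 0" "R = pt r'"
      using P2_cases[of P] P2_cases[of R] by blast
    then have "cross p' r' \<noteq> 0" using False cross_0_pt by metis
    from join_line_distinct[OF this] line_unique[OF this n] p' r' mem show ?thesis by (simp add: pt_line)
  next
    \<comment> \<open>Now P is a double zero on the line, so along p' + u v the cubic has no term
      linear in u; hence the line is the tangent at P.\<close>
    case True
    have "P \<in> P2" using mem(1) by (simp add: line_def)
    then obtain p' where p': "p' \<noteq> 0" "P = pt p'" using P2_cases by blast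
    obtain a b d where abd: "line (cross p q) \<inter> line a = {P}" "line (cross p q) \<inter> line d = {P}"
      and f': "\<forall>X\<in>line (cross p q). \<forall>x\<in>X. fermat x = dot a x * dot b x * dot d x"
      using c[unfolded True] unfolding cuts_out_def by (elim exE conjE) (rule that)
    note f = f'[rule_format]
    have "P \<in> line a" "P \<in> line d" using abd by blast+
    then have ad: "dot a p' = 0" "dot d p' = 0" using p' by (simp_all add: pt_line)
    have lp: "dot (cross p q) p' = 0" using mem(1) p' by (simp add: pt_line)
    have tang: "dot (sq p') v = 0" if v: "dot (cross p q) v = 0" for v
    proof -
      have F: "fermat (1 *s p' + u *s v) = u^2 * (dot a v * (dot b p' + u * dot b v) * dot d v)" for u
      proof (cases "p' + u *s v = 0")
        case True
        then have "dot a (p' + u *s v) = 0" "fermat (p' + u *s v) = 0" by (simp_all add: sp_3 fermat_3)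
        then show ?thesis by (auto simp: sp_linear ad)
      next
        case False
        then have "pt (p' + u *s v) \<in> line (cross p q)" using v lp by (simp add: pt_line sp_linear)
        from f[OF this self_pt]
        have "fermat (p' + u *s v) = u * dot a v * (dot b p' + u * dot b v) * (u * dot d v)"
          by (simp only: sp_linear ad add_0_left)
        then show ?thesis by (simp add: power2_eq_square)
      qed
      have "[:fermat p', 3 * dot (sq p') v, 3 * dot (sq v) p', fermat v:]
        = [:0, 0, 1:] * [:dot a v * dot b p' * dot d v, dot a v * dot b v * dot d v:]"
        (is "?p = ?q")
      proof (rule poly_eq_poly_eq_iff[THEN iffD1], rule ext)
        show "poly ?p u = poly ?q u" for u
          using F[of u] unfolding fermat_comb by (simp add: algebra_simps power2_eq_square power3_eq_cube)
      qed
      then show ?thesis by simp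
    qed
    have "fermat p' = 0" using tang[OF lp] by (simp add: sp_sq_self)
    have "line (sq p') = line (cross p q)"
      by (rule line_unique[OF n sq_nonzero[OF p'(1)]]) (simp_all add: tang sp_cross)
    then show ?thesis by (simp add: True p'(2) join_line_tangent)
  qed
  from third_point_eqI[OF cuts_out_perm(2)[OF c] n this] show ?thesis by (simp add: R_def)
qed

subsection \<open>The chord-and-tangent operation\<close>

lemma flexO_curve: "(flexO :: 'k::field_char_0 point) \<in> fermat_curve"
  and third_point_flexO_flexO: "third_point flexO flexO = (flexO :: 'k::field_char_0 point)"
proof -
  let ?o = "vector [1, - 1, 0] :: 'k ^ 3" and ?q = "vector [0, 0, 1] :: 'k ^ 3"
  have o: "?o \<noteq> 0" "fermat ?o = 0" by (simp_all add: vec_eq_iff forall_3 fermat_3)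
  then show "(flexO :: 'k point) \<in> fermat_curve" by (simp add: flexO_def pt_fermat_curve)
  have n: "cross ?o ?q \<noteq> 0" "dot (sq ?o) ?q = 0"
    by (simp_all add: vec_eq_iff forall_3 cross_nth sp_sq)
  have "third_point flexO flexO = pt (fermat ?q *s ?o - (3 * dot (sq ?q) ?o) *s ?q)"
    unfolding flexO_def
    by (rule third_point_eqI[OF third_point_tangent(1)[OF n(1) o(2) n(2)] n(1) third_point_tangent(3)[OF n(1) o(2) n(2)]])
  also have "fermat ?q *s ?o - (3 * dot (sq ?q) ?o) *s ?q = ?o"
    by (simp add: vec_eq_iff forall_3 fermat_3 sp_sq)
  finally show "third_point flexO flexO = (flexO :: 'k point)" by (simp add: flexO_def)
qed

text \<open>The line through [x:y:z] and [1:-1:0] contains [y:x:z], so swapping the first two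
  coordinates is the negation of the group law. The point \<open>flexO\<close> is fixed, being a
  flex.\<close>

lemma third_point_flexO:
  fixes x y z :: "'k::field_char_0"
  assumes "vector [x, y, z] \<noteq> (0 :: 'k ^ 3)" "x ^ 3 + y ^ 3 + z ^ 3 = 0"
  shows "third_point (pt (vector [x, y, z])) flexO = pt (vector [y, x, z])"
proof (cases "cross (vector [x, y, z]) (vector [1, - 1, 0] :: 'k ^ 3) = 0")
  case True
  have "pt (vector [x, y, z]) = flexO" unfolding flexO_def
    by (rule cross_0_pt[OF True assms(1)]) (simp add: vec_eq_iff forall_3)
  moreover have "pt (vector [y, x, z]) = flexO" unfolding flexO_def
    by (rule cross_0_pt) (use True assms(1) in \<open>auto simp: vec_eq_iff forall_3 cross_nth\<close>)
  ultimately show ?thesis by (simp add: third_point_flexO_flexO)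
next
  case False
  let ?p = "vector [x, y, z] :: 'k ^ 3" and ?o = "vector [1, - 1, 0] :: 'k ^ 3"
  have f: "fermat ?p = 0" "fermat ?o = 0" using assms(2) by (simp_all add: fermat_3)
  have e: "dot (sq ?o) ?p *s ?p - dot (sq ?p) ?o *s ?o = (x + y) *s vector [y, x, z]"
    by (simp add: vec_eq_iff forall_3 sp_sq) (simp add: algebra_simps power2_eq_square)
  have "x + y \<noteq> 0" using third_point_distinct(2)[OF False f] unfolding e by (metis vector_smult_lzero)
  have "third_point (pt ?p) (pt ?o) = pt (dot (sq ?o) ?p *s ?p - dot (sq ?p) ?o *s ?o)"
    by (rule third_point_eqI[OF third_point_distinct(1)[OF False f] False join_line_distinct[OF False]])
  also have "\<dots> = pt (vector [y, x, z])" unfolding e by (rule pt_scale[OF \<open>x + y \<noteq> 0\<close>])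
  finally show ?thesis by (simp add: flexO_def)
qed

lemma EK_simps: "carrier EK = fermat_curve" "\<one>\<^bsub>EK\<^esub> = flexO"
  "P \<otimes>\<^bsub>EK\<^esub> Q = third_point (third_point P Q) flexO"
  by (simp_all add: EK_def)

text \<open>\<open>m_inv\<close> is a description, so uniqueness has to be shown: a product equal to
  \<open>flexO\<close> forces \<open>third_point P Q\<close> to be \<open>flexO\<close>, because
  \<open>flexO\<close> is a flex, and \<open>third_point_third_point\<close> recovers Q.\<close>

lemma inv_EK:
  fixes P :: "'k::field_char_0 point"
  assumes P: "P \<in> fermat_curve"
  shows "inv\<^bsub>EK\<^esub> P = third_point P flexO"
proof -
  have O: "(flexO :: 'k point) \<in> fermat_curve" by (rule flexO_curve)
  have 1: "third_point (third_point P (third_point P flexO)) flexO = flexO"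
    by (simp add: third_point_third_point[OF P O] third_point_flexO_flexO)
  have 2: "Q = third_point P flexO" if Q: "Q \<in> fermat_curve" "third_point (third_point P Q) flexO = flexO" for Q
  proof -
    have "third_point flexO (third_point flexO (third_point P Q)) = third_point P Q"
      by (rule third_point_third_point[OF O third_point_in[OF P Q(1)]])
    then have "third_point P Q = flexO"
      using Q(2) third_point_flexO_flexO third_point_commute[of flexO "third_point P Q"] by metis
    with third_point_third_point[OF P Q(1)] show ?thesis by simp
  qed
  show ?thesis unfolding m_inv_def EK_simps
  proof (rule the_equality, intro conjI)
    show "third_point (third_point (third_point P flexO) P) flexO = flexO"
      using 1 by (simp only: third_point_commute[of "third_point P flexO" P])
  qed (use 1 2 third_point_in[OF P O] in blast)+
qed

subsection \<open>The 6-torsion points and the lines through them\<close>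

text \<open>In the following criteria the scalar \<open>k\<close> is the factor between the coordinates produced by the
  formula for the third point and the chosen ones; \<open>k * k' = c\<close> with an integer \<open>c\<close> shows \<open>k \<noteq> 0\<close>.\<close>

lemma EK_multI:
  fixes p1 p2 p3 q1 q2 q3 r1 r2 r3 :: "'k::field_char_0"
  assumes k: "k * k' = c" "c \<noteq> 0"
    and P: "P = pt (vector [p1, p2, p3])" and Q: "Q = pt (vector [q1, q2, q3])"
    and r1: "r1 = 1 \<or> r2 = 1"
    and p: "p1 * p1 * p1 + p2 * p2 * p2 + p3 * p3 * p3 = 0" and q: "q1 * q1 * q1 + q2 * q2 * q2 + q3 * q3 * q3 = 0"
    and r: "r1 * r1 * r1 + r2 * r2 * r2 + r3 * r3 * r3 = 0"
    and e: "(p1 * q1 * q1 + p2 * q2 * q2 + p3 * q3 * q3) * p1 - (p1 * p1 * q1 + p2 * p2 * q2 + p3 * p3 * q3) * q1 = k * r2"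
      "(p1 * q1 * q1 + p2 * q2 * q2 + p3 * q3 * q3) * p2 - (p1 * p1 * q1 + p2 * p2 * q2 + p3 * p3 * q3) * q2 = k * r1"
      "(p1 * q1 * q1 + p2 * q2 * q2 + p3 * q3 * q3) * p3 - (p1 * p1 * q1 + p2 * p2 * q2 + p3 * p3 * q3) * q3 = k * r3"
  shows "P \<otimes>\<^bsub>EK\<^esub> Q = pt (vector [r1, r2, r3])"
proof -
  let ?p = "vector [p1, p2, p3] :: 'k ^ 3" and ?q = "vector [q1, q2, q3] :: 'k ^ 3" and ?r = "vector [r2, r1, r3] :: 'k ^ 3"
  have k0: "k \<noteq> 0" using k by auto
  have r0: "?r \<noteq> 0" using r1 by (auto simp: vec_eq_iff forall_3)
  have f: "fermat ?p = 0" "fermat ?q = 0" using p q by (simp_all add: fermat_3 power3_eq_cube)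
  have e: "dot (sq ?q) ?p *s ?p - dot (sq ?p) ?q *s ?q = k *s ?r"
    using e by (simp add: vec_eq_iff forall_3 sp_sq) (simp add: algebra_simps power2_eq_square)
  \<comment> \<open>Proportional p and q would make the left-hand side of e zero, so the nonzero k
    also shows that the points are distinct.\<close>
  have n: "cross ?p ?q \<noteq> 0"
  proof
    assume n: "cross ?p ?q = 0"
    have "?p \<noteq> 0 \<and> ?q \<noteq> 0" using e k0 r0 by (auto simp: vec_eq_iff forall_3 sp_sq)
    then obtain a where "?p = a *s ?q" using cross_0_pt[OF n] pt_eqD by metis
    then have "dot (sq ?q) ?p *s ?p - dot (sq ?p) ?q *s ?q = 0"
      using f(2) by (simp add: sp_linear sp_sq_self) (simp add: sp_sq fermat_3 vec_eq_iff forall_3, algebra)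
    with e k0 r0 show False by simp
  qed
  have "third_point P Q = pt (k *s ?r)"
    unfolding P Q e[symmetric] by (rule third_point_eqI[OF third_point_distinct(1)[OF n f] n join_line_distinct[OF n]])
  then show ?thesis
    using pt_scale[OF k0, of ?r] third_point_flexO[OF r0] r by (simp add: EK_simps power3_eq_cube add_ac)
qed

lemma EK_doubleI:
  fixes p q :: "'k::field_char_0 ^ 3"
  assumes "cross p (vector [y, x, z]) \<noteq> 0" "fermat p = 0" "dot (sq p) (vector [y, x, z]) = 0"
    "x ^ 3 + y ^ 3 + z ^ 3 = 0"
  shows "pt p \<otimes>\<^bsub>EK\<^esub> pt p = pt (vector [x, y, z])"
proof -
  let ?q = "vector [y, x, z] :: 'k ^ 3"
  note n = assms(1)
  \<comment> \<open>As q lies on the cubic, the coefficient of p in the formula of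
    \<open>third_point_tangent\<close> is 0 and the third point is q.\<close>
  have q: "fermat ?q = 0" using assms(4) by (simp add: fermat_3 add_ac)
  note t = third_point_tangent[OF n assms(2,3), unfolded q]
  define k where "k = - (3 * dot (sq ?q) p)"
  have e: "0 *s p - (3 * dot (sq ?q) p) *s ?q = k *s ?q" by (simp add: k_def vec_eq_iff)
  have "k \<noteq> 0" using t(2) unfolding e by auto
  have "third_point (pt p) (pt p) = pt (k *s ?q)"
    unfolding e[symmetric] by (rule third_point_eqI[OF t(1) n t(3)])
  also have "\<dots> = pt ?q" by (rule pt_scale[OF \<open>k \<noteq> 0\<close>])
  finally have "third_point (pt p) (pt p) = pt ?q" .
  then show ?thesis
    using third_point_flexO[of y x z] cross_nonzeroD(2)[OF n] assms(4) by (simp add: EK_simps add_ac)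
qed

lemma inv_EK_pt:
  fixes x y z :: "'k::field_char_0"
  assumes "vector [x, y, z] \<noteq> (0 :: 'k ^ 3)" "x ^ 3 + y ^ 3 + z ^ 3 = 0"
  shows "inv\<^bsub>EK\<^esub> (pt (vector [x, y, z])) = pt (vector [y, x, z])"
proof -
  have "pt (vector [x, y, z]) \<in> (fermat_curve :: 'k point set)"
    using assms by (simp add: pt_fermat_curve fermat_3)
  with third_point_flexO[OF assms] show ?thesis by (simp add: inv_EK)
qed

lemma join_lineI:
  fixes p1 p2 p3 q1 q2 q3 r1 r2 r3 :: "'k::field_char_0"
  assumes k: "k * k' = c" "c \<noteq> 0"
    and P: "P = pt (vector [p1, p2, p3])" and Q: "Q = pt (vector [q1, q2, q3])"
    and r: "r1 = 1 \<or> r2 = 1 \<or> r3 = 1"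
    and e: "p2 * q3 - p3 * q2 = k * r1" "p3 * q1 - p1 * q3 = k * r2" "p1 * q2 - p2 * q1 = k * r3"
  shows "join_line P Q = line (vector [r1, r2, r3])"
proof -
  let ?p = "vector [p1, p2, p3] :: 'k ^ 3" and ?q = "vector [q1, q2, q3] :: 'k ^ 3" and ?r = "vector [r1, r2, r3] :: 'k ^ 3"
  have k0: "k \<noteq> 0" using k by auto
  have cr: "cross ?p ?q = k *s ?r" using e by (simp add: vec_eq_iff forall_3 cross_nth)
  have "?r \<noteq> 0" using r by (auto simp: vec_eq_iff forall_3)
  with cr k0 have n: "cross ?p ?q \<noteq> 0" by auto
  have "dot ?r ?p = 0" "dot ?r ?q = 0"
    using sp_cross[of ?p ?q] k0 unfolding cr by (simp_all add: sp_linear)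
  with line_unique[OF n \<open>?r \<noteq> 0\<close>] join_line_distinct[OF n] show ?thesis unfolding P Q by simp
qed

lemma tangent_lineI:
  fixes p1 p2 p3 r1 r2 r3 :: "'k::field_char_0"
  assumes k: "k * k' = c" "c \<noteq> 0" and P: "P = pt (vector [p1, p2, p3])"
    and e: "p1 * p1 = k * r1" "p2 * p2 = k * r2" "p3 * p3 = k * r3"
  shows "join_line P P = line (vector [r1, r2, r3])"
proof -
  have k0: "k \<noteq> 0" using k by auto
  have "sq (vector [p1, p2, p3]) = k *s vector [r1, r2, r3]"
    using e by (simp add: vec_eq_iff forall_3 sq_def power2_eq_square)
  then have "join_line P P = line (k *s vector [r1, r2, r3])" unfolding P by (simp add: join_line_tangent)
  also have "\<dots> = line (vector [r1, r2, r3])" using k0 by (simp add: line_def sp_linear)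
  finally show ?thesis .
qed

locale torsion =
  fixes s t :: "'k::field_char_0"
  assumes s3: "s * s * s = - 2" and t2: "t * t + t + 1 = 0"
begin

lemma t3: "t * t * t = 1"
  using t2 by algebra

lemma cubes: "s ^ 3 = - 2" "t ^ 3 = 1"
  using s3 t3 by (simp_all add: power3_eq_cube)

lemma s_nonzero: "s \<noteq> 0"
  using s3 by auto

text \<open>Rewrite rules towards the monomials s^i t^j with i at most 2 and j at most 1; they
  reduce the explicit identities of the tables to comparing coefficients.\<close>

lemma s_t_simps: "s * (s * s) = - 2" "s * (s * (s * x)) = - 2 * x" "t * t = - t - 1" "t * (t * x) = - (t * x) - x"
  using s3 t2 by algebra+

lemmas ring = algebra_simps s_t_simps

lemma nat_pow_steps:
  "(x :: 'k point) [^]\<^bsub>EK\<^esub> (1::nat) = flexO \<otimes>\<^bsub>EK\<^esub> x" "x [^]\<^bsub>EK\<^esub> (2::nat) = x [^]\<^bsub>EK\<^esub> (1::nat) \<otimes>\<^bsub>EK\<^esub> x"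
  "x [^]\<^bsub>EK\<^esub> (3::nat) = x [^]\<^bsub>EK\<^esub> (2::nat) \<otimes>\<^bsub>EK\<^esub> x" "x [^]\<^bsub>EK\<^esub> (4::nat) = x [^]\<^bsub>EK\<^esub> (3::nat) \<otimes>\<^bsub>EK\<^esub> x"
  "x [^]\<^bsub>EK\<^esub> (5::nat) = x [^]\<^bsub>EK\<^esub> (4::nat) \<otimes>\<^bsub>EK\<^esub> x" "x [^]\<^bsub>EK\<^esub> (6::nat) = x [^]\<^bsub>EK\<^esub> (5::nat) \<otimes>\<^bsub>EK\<^esub> x"
  "x [^]\<^bsub>EK\<^esub> (7::nat) = x [^]\<^bsub>EK\<^esub> (6::nat) \<otimes>\<^bsub>EK\<^esub> x"
  by (simp_all add: eval_nat_numeral EK_simps)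

lemma neg_pow: "0 < n \<Longrightarrow> x [^]\<^bsub>EK\<^esub> (- int n) = inv\<^bsub>EK\<^esub> (x [^]\<^bsub>EK\<^esub> n)"
  by (simp add: int_pow_def2)

lemma flexO_eq: "flexO = pt (vector [1, - 1, 0])"
  by (simp add: flexO_def)

lemma inv_pt:
  assumes "x = 1 \<or> y = 1" "x ^ 3 + y ^ 3 + z ^ 3 = 0"
  shows "inv\<^bsub>EK\<^esub> (pt (vector [x, y, z])) = pt (vector [y, x, z :: 'k])"
  by (rule inv_EK_pt) (use assms in \<open>auto simp: vec_eq_iff forall_3\<close>)

section \<open>Multiples of \<open>alpha\<close> and \<open>beta\<close>\<close>

lemma alpha_1: "alpha s [^]\<^bsub>EK\<^esub> (1::nat) = pt (vector [1, s, 1])"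
  unfolding nat_pow_steps(1)
  by (rule EK_multI[OF _ _ flexO_eq alpha_def, of "- 1 - s" "1 - s + s * s" 1]) (simp_all add: ring)

lemma alpha_2: "alpha s [^]\<^bsub>EK\<^esub> (2::nat) = pt (vector [0, 1, - 1])"
  unfolding nat_pow_steps(2) alpha_1 unfolding alpha_def
  by (rule EK_doubleI) (simp_all add: vec_eq_iff forall_3 cross_nth fermat_3 sp_sq cubes t3 power2_eq_square s_nonzero)

lemma alpha_3: "alpha s [^]\<^bsub>EK\<^esub> (3::nat) = pt (vector [1, 1, s])"
  unfolding nat_pow_steps(3)
  by (rule EK_multI[OF _ _ alpha_2 alpha_def, of "- 1 - s" "1 - s + s * s" 1]) (simp_all add: ring)

lemma alpha_4: "alpha s [^]\<^bsub>EK\<^esub> (4::nat) = pt (vector [1, 0, - 1])"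
  unfolding nat_pow_steps(4)
  by (rule EK_multI[OF _ _ alpha_3 alpha_def, of 3 1 3]) (simp_all add: ring)

lemma alpha_5: "alpha s [^]\<^bsub>EK\<^esub> (5::nat) = pt (vector [s, 1, 1])"
  unfolding nat_pow_steps(5)
  by (rule EK_multI[OF _ _ alpha_4 alpha_def, of "- 2" "- 1" 2]) (simp_all add: ring)

lemma alpha_6: "alpha s [^]\<^bsub>EK\<^esub> (6::nat) = pt (vector [1, - 1, 0])"
  unfolding nat_pow_steps(6)
  by (rule EK_multI[OF _ _ alpha_5 alpha_def, of 3 1 3]) (simp_all add: ring)

text \<open>The index 3 - 2 * i goes down to -7, and a negative power is the inverse of a positive
  one.\<close>

lemma alpha_7: "alpha s [^]\<^bsub>EK\<^esub> (7::nat) = pt (vector [1, s, 1])"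
  unfolding nat_pow_steps(7)
  by (rule EK_multI[OF _ _ alpha_6 alpha_def, of "- 1 - s" "1 - s + s * s" 1]) (simp_all add: ring)

lemmas alpha_nat_pow = alpha_1 alpha_2 alpha_3 alpha_4 alpha_5 alpha_6 alpha_7

lemma alpha_pow:
  shows "alpha s [^]\<^bsub>EK\<^esub> (0::int) = pt (vector [1, - 1, 0])"
    "alpha s [^]\<^bsub>EK\<^esub> (1::int) = pt (vector [1, s, 1])"
    "alpha s [^]\<^bsub>EK\<^esub> (2::int) = pt (vector [0, 1, - 1])"
    "alpha s [^]\<^bsub>EK\<^esub> (3::int) = pt (vector [1, 1, s])"
    "alpha s [^]\<^bsub>EK\<^esub> (4::int) = pt (vector [1, 0, - 1])"
    "alpha s [^]\<^bsub>EK\<^esub> (5::int) = pt (vector [s, 1, 1])"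
  using int_pow_int[of EK "alpha s" 1, unfolded alpha_nat_pow]
    int_pow_int[of EK "alpha s" 2, unfolded alpha_nat_pow]
    int_pow_int[of EK "alpha s" 3, unfolded alpha_nat_pow]
    int_pow_int[of EK "alpha s" 4, unfolded alpha_nat_pow]
    int_pow_int[of EK "alpha s" 5, unfolded alpha_nat_pow]
  by (simp_all add: EK_simps flexO_eq)

text \<open>Reduction of 3 - 2 * i modulo 6, carried out on the computed coordinates.\<close>

lemma alpha_pow_reflect:
  shows "alpha s [^]\<^bsub>EK\<^esub> (3 - 2 * 0 :: int) = alpha s [^]\<^bsub>EK\<^esub> (3::int)"
    "alpha s [^]\<^bsub>EK\<^esub> (3 - 2 * 1 :: int) = alpha s [^]\<^bsub>EK\<^esub> (1::int)"
    "alpha s [^]\<^bsub>EK\<^esub> (3 - 2 * 2 :: int) = alpha s [^]\<^bsub>EK\<^esub> (5::int)"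
    "alpha s [^]\<^bsub>EK\<^esub> (3 - 2 * 3 :: int) = alpha s [^]\<^bsub>EK\<^esub> (3::int)"
    "alpha s [^]\<^bsub>EK\<^esub> (3 - 2 * 4 :: int) = alpha s [^]\<^bsub>EK\<^esub> (1::int)"
    "alpha s [^]\<^bsub>EK\<^esub> (3 - 2 * 5 :: int) = alpha s [^]\<^bsub>EK\<^esub> (5::int)"
  using neg_pow[of 1 "alpha s", unfolded alpha_nat_pow]
    neg_pow[of 3 "alpha s", unfolded alpha_nat_pow]
    neg_pow[of 5 "alpha s", unfolded alpha_nat_pow]
    neg_pow[of 7 "alpha s", unfolded alpha_nat_pow]
  by (simp_all add: alpha_pow inv_pt cubes power_mult_distrib)


lemma beta_1: "beta s t [^]\<^bsub>EK\<^esub> (1::nat) = pt (vector [s, 1, t])"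
  unfolding nat_pow_steps(1)
  by (rule EK_multI[OF _ _ flexO_eq beta_def, of "- 1 - s" "1 - s + s * s" 1]) (simp_all add: ring)

lemma beta_2: "beta s t [^]\<^bsub>EK\<^esub> (2::nat) = pt (vector [1, 0, - t])"
  unfolding nat_pow_steps(2) beta_1 unfolding beta_def
  by (rule EK_doubleI) (simp_all add: vec_eq_iff forall_3 cross_nth fermat_3 sp_sq cubes t3 power2_eq_square s_nonzero)

lemma beta_3: "beta s t [^]\<^bsub>EK\<^esub> (3::nat) = pt (vector [1, 1, s * t])"
  unfolding nat_pow_steps(3)
  by (rule EK_multI[OF _ _ beta_2 beta_def, of "- 1 - s" "1 - s + s * s" 1]) (simp_all add: ring)

lemma beta_4: "beta s t [^]\<^bsub>EK\<^esub> (4::nat) = pt (vector [0, 1, - t])"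
  unfolding nat_pow_steps(4)
  by (rule EK_multI[OF _ _ beta_3 beta_def, of 3 1 3]) (simp_all add: ring)

lemma beta_5: "beta s t [^]\<^bsub>EK\<^esub> (5::nat) = pt (vector [1, s, t])"
  unfolding nat_pow_steps(5)
  by (rule EK_multI[OF _ _ beta_4 beta_def, of "- 2" "- 1" 2]) (simp_all add: ring)

lemma beta_6: "beta s t [^]\<^bsub>EK\<^esub> (6::nat) = pt (vector [1, - 1, 0])"
  unfolding nat_pow_steps(6)
  by (rule EK_multI[OF _ _ beta_5 beta_def, of "- 3" "- 1" 3]) (simp_all add: ring)

lemma beta_7: "beta s t [^]\<^bsub>EK\<^esub> (7::nat) = pt (vector [s, 1, t])"
  unfolding nat_pow_steps(7)
  by (rule EK_multI[OF _ _ beta_6 beta_def, of "- 1 - s" "1 - s + s * s" 1]) (simp_all add: ring)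

lemmas beta_nat_pow = beta_1 beta_2 beta_3 beta_4 beta_5 beta_6 beta_7

lemma beta_pow:
  shows "beta s t [^]\<^bsub>EK\<^esub> (0::int) = pt (vector [1, - 1, 0])"
    "beta s t [^]\<^bsub>EK\<^esub> (1::int) = pt (vector [s, 1, t])"
    "beta s t [^]\<^bsub>EK\<^esub> (2::int) = pt (vector [1, 0, - t])"
    "beta s t [^]\<^bsub>EK\<^esub> (3::int) = pt (vector [1, 1, s * t])"
    "beta s t [^]\<^bsub>EK\<^esub> (4::int) = pt (vector [0, 1, - t])"
    "beta s t [^]\<^bsub>EK\<^esub> (5::int) = pt (vector [1, s, t])"
  using int_pow_int[of EK "beta s t" 1, unfolded beta_nat_pow]
    int_pow_int[of EK "beta s t" 2, unfolded beta_nat_pow]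
    int_pow_int[of EK "beta s t" 3, unfolded beta_nat_pow]
    int_pow_int[of EK "beta s t" 4, unfolded beta_nat_pow]
    int_pow_int[of EK "beta s t" 5, unfolded beta_nat_pow]
  by (simp_all add: EK_simps flexO_eq)

lemma beta_pow_reflect:
  shows "beta s t [^]\<^bsub>EK\<^esub> (3 - 2 * 0 :: int) = beta s t [^]\<^bsub>EK\<^esub> (3::int)"
    "beta s t [^]\<^bsub>EK\<^esub> (3 - 2 * 1 :: int) = beta s t [^]\<^bsub>EK\<^esub> (1::int)"
    "beta s t [^]\<^bsub>EK\<^esub> (3 - 2 * 2 :: int) = beta s t [^]\<^bsub>EK\<^esub> (5::int)"
    "beta s t [^]\<^bsub>EK\<^esub> (3 - 2 * 3 :: int) = beta s t [^]\<^bsub>EK\<^esub> (3::int)"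
    "beta s t [^]\<^bsub>EK\<^esub> (3 - 2 * 4 :: int) = beta s t [^]\<^bsub>EK\<^esub> (1::int)"
    "beta s t [^]\<^bsub>EK\<^esub> (3 - 2 * 5 :: int) = beta s t [^]\<^bsub>EK\<^esub> (5::int)"
  using neg_pow[of 1 "beta s t", unfolded beta_nat_pow]
    neg_pow[of 3 "beta s t", unfolded beta_nat_pow]
    neg_pow[of 5 "beta s t", unfolded beta_nat_pow]
    neg_pow[of 7 "beta s t", unfolded beta_nat_pow]
  by (simp_all add: beta_pow inv_pt cubes power_mult_distrib)

section \<open>Coordinates of the 36 torsion points\<close>

lemma T00: "torsion_pt s t 0 0 = pt (vector [1, - 1, 0])"
  by (simp only: torsion_pt_def alpha_pow beta_pow flexO_eq[symmetric] EK_simps third_point_flexO_flexO)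

lemma T01: "torsion_pt s t 0 1 = pt (vector [s, 1, t])"
  unfolding torsion_pt_def
  by (rule EK_multI[OF _ _ alpha_pow(1) beta_pow(2), of "- 1 - s" "1 - s + s * s" 1]) (simp_all add: ring)

lemma T02: "torsion_pt s t 0 2 = pt (vector [1, 0, - t])"
  unfolding torsion_pt_def
  by (rule EK_multI[OF _ _ alpha_pow(1) beta_pow(3), of "- 1" "- 1" 1]) (simp_all add: ring)

lemma T03: "torsion_pt s t 0 3 = pt (vector [1, 1, s * t])"
  unfolding torsion_pt_def
  by (rule EK_multI[OF _ _ alpha_pow(1) beta_pow(4), of "- 2" "- 1" 2]) (simp_all add: ring)

lemma T04: "torsion_pt s t 0 4 = pt (vector [0, 1, - t])"
  unfolding torsion_pt_def
  by (rule EK_multI[OF _ _ alpha_pow(1) beta_pow(5), of "- 1" "- 1" 1]) (simp_all add: ring)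

lemma T05: "torsion_pt s t 0 5 = pt (vector [1, s, t])"
  unfolding torsion_pt_def
  by (rule EK_multI[OF _ _ alpha_pow(1) beta_pow(6), of "- 1 - s" "1 - s + s * s" 1]) (simp_all add: ring)

lemma T10: "torsion_pt s t 1 0 = pt (vector [1, s, 1])"
  unfolding torsion_pt_def
  by (rule EK_multI[OF _ _ alpha_pow(2) beta_pow(1), of "1 + s" "- 1 + s - s * s" 1]) (simp_all add: ring)

lemma T11: "torsion_pt s t 1 1 = pt (vector [1, t, s * t])"
  unfolding torsion_pt_def
  by (rule EK_multI[OF _ _ alpha_pow(2) beta_pow(2), of "- 2 - t - 2 * s - s * t" "1 - t - s + s * t + s * s - s * s * t" 3]) (simp_all add: ring)

lemma T12: "torsion_pt s t 1 2 = pt (vector [s * t, 1, t * t])"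
  unfolding torsion_pt_def
  by (rule EK_multI[OF _ _ alpha_pow(2) beta_pow(3), of "- 1" "- 1" 1]) (simp_all add: ring)

lemma T13: "torsion_pt s t 1 3 = pt (vector [1, s * t * t, 1])"
  unfolding torsion_pt_def
  by (rule EK_multI[OF _ _ alpha_pow(2) beta_pow(4), of "1 + 2 * t + s - s * t" "1 + 2 * t - s + s * t - 2 * s * s - s * s * t" 3]) (simp_all add: ring)

lemma T14: "torsion_pt s t 1 4 = pt (vector [1, t, s * t * t])"
  unfolding torsion_pt_def
  by (rule EK_multI[OF _ _ alpha_pow(2) beta_pow(5), of "t - s - s * t" "1 + t + s - s * s * t" 1]) (simp_all add: ring)

lemma T15: "torsion_pt s t 1 5 = pt (vector [s, 1, t * t])"
  unfolding torsion_pt_def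
  by (rule EK_multI[OF _ _ alpha_pow(2) beta_pow(6), of "- 1 - 2 * t" "1 + 2 * t" 3]) (simp_all add: ring)

lemma T20: "torsion_pt s t 2 0 = pt (vector [0, 1, - 1])"
  unfolding torsion_pt_def
  by (rule EK_multI[OF _ _ alpha_pow(3) beta_pow(1), of 1 1 1]) (simp_all add: ring)

lemma T21: "torsion_pt s t 2 1 = pt (vector [1, s * t * t, t * t])"
  unfolding torsion_pt_def
  by (rule EK_multI[OF _ _ alpha_pow(3) beta_pow(2), of 1 1 1]) (simp_all add: ring)

lemma T22: "torsion_pt s t 2 2 = pt (vector [1, - (t * t), 0])"
  unfolding torsion_pt_def
  by (rule EK_multI[OF _ _ alpha_pow(3) beta_pow(3), of "1 + t" "- t" 1]) (simp_all add: ring)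

lemma T23: "torsion_pt s t 2 3 = pt (vector [s * t, 1, 1])"
  unfolding torsion_pt_def
  by (rule EK_multI[OF _ _ alpha_pow(3) beta_pow(4), of "- 1 - s * t" "1 - s * t - s * s - s * s * t" 1]) (simp_all add: ring)

lemma T24: "torsion_pt s t 2 4 = pt (vector [1, 0, - (t * t)])"
  unfolding torsion_pt_def
  by (rule EK_multI[OF _ _ alpha_pow(3) beta_pow(5), of "1 + 2 * t" "- 1 - 2 * t" 3]) (simp_all add: ring)

lemma T25: "torsion_pt s t 2 5 = pt (vector [1, t * t, s * t * t])"
  unfolding torsion_pt_def
  by (rule EK_multI[OF _ _ alpha_pow(3) beta_pow(6), of "1 + t - s * t" "t - s - s * s - s * s * t" 1]) (simp_all add: ring)

lemma T30: "torsion_pt s t 3 0 = pt (vector [1, 1, s])"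
  unfolding torsion_pt_def
  by (rule EK_multI[OF _ _ alpha_pow(4) beta_pow(1), of 2 1 2]) (simp_all add: ring)

lemma T31: "torsion_pt s t 3 1 = pt (vector [s * t, 1, t])"
  unfolding torsion_pt_def
  by (rule EK_multI[OF _ _ alpha_pow(4) beta_pow(2), of "1 + 2 * t - 2 * s - s * t" "1 + 2 * t + 2 * s + s * t + s * s - s * s * t" 3]) (simp_all add: ring)

lemma T32: "torsion_pt s t 3 2 = pt (vector [1, s * t * t, t])"
  unfolding torsion_pt_def
  by (rule EK_multI[OF _ _ alpha_pow(4) beta_pow(3), of "1 - s - s * t" "- 1 - s - s * t - s * s * t" 1]) (simp_all add: ring)

lemma T33: "torsion_pt s t 3 3 = pt (vector [1, 1, s * t * t])"
  unfolding torsion_pt_def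
  by (rule EK_multI[OF _ _ alpha_pow(4) beta_pow(4), of "2 + 4 * t" "- 1 - 2 * t" 6]) (simp_all add: ring)

lemma T34: "torsion_pt s t 3 4 = pt (vector [s * t * t, 1, t])"
  unfolding torsion_pt_def
  by (rule EK_multI[OF _ _ alpha_pow(4) beta_pow(5), of "1 - s - s * t" "- 1 - s - s * t - s * s * t" 1]) (simp_all add: ring)

lemma T35: "torsion_pt s t 3 5 = pt (vector [1, s * t, t])"
  unfolding torsion_pt_def
  by (rule EK_multI[OF _ _ alpha_pow(4) beta_pow(6), of "1 + 2 * t - 2 * s - s * t" "1 + 2 * t + 2 * s + s * t + s * s - s * s * t" 3]) (simp_all add: ring)

lemma T40: "torsion_pt s t 4 0 = pt (vector [1, 0, - 1])"
  unfolding torsion_pt_def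
  by (rule EK_multI[OF _ _ alpha_pow(5) beta_pow(1), of 1 1 1]) (simp_all add: ring)

lemma T41: "torsion_pt s t 4 1 = pt (vector [1, t, s])"
  unfolding torsion_pt_def
  by (rule EK_multI[OF _ _ alpha_pow(5) beta_pow(2), of "- t - s" "- 1 - t - s * t + s * s" 1]) (simp_all add: ring)

lemma T42: "torsion_pt s t 4 2 = pt (vector [0, 1, - (t * t)])"
  unfolding torsion_pt_def
  by (rule EK_multI[OF _ _ alpha_pow(5) beta_pow(3), of "1 + 2 * t" "- 1 - 2 * t" 3]) (simp_all add: ring)

lemma T43: "torsion_pt s t 4 3 = pt (vector [1, s * t, 1])"
  unfolding torsion_pt_def
  by (rule EK_multI[OF _ _ alpha_pow(5) beta_pow(4), of "- 1 - s * t" "1 - s * t - s * s - s * s * t" 1]) (simp_all add: ring)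

lemma T44: "torsion_pt s t 4 4 = pt (vector [1, - t, 0])"
  unfolding torsion_pt_def
  by (rule EK_multI[OF _ _ alpha_pow(5) beta_pow(5), of t "- 1 - t" 1]) (simp_all add: ring)

lemma T45: "torsion_pt s t 4 5 = pt (vector [s * t * t, 1, t * t])"
  unfolding torsion_pt_def
  by (rule EK_multI[OF _ _ alpha_pow(5) beta_pow(6), of 1 1 1]) (simp_all add: ring)

lemma T50: "torsion_pt s t 5 0 = pt (vector [s, 1, 1])"
  unfolding torsion_pt_def
  by (rule EK_multI[OF _ _ alpha_pow(6) beta_pow(1), of "1 + s" "- 1 + s - s * s" 1]) (simp_all add: ring)

lemma T51: "torsion_pt s t 5 1 = pt (vector [1, s, t * t])"
  unfolding torsion_pt_def
  by (rule EK_multI[OF _ _ alpha_pow(6) beta_pow(2), of "- 1 - 2 * t" "1 + 2 * t" 3]) (simp_all add: ring)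

lemma T52: "torsion_pt s t 5 2 = pt (vector [1, t * t, s * t])"
  unfolding torsion_pt_def
  by (rule EK_multI[OF _ _ alpha_pow(6) beta_pow(3), of "- 1 - t + s" "- t - s - s * t - s * s" 1]) (simp_all add: ring)

lemma T53: "torsion_pt s t 5 3 = pt (vector [s * t * t, 1, 1])"
  unfolding torsion_pt_def
  by (rule EK_multI[OF _ _ alpha_pow(6) beta_pow(4), of "1 + 2 * t + s - s * t" "1 + 2 * t - s + s * t - 2 * s * s - s * s * t" 3]) (simp_all add: ring)

lemma T54: "torsion_pt s t 5 4 = pt (vector [1, s * t, t * t])"
  unfolding torsion_pt_def
  by (rule EK_multI[OF _ _ alpha_pow(6) beta_pow(5), of "- 1" "- 1" 1]) (simp_all add: ring)

lemma T55: "torsion_pt s t 5 5 = pt (vector [1, t * t, s])"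
  unfolding torsion_pt_def
  by (rule EK_multI[OF _ _ alpha_pow(6) beta_pow(6), of "1 - t + s - s * t" "- 2 - t + 2 * s + s * t - 2 * s * s - s * s * t" 3]) (simp_all add: ring)

text \<open>The indices i' and j' are 3 - 2 * i and 3 - 2 * j reduced modulo 6, so that the second
  point is found in the table. When i and j are both odd it is the first point itself, and the line
  is a tangent.\<close>

lemma L_lineI:
  assumes "torsion_pt s t i j = P" "alpha s [^]\<^bsub>EK\<^esub> (3 - 2 * i) = alpha s [^]\<^bsub>EK\<^esub> i'"
    "beta s t [^]\<^bsub>EK\<^esub> (3 - 2 * j) = beta s t [^]\<^bsub>EK\<^esub> j'" "torsion_pt s t i' j' = Q" "join_line P Q = l"
  shows "L_line s t i j = l"
  using assms by (simp add: L_line_def ell_def torsion_pt_def)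

lemma L00: "L_line s t 0 0 = line (vector [1, 1, s * s * t])"
  by (rule L_lineI[OF T00 alpha_pow_reflect(1) beta_pow_reflect(1) T33], rule join_lineI[OF _ _ refl refl, of "s + s * t" "s * s * t" 2]) (simp_all add: ring)

lemma L01: "L_line s t 0 1 = line (vector [0, 1, - (t * t)])"
  by (rule L_lineI[OF T01 alpha_pow_reflect(1) beta_pow_reflect(2) T31], rule join_lineI[OF _ _ refl refl, of "- s - 2 * s * t" "- (s * s) - 2 * s * s * t" 6]) (simp_all add: ring)

lemma L02: "L_line s t 0 2 = line (vector [t, s * s, 1])"
  by (rule L_lineI[OF T02 alpha_pow_reflect(1) beta_pow_reflect(3) T35], rule join_lineI[OF _ _ refl refl, of "s * t" "s * s + s * s * t" 2]) (simp_all add: ring)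

lemma L03: "L_line s t 0 3 = line (vector [1, - 1, 0])"
  by (rule L_lineI[OF T03 alpha_pow_reflect(1) beta_pow_reflect(4) T33], rule join_lineI[OF _ _ refl refl, of "- s - 2 * s * t" "- (s * s) - 2 * s * s * t" 6]) (simp_all add: ring)

lemma L04: "L_line s t 0 4 = line (vector [s * s * t * t, 1, t * t])"
  by (rule L_lineI[OF T04 alpha_pow_reflect(1) beta_pow_reflect(5) T31], rule join_lineI[OF _ _ refl refl, of "s + s * t" "s * s * t" 2]) (simp_all add: ring)

lemma L05: "L_line s t 0 5 = line (vector [- t, 0, 1])"
  by (rule L_lineI[OF T05 alpha_pow_reflect(1) beta_pow_reflect(6) T35], rule join_lineI[OF _ _ refl refl, of "- s + s * t" "2 * s * s + s * s * t" 6]) (simp_all add: ring)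

lemma L10: "L_line s t 1 0 = line (vector [- 1, 0, 1])"
  by (rule L_lineI[OF T10 alpha_pow_reflect(2) beta_pow_reflect(1) T13], rule join_lineI[OF _ _ refl refl, of "- (2 * s) - s * t" "s * s - s * s * t" 6]) (simp_all add: ring)

lemma L11: "L_line s t 1 1 = line (vector [1, t * t, s * s * t * t])"
  by (rule L_lineI[OF T11 alpha_pow_reflect(2) beta_pow_reflect(2) T11], rule tangent_lineI[OF _ _ refl, of 1 1 1]) (simp_all add: ring)

lemma L12: "L_line s t 1 2 = line (vector [0, 1, - t])"
  by (rule L_lineI[OF T12 alpha_pow_reflect(2) beta_pow_reflect(3) T15], rule join_lineI[OF _ _ refl refl, of "- (2 * s) - s * t" "s * s - s * s * t" 6]) (simp_all add: ring)

lemma L13: "L_line s t 1 3 = line (vector [1, s * s * t, 1])"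
  by (rule L_lineI[OF T13 alpha_pow_reflect(2) beta_pow_reflect(4) T13], rule tangent_lineI[OF _ _ refl, of 1 1 1]) (simp_all add: ring)

lemma L14: "L_line s t 1 4 = line (vector [1, - (t * t), 0])"
  by (rule L_lineI[OF T14 alpha_pow_reflect(2) beta_pow_reflect(5) T11], rule join_lineI[OF _ _ refl refl, of "- (2 * s) - s * t" "s * s - s * s * t" 6]) (simp_all add: ring)

lemma L15: "L_line s t 1 5 = line (vector [s * s, 1, t])"
  by (rule L_lineI[OF T15 alpha_pow_reflect(2) beta_pow_reflect(6) T15], rule tangent_lineI[OF _ _ refl, of 1 1 1]) (simp_all add: ring)

lemma L20: "L_line s t 2 0 = line (vector [s * s * t, 1, 1])"
  by (rule L_lineI[OF T20 alpha_pow_reflect(3) beta_pow_reflect(1) T53], rule join_lineI[OF _ _ refl refl, of "s + s * t" "s * s * t" 2]) (simp_all add: ring)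

lemma L21: "L_line s t 2 1 = line (vector [- (t * t), 0, 1])"
  by (rule L_lineI[OF T21 alpha_pow_reflect(3) beta_pow_reflect(2) T51], rule join_lineI[OF _ _ refl refl, of "2 * s + s * t" "- (s * s) + s * s * t" 6]) (simp_all add: ring)

lemma L22: "L_line s t 2 2 = line (vector [1, t, s * s])"
  by (rule L_lineI[OF T22 alpha_pow_reflect(3) beta_pow_reflect(3) T55], rule join_lineI[OF _ _ refl refl, of "s + s * t" "s * s * t" 2]) (simp_all add: ring)

lemma L23: "L_line s t 2 3 = line (vector [0, 1, - 1])"
  by (rule L_lineI[OF T23 alpha_pow_reflect(3) beta_pow_reflect(4) T53], rule join_lineI[OF _ _ refl refl, of "- s - 2 * s * t" "- (s * s) - 2 * s * s * t" 6]) (simp_all add: ring)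

lemma L24: "L_line s t 2 4 = line (vector [t * t, s * s * t * t, 1])"
  by (rule L_lineI[OF T24 alpha_pow_reflect(3) beta_pow_reflect(5) T51], rule join_lineI[OF _ _ refl refl, of s "- (s * s)" 2]) (simp_all add: ring)

lemma L25: "L_line s t 2 5 = line (vector [1, - t, 0])"
  by (rule L_lineI[OF T25 alpha_pow_reflect(3) beta_pow_reflect(6) T55], rule join_lineI[OF _ _ refl refl, of "- s - 2 * s * t" "- (s * s) - 2 * s * s * t" 6]) (simp_all add: ring)

lemma L30: "L_line s t 3 0 = line (vector [1, - 1, 0])"
  by (rule L_lineI[OF T30 alpha_pow_reflect(4) beta_pow_reflect(1) T33], rule join_lineI[OF _ _ refl refl, of "- (2 * s) - s * t" "s * s - s * s * t" 6]) (simp_all add: ring)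

lemma L31: "L_line s t 3 1 = line (vector [s * s * t * t, 1, t * t])"
  by (rule L_lineI[OF T31 alpha_pow_reflect(4) beta_pow_reflect(2) T31], rule tangent_lineI[OF _ _ refl, of 1 1 1]) (simp_all add: ring)

lemma L32: "L_line s t 3 2 = line (vector [- t, 0, 1])"
  by (rule L_lineI[OF T32 alpha_pow_reflect(4) beta_pow_reflect(3) T35], rule join_lineI[OF _ _ refl refl, of "s + 2 * s * t" "s * s + 2 * s * s * t" 6]) (simp_all add: ring)

lemma L33: "L_line s t 3 3 = line (vector [1, 1, s * s * t])"
  by (rule L_lineI[OF T33 alpha_pow_reflect(4) beta_pow_reflect(4) T33], rule tangent_lineI[OF _ _ refl, of 1 1 1]) (simp_all add: ring)

lemma L34: "L_line s t 3 4 = line (vector [0, 1, - (t * t)])"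
  by (rule L_lineI[OF T34 alpha_pow_reflect(4) beta_pow_reflect(5) T31], rule join_lineI[OF _ _ refl refl, of "- (2 * s) - s * t" "s * s - s * s * t" 6]) (simp_all add: ring)

lemma L35: "L_line s t 3 5 = line (vector [t, s * s, 1])"
  by (rule L_lineI[OF T35 alpha_pow_reflect(4) beta_pow_reflect(6) T35], rule tangent_lineI[OF _ _ refl, of "- 1 - t" t 1]) (simp_all add: ring)

lemma L40: "L_line s t 4 0 = line (vector [1, s * s * t, 1])"
  by (rule L_lineI[OF T40 alpha_pow_reflect(5) beta_pow_reflect(1) T13], rule join_lineI[OF _ _ refl refl, of "- s - s * t" "- (s * s * t)" 2]) (simp_all add: ring)

lemma L41: "L_line s t 4 1 = line (vector [1, - (t * t), 0])"
  by (rule L_lineI[OF T41 alpha_pow_reflect(5) beta_pow_reflect(2) T11], rule join_lineI[OF _ _ refl refl, of "- s - 2 * s * t" "- (s * s) - 2 * s * s * t" 6]) (simp_all add: ring)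

lemma L42: "L_line s t 4 2 = line (vector [s * s, 1, t])"
  by (rule L_lineI[OF T42 alpha_pow_reflect(5) beta_pow_reflect(3) T15], rule join_lineI[OF _ _ refl refl, of "s + s * t" "s * s * t" 2]) (simp_all add: ring)

lemma L43: "L_line s t 4 3 = line (vector [- 1, 0, 1])"
  by (rule L_lineI[OF T43 alpha_pow_reflect(5) beta_pow_reflect(4) T13], rule join_lineI[OF _ _ refl refl, of "- s - 2 * s * t" "- (s * s) - 2 * s * s * t" 6]) (simp_all add: ring)

lemma L44: "L_line s t 4 4 = line (vector [1, t * t, s * s * t * t])"
  by (rule L_lineI[OF T44 alpha_pow_reflect(5) beta_pow_reflect(5) T11], rule join_lineI[OF _ _ refl refl, of "s + s * t" "s * s * t" 2]) (simp_all add: ring)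

lemma L45: "L_line s t 4 5 = line (vector [0, 1, - t])"
  by (rule L_lineI[OF T45 alpha_pow_reflect(5) beta_pow_reflect(6) T15], rule join_lineI[OF _ _ refl refl, of "- s - 2 * s * t" "- (s * s) - 2 * s * s * t" 6]) (simp_all add: ring)

lemma L50: "L_line s t 5 0 = line (vector [0, 1, - 1])"
  by (rule L_lineI[OF T50 alpha_pow_reflect(6) beta_pow_reflect(1) T53], rule join_lineI[OF _ _ refl refl, of "- (2 * s) - s * t" "s * s - s * s * t" 6]) (simp_all add: ring)

lemma L51: "L_line s t 5 1 = line (vector [t * t, s * s * t * t, 1])"
  by (rule L_lineI[OF T51 alpha_pow_reflect(6) beta_pow_reflect(2) T51], rule tangent_lineI[OF _ _ refl, of t "- 1 - t" 1]) (simp_all add: ring)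

lemma L52: "L_line s t 5 2 = line (vector [1, - t, 0])"
  by (rule L_lineI[OF T52 alpha_pow_reflect(6) beta_pow_reflect(3) T55], rule join_lineI[OF _ _ refl refl, of "- (2 * s) - s * t" "s * s - s * s * t" 6]) (simp_all add: ring)

lemma L53: "L_line s t 5 3 = line (vector [s * s * t, 1, 1])"
  by (rule L_lineI[OF T53 alpha_pow_reflect(6) beta_pow_reflect(4) T53], rule tangent_lineI[OF _ _ refl, of 1 1 1]) (simp_all add: ring)

lemma L54: "L_line s t 5 4 = line (vector [- (t * t), 0, 1])"
  by (rule L_lineI[OF T54 alpha_pow_reflect(6) beta_pow_reflect(5) T51], rule join_lineI[OF _ _ refl refl, of "s - s * t" "- (2 * s * s) - s * s * t" 6]) (simp_all add: ring)

lemma L55: "L_line s t 5 5 = line (vector [1, t, s * s])"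
  by (rule L_lineI[OF T55 alpha_pow_reflect(6) beta_pow_reflect(6) T55], rule tangent_lineI[OF _ _ refl, of 1 1 1]) (simp_all add: ring)

lemmas L_line_table =
  L00 L01 L02 L03 L04 L05
  L10 L11 L12 L13 L14 L15
  L20 L21 L22 L23 L24 L25
  L30 L31 L32 L33 L34 L35
  L40 L41 L42 L43 L44 L45
  L50 L51 L52 L53 L54 L55

text \<open>In the table L(i, j) = L(i + 3, j + 3) with indices modulo 6: the third point of the
  line through a and 3 - 2a is a - 3 in the group. So 36 pairs give 18 coefficient vectors.\<close>

lemma L_lines_eq: "L_lines s t = line ` {vector [1, 1, s * s * t], vector [0, 1, - (t * t)], vector [t, s * s, 1],
    vector [1, - 1, 0], vector [s * s * t * t, 1, t * t], vector [- t, 0, 1],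
    vector [- 1, 0, 1], vector [1, t * t, s * s * t * t], vector [0, 1, - t],
    vector [1, s * s * t, 1], vector [1, - (t * t), 0], vector [s * s, 1, t],
    vector [s * s * t, 1, 1], vector [- (t * t), 0, 1], vector [1, t, s * s],
    vector [0, 1, - 1], vector [t * t, s * s * t * t, 1], vector [1, - t, 0]}" (is "_ = ?R")
proof -
  have "{0..5} = {0, 1, 2, 3, 4, 5 :: int}" by auto
  then have "L_lines s t = (\<Union>i\<in>{0, 1, 2, 3, 4, 5}. L_line s t i ` {0, 1, 2, 3, 4, 5})"
    unfolding L_lines_def by blast
  also have "\<dots> = ?R"
    by (simp only: UN_insert UN_empty image_insert image_empty L_line_table) auto
  finally show ?thesis .
qed

end

subsection \<open>Incidences of the configuration\<close>

lemma line_eq_proportional: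
  fixes a b :: "'k::field ^ 3"
  assumes "line a = line b" "a \<noteq> 0" "b \<noteq> 0"
  shows "\<exists>k. k \<noteq> 0 \<and> a = k *s b"
proof -
  have "dot b v = 0" if "dot a v = 0" for v
    using that assms(1) pt_line[of v a] pt_line[of v b] by (cases "v = 0") (auto simp: sp_3)
  from this[of "vector [0, a $ 3, - a $ 2]"] this[of "vector [- a $ 3, 0, a $ 1]"] this[of "vector [a $ 2, - a $ 1, 0]"]
  have "cross a b = 0" by (simp add: sp_3 vec_eq_iff forall_3 cross_nth algebra_simps)
  with cross_0_pt assms(2,3) pt_eqD show ?thesis by metis
qed

context cube_roots
begin

text \<open>Families 0 to 2 are the three pencils of \<Phi>, families 3 to 5 the linear factors of
  D; the index w in \<open>\<mu>\<close> makes counting and products uniform.\<close>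

definition coline :: "nat \<Rightarrow> 'k \<Rightarrow> 'k ^ 3" where
  "coline i w = [vector [0, 1, - w], vector [- w, 0, 1], vector [1, - w, 0],
     vector [1, w, w^2 * \<tau>], vector [w^2 * \<tau>, 1, w], vector [w, w^2 * \<tau>, 1]] ! i"

lemma coline_simps:
  "coline 0 w = vector [0, 1, - w]" "coline 1 w = vector [- w, 0, 1]" "coline 2 w = vector [1, - w, 0]"
  "coline 3 w = vector [1, w, w^2 * \<tau>]" "coline 4 w = vector [w^2 * \<tau>, 1, w]" "coline 5 w = vector [w, w^2 * \<tau>, 1]"
  by (simp_all add: coline_def)

lemma less_6: "{..<6 :: nat} = {0, 1, 2, 3, 4, 5}"
  by auto

lemma coline_nonzero: "i < 6 \<Longrightarrow> coline i w \<noteq> 0"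
proof -
  assume "i < 6"
  then have "i \<in> {0, 1, 2, 3, 4, 5}" using less_6 by blast
  then show ?thesis by (auto simp: coline_simps[unfolded One_nat_def] vec_eq_iff forall_3)
qed

text \<open>The cubes of the coordinates of \<open>coline i w\<close> do not depend on w, so
  comparing them up to k^3 separates the six families. Within a family a coordinate equal to 1 gives
  k = 1.\<close>

lemma coline_inj: "inj_on (\<lambda>(i, w). line (coline i w)) ({..<6} \<times> \<mu>)"
proof (rule inj_onI, clarify)
  fix i j v w
  assume i: "i < 6" and j: "j < 6" and v: "v \<in> \<mu>" and w: "w \<in> \<mu>" and "line (coline i v) = line (coline j w)"
  then obtain k where k: "coline i v = k *s coline j w"
    using line_eq_proportional coline_nonzero by metis
  have ij: "i \<in> {0, 1, 2, 3, 4, 5}" "j \<in> {0, 1, 2, 3, 4, 5}" using i j less_6 by blast+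
  define cubes :: "nat \<Rightarrow> 'k ^ 3" where "cubes n = [vector [0, 1, - 1], vector [- 1, 0, 1], vector [1, - 1, 0],
    vector [1, 1, 4], vector [4, 1, 1], vector [1, 4, 1]] ! n" for n
  have cubes: "coline n x $ l ^ 3 = cubes n $ l" if n: "n \<in> {0, 1, 2, 3, 4, 5}" and x: "x \<in> \<mu>" for n x l
  proof -
    have x3: "x ^ 3 = 1" "x ^ 6 = 1" using x mu_sq[OF x] by (simp_all add: mu_iff)
    have "\<forall>l. coline n x $ l ^ 3 = cubes n $ l"
      using n by (elim insertE emptyE; hypsubst)
        (simp_all add: forall_3 coline_def cubes_def power_mult_distrib x3 tau3)
    then show ?thesis by blast
  qed
  have c: "cubes i $ l = k ^ 3 * cubes j $ l" for l
    using cubes[OF ij(1) v, of l] cubes[OF ij(2) w, of l] unfolding k by (simp add: power_mult_distrib)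
  have "i = j"
    using ij c[of 1] c[of 2] c[of 3] by (elim insertE emptyE; hypsubst) (simp_all add: cubes_def)
  moreover have "coline i v $ l = k * coline i w $ l" for l using k \<open>i = j\<close> by simp
  from this[of 1] this[of 2] this[of 3] have "v = w"
    using ij(1) by (elim insertE emptyE; hypsubst) (simp_all add: coline_def)
  ultimately show "i = j \<and> v = w" ..
qed

section \<open>The number of lines through each of the 48 points\<close>

definition incidence :: "'k \<Rightarrow> 'k \<Rightarrow> 'k \<Rightarrow> nat" where
  "incidence x y z = card {w \<in> \<mu>. y = w * z} + card {w \<in> \<mu>. z = w * x} + card {w \<in> \<mu>. x = w * y}
     + card {w \<in> \<mu>. x + w * y + w^2 * \<tau> * z = 0} + card {w \<in> \<mu>. y + w * z + w^2 * \<tau> * x = 0}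
     + card {w \<in> \<mu>. z + w * x + w^2 * \<tau> * y = 0}"

definition config :: "'k point set set" where
  "config = (\<lambda>(i, w). line (coline i w)) ` ({..<6} \<times> \<mu>)"

lemma card_config: "card config = 18"
  unfolding config_def by (simp add: card_image[OF coline_inj] card_cartesian_product card_mu)

lemma incidence_card:
  assumes p: "vector [x, y, z] \<noteq> (0 :: 'k ^ 3)"
  shows "card {l \<in> config. pt (vector [x, y, z]) \<in> l} = incidence x y z"
proof -
  let ?p = "vector [x, y, z] :: 'k ^ 3"
  let ?S = "Sigma {..<6} (\<lambda>i. {w \<in> \<mu>. dot (coline i w) ?p = 0})"
  have "{l \<in> config. pt ?p \<in> l} = (\<lambda>(i, w). line (coline i w)) ` ?S"
    using p by (auto simp: config_def pt_line)
  moreover have "inj_on (\<lambda>(i, w). line (coline i w)) ?S"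
    by (rule inj_on_subset[OF coline_inj]) auto
  ultimately have "card {l \<in> config. pt ?p \<in> l} = card ?S" by (simp add: card_image)
  also have "\<dots> = (\<Sum>i<6. card {w \<in> \<mu>. dot (coline i w) ?p = 0})"
    by (rule card_SigmaI) (auto simp: finite_mu)
  also have "\<dots> = incidence x y z"
    unfolding less_6 by (simp add: coline_simps[unfolded One_nat_def] sp_3 incidence_def add_ac eq_neg_iff_add_eq_0 eq_commute[of _ "_ * _"])
  finally show ?thesis .
qed

lemma incidence_rot: "incidence y z x = incidence x y z"
  by (simp add: incidence_def add_ac)

text \<open>Keeps the lines of D away from the points with x^3 = y^3 = z^3: the cube of a + b is 8
  times a cube of an element of \<open>\<mu>\<close>, that is 8, or it is -1, but it would have to
  be -4.\<close>

lemma mu_sum_nonzero: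
  assumes "a \<in> \<mu>" "b \<in> \<mu>" "c \<in> \<mu>"
  shows "a + b + c * \<tau> \<noteq> 0"
proof
  assume "a + b + c * \<tau> = 0"
  then have "(a + b) ^ 3 = - ((c * \<tau>) ^ 3)" by algebra
  then have 1: "(a + b) ^ 3 = - 4" using assms(3) tau3 by (simp add: power_mult_distrib mu_iff)
  have "a ^ 3 = 1" "b ^ 3 = 1" using assms by (simp_all add: mu_iff)
  then have "(a - b) * (a^2 + a * b + b^2) = 0" by algebra
  then consider "a = b" | "a^2 + a * b + b^2 = 0" by auto
  then show False
  proof cases
    case 1
    with \<open>(a + b) ^ 3 = - 4\<close> \<open>b ^ 3 = 1\<close> have "(12 :: 'k) = 0" by algebra
    then show False by simp
  next
    case 2
    with 1 \<open>a ^ 3 = 1\<close> \<open>b ^ 3 = 1\<close> have "(3 :: 'k) = 0" by algebra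
    then show False by simp
  qed
qed

text \<open>Multiplication by a - \<tau> would give a^3 = \<tau>^3, that is 1 = 4.\<close>

lemma tau_square_nonzero:
  assumes "a \<in> \<mu>"
  shows "a^2 + a * \<tau> + \<tau>^2 \<noteq> 0"
proof
  assume "a^2 + a * \<tau> + \<tau>^2 = 0"
  moreover have "a ^ 3 = 1" using assms by (simp add: mu_iff)
  ultimately have "(3 :: 'k) = 0" using tau3 by algebra
  then show False by simp
qed

lemma card_mu_1: "w0 \<in> \<mu> \<Longrightarrow> (\<And>w. w \<in> \<mu> \<Longrightarrow> Q w \<longleftrightarrow> w = w0) \<Longrightarrow> card {w \<in> \<mu>. Q w} = 1"
proof -
  assume "w0 \<in> \<mu>" "\<And>w. w \<in> \<mu> \<Longrightarrow> Q w \<longleftrightarrow> w = w0"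
  then have "{w \<in> \<mu>. Q w} = {w0}" by auto
  then show ?thesis by simp
qed

lemma card_mu_0: "(\<And>w. w \<in> \<mu> \<Longrightarrow> \<not> Q w) \<Longrightarrow> card {w \<in> \<mu>. Q w} = 0"
  by (metis (mono_tags, lifting) card.empty empty_Collect_eq)

lemma mu_diff: "v \<in> \<mu> \<Longrightarrow> w \<in> \<mu> \<Longrightarrow> v^2 + v * w + w^2 = 0 \<longleftrightarrow> v \<noteq> w"
proof -
  assume v: "v \<in> \<mu>" and w: "w \<in> \<mu>"
  have "(v - w) * (v^2 + v * w + w^2) = 0" using v w unfolding mu_iff by algebra
  moreover have "v^2 + v^2 + v^2 \<noteq> 0" using mu_nonzero[OF v] by simp
  ultimately show ?thesis by (auto simp: power2_eq_square)
qed

lemma incidence_coordinate: "incidence 1 0 0 = 3"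
proof -
  have "{w \<in> \<mu>. (0 :: 'k) = w * 0} = \<mu>" by auto
  then show ?thesis using mu_nonzero tau_nonzero by (auto simp: incidence_def card_mu)
qed

text \<open>Triple points lie on exactly three lines, so the other lines must be excluded as well.
  For u in \<open>\<mu>\<close> three lines of \<Phi> meet. For \<tau> * u = 1 there are one line of
  \<Phi> and two of family 4. For the remaining roots there is one line each of \<Phi> and of
  families 3 and 5.\<close>

lemma incidence_triple:
  assumes w: "w \<in> \<mu>" and u: "septic u = 0"
  shows "incidence (w^2 * u) w 1 = 3"
proof -
  have w3: "w ^ 3 = 1" using w by (simp add: mu_iff)
  have v3: "v ^ 3 = 1" if "v \<in> \<mu>" for v using that by (simp add: mu_iff)
  have A: "card {v \<in> \<mu>. w = v * 1} = 1" by (rule card_mu_1[OF w]) auto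
  have BC: "card {v \<in> \<mu>. 1 = v * (w^2 * u)} = 0" "card {v \<in> \<mu>. w^2 * u = v * w} = 0" if "u ^ 3 \<noteq> 1"
  proof -
    show "card {v \<in> \<mu>. 1 = v * (w^2 * u)} = 0"
    proof (rule card_mu_0, rule notI)
      fix v assume v: "v \<in> \<mu>" and "1 = v * (w^2 * u)"
      with v3[OF v] w3 have "u ^ 3 = 1" by algebra
      with that show False by simp
    qed
    show "card {v \<in> \<mu>. w^2 * u = v * w} = 0"
    proof (rule card_mu_0, rule notI)
      fix v assume v: "v \<in> \<mu>" and "w^2 * u = v * w"
      with v3[OF v] w3 have "u ^ 3 = 1" by algebra
      with that show False by simp
    qed
  qed
  consider (mu) "u \<in> \<mu>" | (tau) "\<tau> * u = 1" | (nu) \<omega> where "\<omega> \<in> \<mu>" "u = - (\<tau> * \<omega> + \<omega>^2)"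
    using u E_root_cases[of u] by (auto simp: septic_def mu_iff)
  then show ?thesis
  proof cases
    case mu
    note m = mu_mult mu_sq w mu one_mu
    have u3: "u ^ 3 = 1" using mu by (simp add: mu_iff)
    have B: "card {v \<in> \<mu>. 1 = v * (w^2 * u)} = 1"
    proof (rule card_mu_1[of "w * u^2"])
      fix v
      show "1 = v * (w^2 * u) \<longleftrightarrow> v = w * u^2"
      proof
        assume "1 = v * (w^2 * u)" with w3 u3 show "v = w * u^2" by algebra
      next
        assume "v = w * u^2" with w3 u3 show "1 = v * (w^2 * u)" by algebra
      qed
    qed (intro m)
    have C: "card {v \<in> \<mu>. w^2 * u = v * w} = 1"
      by (rule card_mu_1[of "w * u"]) (use m mu_nonzero[OF w] in \<open>auto simp: power2_eq_square\<close>)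
    have D: "card {v \<in> \<mu>. w^2 * u + v * w + v^2 * \<tau> * 1 = 0} = 0"
      using mu_sum_nonzero[OF mu_mult[OF mu_sq[OF w] mu] mu_mult[OF _ w] mu_sq] by (intro card_mu_0) simp
    have E: "card {v \<in> \<mu>. w + v * 1 + v^2 * \<tau> * (w^2 * u) = 0} = 0"
    proof (rule card_mu_0)
      fix v assume v: "v \<in> \<mu>"
      have "v^2 * \<tau> * (w^2 * u) = (v^2 * (w^2 * u)) * \<tau>" by simp
      then show "w + v * 1 + v^2 * \<tau> * (w^2 * u) \<noteq> 0"
        using mu_sum_nonzero[OF w v mu_mult[OF mu_sq[OF v] mu_mult[OF mu_sq[OF w] mu]]]
        by (simp add: mult_ac)
    qed
    have F: "card {v \<in> \<mu>. 1 + v * (w^2 * u) + v^2 * \<tau> * w = 0} = 0"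
    proof (rule card_mu_0)
      fix v assume v: "v \<in> \<mu>"
      have "v^2 * \<tau> * w = (v^2 * w) * \<tau>" by simp
      then show "1 + v * (w^2 * u) + v^2 * \<tau> * w \<noteq> 0"
        using mu_sum_nonzero[OF one_mu mu_mult[OF v mu_mult[OF mu_sq[OF w] mu]] mu_mult[OF mu_sq[OF v] w]]
        by (simp add: mult_ac)
    qed
    show ?thesis unfolding incidence_def A B C D E F by simp
  next
    case tau
    have "u ^ 3 \<noteq> 1"
    proof
      assume "u ^ 3 = 1"
      then have "\<tau> ^ 3 = 1" using tau by algebra
      with tau3 show False by simp
    qed
    note BC = BC[OF this]
    have D: "card {v \<in> \<mu>. w^2 * u + v * w + v^2 * \<tau> * 1 = 0} = 0"
    proof (rule card_mu_0, rule notI)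
      fix v assume v: "v \<in> \<mu>" and "w^2 * u + v * w + v^2 * \<tau> * 1 = 0"
      then have "(v^2 * w)^2 + (v^2 * w) * \<tau> + \<tau>^2 = 0" using tau v3[OF v] w3 by algebra
      with tau_square_nonzero[OF mu_mult[OF mu_sq[OF v] w]] show False by simp
    qed
    have E: "card {v \<in> \<mu>. w + v * 1 + v^2 * \<tau> * (w^2 * u) = 0} = 2"
    proof -
      have "w + v * 1 + v^2 * \<tau> * (w^2 * u) = 0 \<longleftrightarrow> v \<noteq> w" if v: "v \<in> \<mu>" for v
      proof -
        have "w + v * 1 + v^2 * \<tau> * (w^2 * u) = w^2 * (v^2 + v * w + w^2)" using tau w3 by algebra
        then show ?thesis using mu_diff[OF v w] mu_nonzero[OF w] by simp
      qed
      then have "{v \<in> \<mu>. w + v * 1 + v^2 * \<tau> * (w^2 * u) = 0} = \<mu> - {w}" by auto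
      then show ?thesis using w card_mu finite_mu by simp
    qed
    have F: "card {v \<in> \<mu>. 1 + v * (w^2 * u) + v^2 * \<tau> * w = 0} = 0"
    proof (rule card_mu_0, rule notI)
      fix v assume v: "v \<in> \<mu>" and "1 + v * (w^2 * u) + v^2 * \<tau> * w = 0"
      then have "(v * w^2)^2 + (v * w^2) * \<tau> + \<tau>^2 = 0" using tau v3[OF v] w3 by algebra
      with tau_square_nonzero[OF mu_mult[OF v mu_sq[OF w]]] show False by simp
    qed
    show ?thesis unfolding incidence_def A BC D E F by simp
  next
    case nu
    have o3: "\<omega> ^ 3 = 1" using nu(1) by (simp add: mu_iff)
    have "u ^ 3 - 3 * \<tau> * u + 5 = 0" unfolding nu(2) by (rule nu_root[OF o3])
    note nf = nu_facts[OF this]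
    note BC = BC[OF nf(1)]
    have D: "card {v \<in> \<mu>. w^2 * u + v * w + v^2 * \<tau> * 1 = 0} = 1"
    proof (rule card_mu_1[of "w * \<omega>^2"])
      show "w * \<omega>^2 \<in> \<mu>" by (intro mu_mult mu_sq w nu(1))
      fix v assume v: "v \<in> \<mu>"
      show "w^2 * u + v * w + v^2 * \<tau> * 1 = 0 \<longleftrightarrow> v = w * \<omega>^2"
      proof
        assume "w^2 * u + v * w + v^2 * \<tau> * 1 = 0"
        \<comment> \<open>Dividing the equation of the line by w^2 shows that u is the root attached
          to v^2 * w, and \<open>nu_inj\<close> makes this parameter unique.\<close>
        then have "- (\<tau> * (v^2 * w) + (v^2 * w)^2) = - (\<tau> * \<omega> + \<omega>^2)"
          unfolding nu(2)[symmetric] using v3[OF v] w3 by algebra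
        then have "v^2 * w = \<omega>" using nu_inj mu_mult mu_sq v w nu(1) by (auto dest: inj_onD)
        with v3[OF v] w3 show "v = w * \<omega>^2" by algebra
      next
        assume "v = w * \<omega>^2"
        with nu(2) w3 o3 show "w^2 * u + v * w + v^2 * \<tau> * 1 = 0" by algebra
      qed
    qed
    have E: "card {v \<in> \<mu>. w + v * 1 + v^2 * \<tau> * (w^2 * u) = 0} = 0"
    proof (rule card_mu_0, rule notI)
      fix v assume v: "v \<in> \<mu>" and 0: "w + v * 1 + v^2 * \<tau> * (w^2 * u) = 0"
      show False
      proof (cases "v = w")
        case True
        have "w * (\<tau> * u + 2) = 0" using 0[unfolded True] w3 by algebra
        then have "\<tau> * u = - 2" using mu_nonzero[OF w] by (simp add: eq_neg_iff_add_eq_0)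
        with nf(3) show False by simp
      next
        case False
        then have "v^2 + v * w + w^2 = 0" using mu_diff[OF v w] by simp
        then have "\<tau> * u = 1" using 0 v3[OF v] w3 by algebra
        with nf(2) show False by simp
      qed
    qed
    have F: "card {v \<in> \<mu>. 1 + v * (w^2 * u) + v^2 * \<tau> * w = 0} = 1"
    proof (rule card_mu_1[of "w * \<omega>"])
      show "w * \<omega> \<in> \<mu>" by (intro mu_mult w nu(1))
      fix v assume v: "v \<in> \<mu>"
      show "1 + v * (w^2 * u) + v^2 * \<tau> * w = 0 \<longleftrightarrow> v = w * \<omega>"
      proof
        assume "1 + v * (w^2 * u) + v^2 * \<tau> * w = 0"
        then have "- (\<tau> * (v * w^2) + (v * w^2)^2) = - (\<tau> * \<omega> + \<omega>^2)"
          unfolding nu(2)[symmetric] using v3[OF v] w3 by algebra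
        then have "v * w^2 = \<omega>" using nu_inj mu_mult mu_sq v w nu(1) by (auto dest: inj_onD)
        with w3 show "v = w * \<omega>" by algebra
      next
        assume "v = w * \<omega>"
        with nu(2) w3 o3 show "1 + v * (w^2 * u) + v^2 * \<tau> * w = 0" by algebra
      qed
    qed
    show ?thesis unfolding incidence_def A BC D E F by simp
  qed
qed

text \<open>Bridge from the geometric definition of the triple points to the coordinate test: each
  point tested by \<open>vanishing\<close> lies on exactly three lines of
  \<open>config\<close>.\<close>

lemma vanishing_fn:
  assumes "\<And>P x. P \<in> {P \<in> P2. card {l \<in> config. P \<in> l} = 3} \<Longrightarrow> x \<in> P \<Longrightarrow> peval p x = 0"
  shows "vanishing (fn p)"
proof -
  have pt: "fn p x y z = 0" if "vector [x, y, z] \<noteq> (0 :: 'k ^ 3)" "incidence x y z = 3" for x y z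
    unfolding fn_def using that by (intro assms[OF _ self_pt]) (simp add: pt_P2 incidence_card)
  have 1: "fn p 1 0 0 = 0" "fn p 0 1 0 = 0" "fn p 0 0 1 = 0"
    using incidence_coordinate incidence_rot[of 0 0 1] incidence_rot[of 0 1 0]
    by (auto intro!: pt simp: vec_eq_iff forall_3)
  have 2: "fn p (w^2 * u) w 1 = 0" "fn p 1 (w^2 * u) w = 0" "fn p w 1 (w^2 * u) = 0"
    if "w \<in> \<mu>" "septic u = 0" for w u
    using incidence_triple[OF that] incidence_rot[of "w^2 * u" w 1] incidence_rot[of w 1 "w^2 * u"]
    by (auto intro!: pt simp: vec_eq_iff forall_3)
  show ?thesis unfolding vanishing_def van1_def using 1 2 by simp
qed

end

subsection \<open>Products of linear forms\<close>

lemma fn_prod: "finite S \<Longrightarrow> fn (\<Prod>a\<in>S. f a) x y z = (\<Prod>a\<in>S. fn (f a) x y z)"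
proof (induction S rule: finite_induct)
  case empty
  have "fn 1 x y z = 1" unfolding fn_def single_one[symmetric] peval_single by simp
  then show ?case by simp
qed (simp add: fn_mult)

lemma form_prod: "finite S \<Longrightarrow> (\<And>a. a \<in> S \<Longrightarrow> f a \<in> form 1) \<Longrightarrow> (\<lambda>x y z. \<Prod>a\<in>S. f a x y z) \<in> form (card S)"
proof (induction S rule: finite_induct)
  case empty
  show ?case using form_const[of 1] by simp
next
  case (insert a S)
  from form_mult[OF insert.prems[of a] insert.IH] insert show ?case by simp
qed

lemma form_1_linear: "g \<in> form 1 \<Longrightarrow> \<exists>a b c. g = (\<lambda>x y z. a * x + b * y + c * z)"
proof (induction rule: form.induct)
  case zero
  show ?case by (intro exI[of _ 0]) simp
next
  case (monomial i j k g e)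
  then obtain a b c where g: "g = (\<lambda>x y z. a * x + b * y + c * z)" by blast
  have "i = 1 \<and> j = 0 \<and> k = 0 \<or> i = 0 \<and> j = 1 \<and> k = 0 \<or> i = 0 \<and> j = 0 \<and> k = 1" using monomial(1) by linarith
  then have "(\<lambda>x y z. e * x ^ i * y ^ j * z ^ k + g x y z) =
    (\<lambda>x y z. (a + (if i = 1 then e else 0)) * x + (b + (if j = 1 then e else 0)) * y + (c + (if k = 1 then e else 0)) * z)"
    unfolding g by (elim disjE conjE; hypsubst) (simp_all add: distrib_right add_ac)
  then show ?case by blast
qed

text \<open>A linear form is determined by its zero line up to a nonzero scalar; the zero form is
  excluded because its zero set is the whole plane.\<close>

lemma linear_form_of_line:
  assumes "linear_form_of f (line v)" "v \<noteq> 0"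
  shows "\<exists>k. k \<noteq> 0 \<and> (\<forall>x. peval f x = k * dot v x)"
proof -
  have "fn f \<in> form 1" using assms(1) homogeneous_fn_form by (auto simp: linear_form_of_def)
  then obtain a b c where "fn f = (\<lambda>x y z. a * x + b * y + c * z)" using form_1_linear by blast
  then have f: "peval f x = dot (vector [a, b, c]) x" for x by (simp add: peval_fn sp_3)
  then have l: "line (vector [a, b, c]) = line v" using assms(1) by (simp add: linear_form_of_def line_def)
  have "vector [a, b, c] \<noteq> (0 :: 'a ^ 3)"
  proof
    assume "vector [a, b, c] = (0 :: 'a ^ 3)"
    with l have "pt x \<in> line v" if "x \<noteq> 0" for x using that pt_line[of x "vector [a, b, c]"] by (simp add: sp_0)
    from pt_line this have "dot v x = 0" if "x \<noteq> 0" for x using that by blast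
    from this[of "vector [1, 0, 0]"] this[of "vector [0, 1, 0]"] this[of "vector [0, 0, 1]"] assms(2)
    show False by (simp add: sp_3 vec_eq_iff forall_3)
  qed
  from line_eq_proportional[OF l this assms(2)] f show ?thesis by (metis sp_linear(4))
qed

lemma linear_form_exists: "\<exists>f. linear_form_of f (line v)"
proof -
  let ?X = "\<lambda>i. Poly_Mapping.single (Poly_Mapping.single i (1::nat)) (v $ i)"
  let ?f = "?X 1 + (?X 2 + ?X 3)"
  have mon: "(\<Prod>j\<in>UNIV. x $ j ^ lookup (Poly_Mapping.single i (1::nat)) j) = x $ i" for x :: "'a ^ 3" and i
    using exhaust_3[of i] by (elim disjE) (simp_all add: prod_UNIV_3 lookup_single)
  have "keys ?f \<subseteq> keys (?X 1) \<union> (keys (?X 2) \<union> keys (?X 3))"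
    using Poly_Mapping.keys_add[of "?X 1" "?X 2 + ?X 3"] Poly_Mapping.keys_add[of "?X 2" "?X 3"] by blast
  also have "\<dots> \<subseteq> {Poly_Mapping.single 1 1, Poly_Mapping.single 2 1, Poly_Mapping.single 3 1}"
    by simp
  finally have k: "m \<in> {Poly_Mapping.single 1 1, Poly_Mapping.single 2 1, Poly_Mapping.single 3 1}"
    if "m \<in> keys ?f" for m using that by blast
  have "homogeneous 1 ?f" unfolding homogeneous_def using k by (fastforce simp: sum_3 lookup_single)
  moreover have "peval ?f x = dot v x" for x
    unfolding peval_add peval_single mon sp_3 by simp
  ultimately show ?thesis by (auto simp: linear_form_of_def line_def)
qed

lemma ideal_gen_superset: "s \<in> S \<Longrightarrow> s \<in> ideal_gen S"
  unfolding ideal_gen_def by (rule module.span_base[OF module_times])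

text \<open>The extra factor r is what remains in the base case, where the power is the unit
  ideal.\<close>

lemma prod_ideal_power:
  assumes "finite S" "\<And>a. a \<in> S \<Longrightarrow> f a \<in> I"
  shows "(\<Prod>a\<in>S. f a) * r \<in> ideal_power I (card S)"
  using assms
proof (induction S rule: finite_induct)
  case (insert a S)
  then have "f a * ((\<Prod>a\<in>S. f a) * r) \<in> ideal_mult I (ideal_power I (card S))"
    unfolding ideal_mult_def by (intro ideal_gen_superset) auto
  with insert show ?case by (simp add: mult.assoc)
qed simp

context cube_roots
begin

lemma prod_mu: "(\<Prod>w\<in>\<mu>. f w) = f 1 * (f t * f (t^2))"
  using t_distinct by (simp add: \<mu>_def)

lemma prod_mu_linear: "(\<Prod>w\<in>\<mu>. a - w * b) = a ^ 3 - b ^ 3"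
proof -
  have "(a - 1 * b) * ((a - t * b) * (a - t^2 * b)) = a ^ 3 - b ^ 3" using t2 by algebra
  then show ?thesis by (simp only: prod_mu)
qed

text \<open>The cofactor D of \<Phi>, kept as a product of linear factors so that its value at
  [1:1:1] can be seen to be nonzero factor by factor.\<close>

definition nonfermat :: "'k \<Rightarrow> 'k \<Rightarrow> 'k \<Rightarrow> 'k" where
  "nonfermat x y z = (\<Prod>w\<in>\<mu>. x + w * y + w^2 * \<tau> * z) * ((\<Prod>w\<in>\<mu>. y + w * z + w^2 * \<tau> * x)
     * (\<Prod>w\<in>\<mu>. z + w * x + w^2 * \<tau> * y))"

lemma nonfermat_form: "nonfermat \<in> form 9"
proof -
  have "(\<lambda>x y z. \<Prod>w\<in>\<mu>. f w x y z) \<in> form 3" if "\<And>w. f w \<in> form 1" for f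
    using form_prod[OF finite_mu, of f] that by (simp add: card_mu)
  note prod3 = this
  have "nonfermat \<in> form (3 + (3 + 3))"
    unfolding nonfermat_def[abs_def] by (intro form_mult prod3 form_add form_scale form_x form_y form_z)
  then show ?thesis by simp
qed

lemma nonfermat_1: "nonfermat 1 1 1 \<noteq> 0"
  using mu_sum_nonzero[OF one_mu _ mu_sq] by (auto simp: nonfermat_def finite_mu)

text \<open>Each linear form is fixed only up to a scalar, so the product is \<Phi> * D up to one
  nonzero constant.\<close>

lemma config_product:
  assumes "\<And>l. l \<in> config \<Longrightarrow> linear_form_of (\<phi> l) l"
  shows "\<exists>k. k \<noteq> 0 \<and> (\<forall>x y z. fn (\<Prod>l\<in>config. \<phi> l) x y z =
    k * (((y ^ 3 - z ^ 3) * (z ^ 3 - x ^ 3) * (x ^ 3 - y ^ 3)) * nonfermat x y z))"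
proof -
  let ?I = "{..<6} \<times> \<mu>"
  have "\<exists>k. k \<noteq> 0 \<and> (\<forall>x. peval (\<phi> (line (coline i w))) x = k * dot (coline i w) x)" if "i < 6" "w \<in> \<mu>" for i w
    using that by (intro linear_form_of_line assms coline_nonzero) (auto simp: config_def)
  then obtain k where k: "\<And>i w. i < 6 \<Longrightarrow> w \<in> \<mu> \<Longrightarrow> k i w \<noteq> 0"
    "\<And>i w x. i < 6 \<Longrightarrow> w \<in> \<mu> \<Longrightarrow> peval (\<phi> (line (coline i w))) x = k i w * dot (coline i w) x"
    by metis
  have fin: "finite config" by (simp add: config_def finite_mu)
  have "fn (\<Prod>l\<in>config. \<phi> l) x y z = (\<Prod>i<6. \<Prod>w\<in>\<mu>. k i w) *
    (((y ^ 3 - z ^ 3) * (z ^ 3 - x ^ 3) * (x ^ 3 - y ^ 3)) * nonfermat x y z)" for x y z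
  proof -
    let ?v = "vector [x, y, z] :: 'k ^ 3"
    have "fn (\<Prod>l\<in>config. \<phi> l) x y z = (\<Prod>l\<in>config. peval (\<phi> l) ?v)"
      unfolding fn_prod[OF fin] by (simp add: fn_def)
    also have "\<dots> = (\<Prod>(i, w)\<in>?I. peval (\<phi> (line (coline i w))) ?v)"
      unfolding config_def by (subst prod.reindex[OF coline_inj]) (simp add: case_prod_unfold)
    also have "\<dots> = (\<Prod>i<6. \<Prod>w\<in>\<mu>. peval (\<phi> (line (coline i w))) ?v)"
      by (simp add: prod.cartesian_product)
    also have "\<dots> = (\<Prod>i<6. \<Prod>w\<in>\<mu>. k i w * dot (coline i w) ?v)"
      by (intro prod.cong refl) (simp add: k)
    also have "\<dots> = (\<Prod>i<6. \<Prod>w\<in>\<mu>. k i w) * (\<Prod>i<6. \<Prod>w\<in>\<mu>. dot (coline i w) ?v)"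
      by (simp add: prod.distrib)
    also have "(\<Prod>i<6. \<Prod>w\<in>\<mu>. dot (coline i w) ?v) =
        ((\<Prod>w\<in>\<mu>. y - w * z) * (\<Prod>w\<in>\<mu>. z - w * x) * (\<Prod>w\<in>\<mu>. x - w * y)) * nonfermat x y z"
      unfolding less_6 nonfermat_def by (simp add: coline_def sp_3 algebra_simps)
    finally show ?thesis unfolding prod_mu_linear .
  qed
  moreover have "(\<Prod>i<6. \<Prod>w\<in>\<mu>. k i w) \<noteq> 0" using k(1) by (simp add: finite_mu)
  ultimately show ?thesis by blast
qed

lemma config_product_not_in_square:
  assumes \<phi>: "\<And>l. l \<in> config \<Longrightarrow> linear_form_of (\<phi> l) l"
  shows "(\<Prod>l\<in>config. \<phi> l) \<notin> ideal_power (point_ideal {P \<in> P2. card {l \<in> config. P \<in> l} = 3}) 2"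
proof
  let ?Z = "{P \<in> P2. card {l \<in> config. P \<in> l} = 3}" and ?p = "\<Prod>l\<in>config. \<phi> l"
  assume p: "?p \<in> ideal_power (point_ideal ?Z) 2"
  have fin: "finite config" by (simp add: config_def finite_mu)
  obtain k where k: "k \<noteq> 0" "\<And>x y z. fn ?p x y z =
    k * (((y ^ 3 - z ^ 3) * (z ^ 3 - x ^ 3) * (x ^ 3 - y ^ 3)) * nonfermat x y z)"
    using config_product[of \<phi>] \<phi> by blast
  have "fn (\<phi> l) \<in> form 1" if "l \<in> config" for l
    using \<phi>[OF that] homogeneous_fn_form by (auto simp: linear_form_of_def)
  from form_prod[OF fin this] have "fn ?p \<in> form 18"
    by (simp add: card_config fn_prod[OF fin, abs_def])
  moreover have "fn ?p x (w * z) z = 0" "fn ?p x y (w * x) = 0" "fn ?p (w * y) y z = 0" if "w \<in> \<mu>" for w x y z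
    using that by (simp_all add: k(2) power_mult_distrib mu_iff)
  ultimately obtain G where G: "G \<in> form 9" "G 1 1 1 = 0"
    "\<And>x y z. fn ?p x y z = (y ^ 3 - z ^ 3) * (z ^ 3 - x ^ 3) * (x ^ 3 - y ^ 3) * G x y z"
    using ideal_square_nine_lines[OF vanishing_fn p] by blast
  have F: "(\<lambda>x y z. (y ^ 3 - z ^ 3) * (z ^ 3 - x ^ 3) * (x ^ 3 - y ^ 3)) \<in> form (3 * 1 + 3 * 1 + 3 * (1::nat))"
    by (intro form_mult form_diff form_power form_x form_y form_z)
  \<comment> \<open>Since \<Phi> vanishes at [1:1:1], the cofactors cannot be compared there by
    values; \<Phi> is first cancelled as a form.\<close>
  have "k * nonfermat 1 1 1 - G 1 1 1 = 0"
  proof (rule form_mult_eq_0[OF F, where h = "\<lambda>x y z. k * nonfermat x y z - G x y z"])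
    show "(\<lambda>x y z. k * nonfermat x y z - G x y z) \<in> form 9"
      by (intro form_diff form_scale nonfermat_form G(1))
    show "((y ^ 3 - z ^ 3) * (z ^ 3 - x ^ 3) * (x ^ 3 - y ^ 3)) * (k * nonfermat x y z - G x y z) = 0" for x y z
      using G(3)[of x y z] k(2)[of x y z] by algebra
    \<comment> \<open>The value of \<Phi> at (2, 1, 0).\<close>
    show "((1::'k) ^ 3 - 0 ^ 3) * (0 ^ 3 - 2 ^ 3) * (2 ^ 3 - 1 ^ 3) \<noteq> 0" by simp
  qed
  with nonfermat_1 k(1) G(2) show False by simp
qed

end

text \<open>At each point of the set exactly m of the linear forms vanish, so their product is in
  the m-th power of the ideal of that point; the other forms are a cofactor.\<close>

lemma product_in_symbolic_power:
  assumes fin: "finite C" and \<phi>: "\<And>l. l \<in> C \<Longrightarrow> linear_form_of (\<phi> l) l"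
  shows "(\<Prod>l\<in>C. \<phi> l) \<in> symbolic_power {P \<in> P2. card {l \<in> C. P \<in> l} = m} m"
  unfolding symbolic_power_def
proof (rule INT_I)
  fix P assume P: "P \<in> {P \<in> P2. card {l \<in> C. P \<in> l} = m}"
  let ?S = "{l \<in> C. P \<in> l}"
  have "\<phi> l \<in> point_ideal {P}" if "l \<in> ?S" for l
    using \<phi>[of l] that unfolding point_ideal_def by (intro ideal_gen_superset) (auto simp: linear_form_of_def)
  then have "(\<Prod>l\<in>?S. \<phi> l) * (\<Prod>l\<in>C - ?S. \<phi> l) \<in> ideal_power (point_ideal {P}) (card ?S)"
    using fin by (intro prod_ideal_power) auto
  also have "(\<Prod>l\<in>?S. \<phi> l) * (\<Prod>l\<in>C - ?S. \<phi> l) = (\<Prod>l\<in>C. \<phi> l)"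
    using prod.subset_diff[of ?S C \<phi>] fin by (simp add: mult.commute)
  finally show "(\<Prod>l\<in>C. \<phi> l) \<in> ideal_power (point_ideal {P}) m" using P by simp
qed

lemma config_eq_L_lines:
  assumes "torsion s t" "cube_roots t (s^2 * t)"
  shows "cube_roots.config t (s^2 * t) = L_lines s t"
proof -
  interpret torsion s t by fact
  interpret cube_roots t "s^2 * t" by fact
  \<comment> \<open>Because t^3 = 1, the coefficient w^2 * \<tau> runs through s^2 t, s^2 and s^2
    t^2, the entries found in the table of lines.\<close>
  have e: "t^2 * (s^2 * t) = s * s" "(t^2)^2 * (s^2 * t) = s * s * t * t" using t3 by algebra+
  have "config = (\<Union>i<6. line ` coline i ` \<mu>)" by (auto simp: config_def)
  also have "\<dots> = line ` (\<Union>i\<in>{0, 1, 2, 3, 4, 5}. coline i ` {1, t, t * t})"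
    unfolding less_6 \<mu>_def by (auto simp: power2_eq_square)
  also have "(\<Union>i\<in>{0, 1, 2, 3, 4, 5}. coline i ` {1, t, t * t}) = {vector [1, 1, s * s * t],
    vector [0, 1, - (t * t)], vector [t, s * s, 1], vector [1, - 1, 0], vector [s * s * t * t, 1, t * t],
    vector [- t, 0, 1], vector [- 1, 0, 1], vector [1, t * t, s * s * t * t], vector [0, 1, - t],
    vector [1, s * s * t, 1], vector [1, - (t * t), 0], vector [s * s, 1, t], vector [s * s * t, 1, 1],
    vector [- (t * t), 0, 1], vector [1, t, s * s], vector [0, 1, - 1], vector [t * t, s * s * t * t, 1],
    vector [1, - t, 0]}"
    by (simp only: UN_insert UN_empty image_insert image_empty coline_def)
      (simp add: e[unfolded power2_eq_square] power2_eq_square, blast)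
  finally show ?thesis unfolding L_lines_eq .
qed

theorem mainTheorem6:
  fixes s t :: K
  assumes s: "Rep_K s = - complex_of_real (root 3 2)"
    and t: "t ^ 3 = 1" "t \<noteq> 1"
  shows "\<not> symbolic_power (B_E6 s t) 3 \<subseteq> ideal_power (I_E6 s t) 2
    \<and> card (L_lines s t) = 18
    \<and> (\<forall>\<phi>. (\<forall>l\<in>L_lines s t. linear_form_of (\<phi> l) l) \<longrightarrow>
          (\<Prod>l\<in>L_lines s t. \<phi> l) \<in> symbolic_power (B_E6 s t) 3 \<and>
          (\<Prod>l\<in>L_lines s t. \<phi> l) \<notin> ideal_power (I_E6 s t) 2)"
proof -
  have "Rep_K (s * s * s) = Rep_K (- 1 - 1)"
  proof -
    have "complex_of_real (root 3 2) * complex_of_real (root 3 2) * complex_of_real (root 3 2)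
        = complex_of_real (root 3 2 ^ 3)" by (simp add: power3_eq_cube)
    also have "\<dots> = 2" by simp
    finally show ?thesis by (simp only: times_K.rep_eq minus_K.rep_eq uminus_K.rep_eq one_K.rep_eq s) simp
  qed
  then have s3: "s * s * s = - 2" by (simp add: Rep_K_inject)
  have "(t - 1) * (t * t + t + 1) = 0" using t(1) by algebra
  then have t2: "t * t + t + 1 = 0" using t(2) by simp
  have tors: "torsion s t" using s3 t2 by unfold_locales
  have roots: "cube_roots t (s^2 * t)"
  proof
    show "t^2 + t + 1 = 0" using t2 by (simp add: power2_eq_square)
    show "(s^2 * t) ^ 3 = 4" using s3 t(1) by algebra
  qed
  interpret cube_roots t "s^2 * t" by (rule roots)
  have L: "L_lines s t = config" by (rule config_eq_L_lines[OF tors roots, symmetric])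
  have Z: "B_E6 s t = {P \<in> P2. card {l \<in> config. P \<in> l} = 3}" by (simp add: B_E6_def L)
  have fin: "finite config" by (simp add: config_def finite_mu)
  have in_out: "(\<Prod>l\<in>config. \<phi> l) \<in> symbolic_power (B_E6 s t) 3 \<and> (\<Prod>l\<in>config. \<phi> l) \<notin> ideal_power (I_E6 s t) 2"
    if "\<forall>l\<in>config. linear_form_of (\<phi> l) l" for \<phi>
    unfolding I_E6_def Z using that fin by (intro conjI product_in_symbolic_power config_product_not_in_square) blast+
  have "\<forall>l\<in>config. \<exists>f. linear_form_of f l" using linear_form_exists by (auto simp: config_def)
  then obtain \<phi> where "\<forall>l\<in>config. linear_form_of (\<phi> l) l" by metis
  with in_out have "\<not> symbolic_power (B_E6 s t) 3 \<subseteq> ideal_power (I_E6 s t) 2" by blast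
  then show ?thesis using card_config in_out unfolding L by blast
qed

end
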